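(* There exist a constant $r_0>0$ and, for every $\delta>1$, a constant $C_\delta$ such that the following holds. Let $K\subset D$ be arbitrary bounded domains in $\Phi$ such that $D$ is the $r$-neighborhood of $K$ for some $r\ge r_0$. Then an arbitrary function $f\in H$ can be written in the form $$f=\sum_{\lambda\in\Lambda\cap D}\alpha^{\lambda}\mathbf{e}_{\lambda}+\sum_{\mu\in(\Lambda+\sharp)\cap (D\setminus K)}\omega^{\mu}\mathbf{e}_{\mu}+\phi_r$$ with complex coefficients $\alpha^\lambda,\omega^\mu$ and $\phi_r\in L_2(\mathbb{R})$, where for $f\in H^\delta$, $\delta>1$, $$\|\phi_r\|\le\left(\int_{\Phi\setminus D}|\langle f|\mathbf{e}_\mu\rangle|^2\,d\mu\right)^{1/2}+C_\delta\, r^{\delta}\exp(-r/e)\,\|f\|_\delta ,$$ and the constant $C_\delta$ does not depend on $K$ and $D$.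
   Context: The phase plane is $\Phi=\mathbb{R}\times\mathbb{R}$ with points $\lambda=(p,\theta)$, Euclidean norm $|\lambda|^2=p^2+\theta^2$ and Lebesgue measure $d\lambda=dp\,d\theta$. The $r$-neighborhood of a set $K\subset\Phi$ is taken with respect to the Euclidean distance. For $\lambda=(p,\theta)\in\Phi$ the Gabor function is $\mathbf{e}_\lambda(x)=2^{1/4}\exp(-\pi(x-p)^2+2\pi i\theta x)$, $x\in\mathbb{R}$. $\langle f|g\rangle=\int f\bar g\,dx$ and $\|\cdot\|$ are the scalar product and norm of $L_2=L_2(\mathbb{R})$. For $\delta>0$, $H^\delta$ is the space of $f\in L_2$ with $\|f\|_\delta:=\left(\int_\Phi(|\lambda|^{\delta}+1)|\langle f|\mathbf{e}_\lambda\rangle|^2d\lambda\right)^{1/2}<\infty$, and $H=\bigcup_{\delta>1}H^\delta$. $\Lambda=\mathbb{Z}\times\mathbb{Z}\subset\Phi$, $\sharp=(1/2,1/2)$, so $\Lambda+\sharp=(\mathbb{Z}+1/2)\times(\mathbb{Z}+1/2)$. In $\exp(-r/e)$, $e$ is Euler's number. *)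

theory Defs
  imports "HOL-Analysis.Analysis"
begin

text \<open>
  Points of the phase plane are pairs \<open>(p, \<theta>)\<close> of type \<^typ>\<open>real \<times> real\<close>; the norm and
  \<^term>\<open>lborel\<close> on this type are the Euclidean norm and the measure \<open>dp d\<theta>\<close>.
\<close>

text \<open>
  Elements of \<open>L\<^sub>2(\<real>)\<close> are handled through Borel representatives, so equality in \<open>L\<^sub>2\<close> is
  equality almost everywhere.
\<close>

definition L2 :: "(real \<Rightarrow> complex) set" where
  "L2 = {f. f \<in> borel_measurable lborel \<and> integrable lborel (\<lambda>x. (norm (f x))\<^sup>2)}"

definition L2_norm :: "(real \<Rightarrow> complex) \<Rightarrow> real" where
  "L2_norm f = sqrt (LINT x|lborel. (norm (f x))\<^sup>2)"

definition L2_inner :: "(real \<Rightarrow> complex) \<Rightarrow> (real \<Rightarrow> complex) \<Rightarrow> complex" where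
  "L2_inner f g = (LINT x|lborel. f x * cnj (g x))"

definition gabor :: "real \<times> real \<Rightarrow> real \<Rightarrow> complex" where
  "gabor z x = of_real (2 powr (1/4)) *
     exp (of_real (- pi * (x - fst z)\<^sup>2) + 2 * of_real pi * \<i> * of_real (snd z * x))"

text \<open>
  Finiteness of \<open>\<parallel>f\<parallel>\<^sub>\<delta>\<close> is integrability of the weighted transform; outside \<open>H\<^sup>\<delta>\<close> the value
  of \<open>H_norm\<close> is meaningless.
\<close>

definition H_norm :: "real \<Rightarrow> (real \<Rightarrow> complex) \<Rightarrow> real" where
  "H_norm \<delta> f = sqrt (LINT z|lborel. (norm z powr \<delta> + 1) * (norm (L2_inner f (gabor z)))\<^sup>2)"

definition H_delta :: "real \<Rightarrow> (real \<Rightarrow> complex) set" where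
  "H_delta \<delta> = {f \<in> L2. integrable lborel
     (\<lambda>z. (norm z powr \<delta> + 1) * (norm (L2_inner f (gabor z)))\<^sup>2)}"

definition H_space :: "(real \<Rightarrow> complex) set" where
  "H_space = (\<Union>\<delta>\<in>{1<..}. H_delta \<delta>)"

definition \<Lambda> :: "(real \<times> real) set" where
  "\<Lambda> = \<int> \<times> \<int>"

definition \<Lambda>_sharp :: "(real \<times> real) set" where
  "\<Lambda>_sharp = (\<lambda>z. z + (1/2, 1/2)) ` \<Lambda>"

definition bounded_domain :: "(real \<times> real) set \<Rightarrow> bool" where
  "bounded_domain K \<longleftrightarrow> open K \<and> connected K \<and> K \<noteq> {} \<and> bounded K"

definition neighborhood :: "real \<Rightarrow> (real \<times> real) set \<Rightarrow> (real \<times> real) set" where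
  "neighborhood r K = {z. \<exists>w\<in>K. dist z w < r}"

end

theory Submission
  imports Defs "HOL-Probability.Probability" "HOL-Complex_Analysis.Complex_Analysis"
begin

text \<open>
  Take for \<open>\<phi>\<close> the component of \<open>f\<close> orthogonal to all the Gabor functions in question, so that its transform
  \<open>V\<close> vanishes on \<open>\<Lambda> \<inter> D\<close> and on \<open>\<Lambda>_sharp \<inter> (D - K)\<close>. By Moyal's identity \<open>\<parallel>\<phi>\<parallel>\<^sup>2 = \<langle>f|\<phi>\<rangle>\<close> is the integral over
  the phase plane of the product of the transforms; the part outside \<open>D\<close> gives the first term of the estimate, and
  it remains to show that \<open>V\<close> is small in \<open>D\<close> in a weighted \<open>L\<^sub>2\<close> norm. Up to a Gaussian factor \<open>V\<close> is
  entire of Fock-space growth. In \<open>D - K\<close> its zeros have density two, twice what that growth allows, and dividing by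
  a finite Blaschke product makes \<open>V\<close> smaller than any \<open>exp (- c * r)\<close>, up to the boundary of \<open>D\<close>. Near \<open>K\<close>
  one divides by a theta function with the zeros \<open>\<Lambda>\<close> and recovers the quotient from a contour in
  \<open>D - K\<close> by Cauchy's formula.
\<close>

section \<open>Square-integrable functions\<close>

text \<open>The Jensen step rests on a balance of exponents. After multiplication by a Gaussian the
  modulus of V is that of an entire function of growth exp (pi |w|^2 / 2). Going from the circle of
  radius sqrt s * A to that of radius A, across the zeros of two lattices of density one in the disc
  of radius A, leaves in the ideal case the exponent (pi A^2 / 2) (s - 2 ln s), against pi A^2 / 2
  for the Gaussian at radius A. The value s = 2 minimises it, at about 0.61; hence the circles of
  radius sqrt 2 * A. For one lattice the bracket is s - ln s, never below 1, so near
  \<open>K\<close> this argument gives nothing and a theta function has to be divided out.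

  The other obstacle is uniformity in \<open>K\<close>. Pointwise bounds are therefore stated
  through \<open>smear\<close>, an average of the energy density whose sum over any set of lattice
  points is at most a constant times the squared norm, however long the contour around
  \<open>K\<close> is. Cauchy's kernel decays only like the inverse distance;
  \<open>hweight\<close>, the reciprocal of the weight in \<open>H_norm\<close>, supplies the
  missing decay.\<close>

lemma Cauchy_Schwarz_integral:
  fixes f g :: "'a \<Rightarrow> real"
  assumes [measurable]: "f \<in> borel_measurable M" "g \<in> borel_measurable M"
    and f: "integrable M (\<lambda>x. (f x)\<^sup>2)" and g: "integrable M (\<lambda>x. (g x)\<^sup>2)"
  shows "integrable M (\<lambda>x. f x * g x)"
    and "(LINT x|M. \<bar>f x * g x\<bar>) \<le> sqrt (LINT x|M. (f x)\<^sup>2) * sqrt (LINT x|M. (g x)\<^sup>2)"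
proof -
  show 1: "integrable M (\<lambda>x. f x * g x)"
  proof (rule Bochner_Integration.integrable_bound)
    show "integrable M (\<lambda>x. (f x)\<^sup>2 + (g x)\<^sup>2)" using f g by simp
    have "\<bar>f x * g x\<bar> \<le> (f x)\<^sup>2 + (g x)\<^sup>2" for x
    proof -
      have "0 \<le> (\<bar>f x\<bar> - \<bar>g x\<bar>)\<^sup>2" by simp
      then have "2 * \<bar>f x * g x\<bar> \<le> (f x)\<^sup>2 + (g x)\<^sup>2" by (simp add: power2_diff abs_mult)
      then show ?thesis by (smt (verit) zero_le_power2)
    qed
    then show "AE x in M. norm (f x * g x) \<le> norm ((f x)\<^sup>2 + (g x)\<^sup>2)" by simp
  qed simp
  have i: "integrable M (\<lambda>x. \<bar>f x * g x\<bar>)" using 1 by simp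
  have "(\<integral>\<^sup>+x. ennreal \<bar>f x\<bar> * ennreal \<bar>g x\<bar> \<partial>M)\<^sup>2 \<le> (\<integral>\<^sup>+x. ennreal \<bar>f x\<bar> ^ 2 \<partial>M) * (\<integral>\<^sup>+x. ennreal \<bar>g x\<bar> ^ 2 \<partial>M)"
    by (rule Cauchy_Schwarz_nn_integral) auto
  also have "(\<integral>\<^sup>+x. ennreal \<bar>f x\<bar> ^ 2 \<partial>M) = ennreal (LINT x|M. (f x)\<^sup>2)"
    using f by (simp add: ennreal_power nn_integral_eq_integral)
  also have "(\<integral>\<^sup>+x. ennreal \<bar>g x\<bar> ^ 2 \<partial>M) = ennreal (LINT x|M. (g x)\<^sup>2)"
    using g by (simp add: ennreal_power nn_integral_eq_integral)
  also have "(\<integral>\<^sup>+x. ennreal \<bar>f x\<bar> * ennreal \<bar>g x\<bar> \<partial>M) = ennreal (LINT x|M. \<bar>f x * g x\<bar>)"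
    using i by (simp add: ennreal_mult[symmetric] abs_mult[symmetric] nn_integral_eq_integral)
  finally have "ennreal ((LINT x|M. \<bar>f x * g x\<bar>)\<^sup>2) \<le> ennreal ((LINT x|M. (f x)\<^sup>2) * (LINT x|M. (g x)\<^sup>2))"
    by (simp add: ennreal_power ennreal_mult)
  then have "(LINT x|M. \<bar>f x * g x\<bar>)\<^sup>2 \<le> (LINT x|M. (f x)\<^sup>2) * (LINT x|M. (g x)\<^sup>2)"
    by (subst (asm) ennreal_le_iff) auto
  then show "(LINT x|M. \<bar>f x * g x\<bar>) \<le> sqrt (LINT x|M. (f x)\<^sup>2) * sqrt (LINT x|M. (g x)\<^sup>2)"
    by (metis real_le_rsqrt real_sqrt_mult)
qed

lemma borel_measurable_cnj [measurable]:
  "f \<in> borel_measurable M \<Longrightarrow> (\<lambda>x. cnj (f x)) \<in> borel_measurable M"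
  by (rule measurable_compose[OF _ borel_measurable_continuous_onI[of cnj]])
     (auto intro: continuous_on_cnj continuous_on_id)

lemma LIMSEQ_less: "X \<longlonglongrightarrow> (0::real) \<Longrightarrow> e > 0 \<Longrightarrow> \<forall>\<^sub>F n in sequentially. X n < e"
  by (rule order_tendstoD(2))

lemma L2_measurable [measurable_dest]: "f \<in> L2 \<Longrightarrow> f \<in> borel_measurable borel"
  by (simp add: L2_def)

lemma L2_integrable: "f \<in> L2 \<Longrightarrow> integrable lborel (\<lambda>x. (norm (f x))\<^sup>2)"
  by (simp add: L2_def)

lemma norm_add_sq: "(norm (a + b :: 'a::real_normed_vector))\<^sup>2 \<le> 2 * (norm a)\<^sup>2 + 2 * (norm b)\<^sup>2"
proof -
  have "(norm (a + b))\<^sup>2 \<le> (norm a + norm b)\<^sup>2" by (simp add: norm_triangle_ineq)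
  also have "\<dots> \<le> 2 * (norm a)\<^sup>2 + 2 * (norm b)\<^sup>2"
    using zero_le_power2[of "norm a - norm b"] by (simp add: power2_sum power2_diff)
  finally show ?thesis .
qed

lemma L2_add: assumes "f \<in> L2" "g \<in> L2" shows "(\<lambda>x. f x + g x) \<in> L2"
proof -
  note [measurable] = L2_measurable[OF assms(1)] L2_measurable[OF assms(2)]
  have "integrable lborel (\<lambda>x. (norm (f x + g x))\<^sup>2)"
    by (rule Bochner_Integration.integrable_bound[where f="\<lambda>x. 2 * (norm (f x))\<^sup>2 + 2 * (norm (g x))\<^sup>2"])
       (use assms in \<open>auto simp: L2_integrable intro!: norm_add_sq\<close>)
  then show ?thesis by (simp add: L2_def)
qed

lemma L2_scale: assumes "f \<in> L2" shows "(\<lambda>x. c * f x) \<in> L2"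
proof -
  note [measurable] = L2_measurable[OF assms(1)]
  show ?thesis using assms by (simp add: L2_def norm_mult power_mult_distrib)
qed

lemma L2_diff: assumes "f \<in> L2" "g \<in> L2" shows "(\<lambda>x. f x - g x) \<in> L2"
  using L2_add[OF assms(1) L2_scale[OF assms(2), of "-1"]] by simp

lemma L2_zero: "(\<lambda>x. 0) \<in> L2" by (simp add: L2_def)

lemma L2_sum: "(\<And>i. i \<in> I \<Longrightarrow> f i \<in> L2) \<Longrightarrow> (\<lambda>x. \<Sum>i\<in>I. f i x) \<in> L2"
  by (induction I rule: infinite_finite_induct) (auto simp: L2_zero L2_add)

lemma L2_inner_integrable:
  assumes "f \<in> L2" "g \<in> L2" shows "integrable lborel (\<lambda>x. f x * cnj (g x))"
proof -
  note [measurable] = L2_measurable[OF assms(1)] L2_measurable[OF assms(2)]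
  have "integrable lborel (\<lambda>x. norm (f x) * norm (g x))"
    by (rule Cauchy_Schwarz_integral) (use assms in \<open>auto simp: L2_integrable\<close>)
  then show ?thesis
    by (rule Bochner_Integration.integrable_bound) (auto simp: norm_mult)
qed

lemma L2_Cauchy_Schwarz:
  assumes "f \<in> L2" "g \<in> L2" shows "norm (L2_inner f g) \<le> L2_norm f * L2_norm g"
proof -
  note [measurable] = L2_measurable[OF assms(1)] L2_measurable[OF assms(2)]
  have "norm (L2_inner f g) \<le> (LINT x|lborel. norm (f x * cnj (g x)))"
    unfolding L2_inner_def by (rule integral_norm_bound)
  also have "\<dots> = (LINT x|lborel. \<bar>norm (f x) * norm (g x)\<bar>)"
    by (simp add: norm_mult)
  also have "\<dots> \<le> L2_norm f * L2_norm g" unfolding L2_norm_def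
    by (rule Cauchy_Schwarz_integral) (use assms in \<open>auto simp: L2_integrable\<close>)
  finally show ?thesis .
qed

lemma L2_inner_add: "f \<in> L2 \<Longrightarrow> g \<in> L2 \<Longrightarrow> h \<in> L2 \<Longrightarrow> L2_inner (\<lambda>x. f x + g x) h = L2_inner f h + L2_inner g h"
  unfolding L2_inner_def by (simp add: ring_distribs Bochner_Integration.integral_add L2_inner_integrable)

lemma L2_inner_scale: "L2_inner (\<lambda>x. c * f x) h = c * L2_inner f h"
  unfolding L2_inner_def by (simp add: mult.assoc)

lemma L2_inner_diff: "f \<in> L2 \<Longrightarrow> g \<in> L2 \<Longrightarrow> h \<in> L2 \<Longrightarrow> L2_inner (\<lambda>x. f x - g x) h = L2_inner f h - L2_inner g h"
  unfolding L2_inner_def by (simp add: ring_distribs Bochner_Integration.integral_diff L2_inner_integrable)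

lemma L2_inner_sum: "(\<And>i. i \<in> I \<Longrightarrow> f i \<in> L2) \<Longrightarrow> h \<in> L2 \<Longrightarrow> L2_inner (\<lambda>x. \<Sum>i\<in>I. f i x) h = (\<Sum>i\<in>I. L2_inner (f i) h)"
proof (induction I rule: infinite_finite_induct)
  case (insert i I)
  then show ?case by (simp add: L2_inner_add L2_sum)
qed (auto simp: L2_inner_def)

lemma L2_inner_commute: "L2_inner f g = cnj (L2_inner g f)"
  unfolding L2_inner_def by (simp add: mult.commute flip: Bochner_Integration.integral_cnj)

lemma L2_norm_sq: "f \<in> L2 \<Longrightarrow> (L2_norm f)\<^sup>2 = (LINT x|lborel. (norm (f x))\<^sup>2)"
  unfolding L2_norm_def by simp

lemma L2_inner_self: "L2_inner f f = of_real ((L2_norm f)\<^sup>2)"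
  unfolding L2_inner_def L2_norm_def
  by (simp add: complex_norm_square[symmetric] flip: integral_complex_of_real)

lemma L2_translate: assumes "f \<in> L2" shows "(\<lambda>x. f (x - t)) \<in> L2"
    "(LINT x|lborel. (norm (f (x - t)))\<^sup>2) = (LINT x|lborel. (norm (f x))\<^sup>2)"
proof -
  note [measurable] = L2_measurable[OF assms(1)]
  have "integrable lborel (\<lambda>x. (norm (f (- t + 1 * x)))\<^sup>2)"
    by (rule lborel_integrable_real_affine[OF L2_integrable[OF assms]]) simp
  then show "(\<lambda>x. f (x - t)) \<in> L2" by (simp add: L2_def)
  show "(LINT x|lborel. (norm (f (x - t)))\<^sup>2) = (LINT x|lborel. (norm (f x))\<^sup>2)"
    using lborel_integral_real_affine[of 1 "\<lambda>x. (norm (f x))\<^sup>2" "-t"] by simp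
qed

section \<open>Approximation in mean and continuity of translations\<close>

lemma L2_bounded_approx:
  assumes f: "f \<in> L2" and e: "e > 0"
  obtains M g where "M > 0" "g \<in> borel_measurable borel" "\<And>x. norm (g x) \<le> M" "\<And>x. \<bar>x\<bar> > M \<Longrightarrow> g x = 0"
    "(LINT x|lborel. (norm (f x - g x))\<^sup>2) < e"
proof -
  note [measurable] = L2_measurable[OF f]
  define g where "g n x = (if \<bar>x\<bar> \<le> real n \<and> norm (f x) \<le> real n then f x else 0)" for n x
  have [measurable]: "g n \<in> borel_measurable borel" for n unfolding g_def by measurable
  have "(\<lambda>n. LINT x|lborel. (norm (f x - g n x))\<^sup>2) \<longlonglongrightarrow> (LINT x|(lborel::real measure). (0::real))"
  proof (rule integral_dominated_convergence[where w="\<lambda>x. (norm (f x))\<^sup>2"])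
    show "AE x in lborel. (\<lambda>n. (norm (f x - g n x))\<^sup>2) \<longlonglongrightarrow> 0"
    proof (rule AE_I2)
      fix x
      obtain N where N: "real N \<ge> \<bar>x\<bar> + norm (f x)" using real_arch_simple by blast
      have "g n x = f x" if "n \<ge> N" for n
      proof -
        have "real n \<ge> real N" using that by simp
        then have "\<bar>x\<bar> \<le> real n \<and> norm (f x) \<le> real n" using N norm_ge_zero[of "f x"] abs_ge_zero[of x] by linarith
          then show ?thesis by (simp add: g_def)
      qed
      then have "\<forall>\<^sub>F n in sequentially. (norm (f x - g n x))\<^sup>2 = 0"
        unfolding eventually_sequentially by (intro exI[of _ N]) auto
      then show "(\<lambda>n. (norm (f x - g n x))\<^sup>2) \<longlonglongrightarrow> 0" by (rule tendsto_eventually)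
    qed
  qed (use L2_integrable[OF f] in \<open>auto simp: g_def\<close>)
  then have "\<forall>\<^sub>F n in sequentially. (LINT x|lborel. (norm (f x - g n x))\<^sup>2) < e"
    using e by (auto dest: order_tendstoD(2))
  then obtain N where N: "\<And>n. n \<ge> N \<Longrightarrow> (LINT x|lborel. (norm (f x - g n x))\<^sup>2) < e"
    by (auto simp: eventually_sequentially)
  show ?thesis
    by (rule that[of "real (Suc N)" "g (Suc N)"]) (use N[of "Suc N"] in \<open>auto simp: g_def\<close>)
qed

text \<open>A measurable function is almost everywhere a limit of continuous ones. Cutting these off
  and clipping their modulus keeps them continuous and provides the majorant for dominated
  convergence.\<close>

lemma L2_continuous_approx:
  assumes f: "f \<in> L2" and e: "e > 0"
  obtains v R where "continuous_on UNIV v" "\<And>x. norm (v x) \<le> R" "\<And>x. \<bar>x\<bar> > R \<Longrightarrow> v x = 0"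
    "(LINT x|lborel. (norm (f x - v x))\<^sup>2) < e" "v \<in> L2"
proof -
  obtain M g where M: "M > 0" and [measurable]: "g \<in> borel_measurable borel" and gM: "\<And>x. norm (g x) \<le> M"
    and g0: "\<And>x. \<bar>x\<bar> > M \<Longrightarrow> g x = 0" and fg: "(LINT x|lborel. (norm (f x - g x))\<^sup>2) < e / 4"
    using L2_bounded_approx[OF f, of "e / 4"] e by auto
  note [measurable] = L2_measurable[OF f]
  have "g \<in> borel_measurable lebesgue" by (simp add: measurable_completion)
  then have "g measurable_on UNIV" by (rule lebesgue_measurable_imp_measurable_on) simp
  then obtain N h where N: "negligible N" and hc: "\<And>n. continuous_on UNIV (h n)"
    and hl: "\<And>x. x \<notin> N \<Longrightarrow> (\<lambda>n. h n x) \<longlonglongrightarrow> g x"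
    unfolding measurable_on_def by auto
  \<comment> \<open>The first factor is 1 for |x| <= M and 0 for |x| >= M + 1; the second shrinks
    \<open>h n x\<close> to modulus at most \<open>M\<close> and leaves smaller values
    alone.\<close>
  define v where "v n x = of_real (max 0 (min 1 (M + 1 - \<bar>x\<bar>))) * (h n x / of_real (max 1 (norm (h n x) / M)))" for n x
  have vc: "continuous_on UNIV (v n)" for n
    unfolding v_def using M by (intro continuous_intros hc) auto
  then have [measurable]: "v n \<in> borel_measurable borel" for n by (rule borel_measurable_continuous_onI)
  have vb: "norm (v n x) \<le> M" for n x
  proof -
    have "norm (h n x) / max 1 (norm (h n x) / M) \<le> M"
    proof (cases "norm (h n x) \<le> M")
      case True
      then have "norm (h n x) / M \<le> 1" using M by simp
      then show ?thesis using True by (simp add: max_def)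
    next
      case False
      then have "norm (h n x) / M > 1" using M by simp
      then show ?thesis using False M by (simp add: max_def)
    qed
    then show ?thesis unfolding v_def norm_mult norm_divide norm_of_real
      using mult_mono[of "\<bar>max 0 (min 1 (M + 1 - \<bar>x\<bar>))\<bar>" 1 "norm (h n x) / \<bar>max 1 (norm (h n x) / M)\<bar>" M] M by (auto simp: abs_if)
  qed
  have v0: "v n x = 0" if "\<bar>x\<bar> > M + 1" for n x using that by (simp add: v_def)
  have indi: "integrable lborel (\<lambda>x::real. c * indicator {-b..b} x)" for b c :: real
    by (simp add: emeasure_lborel_Icc_eq)
  have "(\<lambda>n. LINT x|lborel. (norm (g x - v n x))\<^sup>2) \<longlonglongrightarrow> (LINT x|(lborel::real measure). (0::real))"
  proof (rule integral_dominated_convergence[where w="\<lambda>x. (2 * M)\<^sup>2 * indicator {-(M+1)..M+1} x"])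
    have "AE x in lborel. x \<notin> N"
      using N by (metis AE_not_in negligible_iff_null_sets AE_completion_iff)
    then show "AE x in lborel. (\<lambda>n. (norm (g x - v n x))\<^sup>2) \<longlonglongrightarrow> 0"
    proof eventually_elim
      case (elim x)
      have "(\<lambda>n. v n x) \<longlonglongrightarrow> of_real (max 0 (min 1 (M + 1 - \<bar>x\<bar>))) * (g x / of_real (max 1 (norm (g x) / M)))"
        unfolding v_def using M by (intro tendsto_intros hl[OF elim]) auto
      also have "of_real (max 0 (min 1 (M + 1 - \<bar>x\<bar>))) * (g x / of_real (max 1 (norm (g x) / M))) = g x"
      proof (cases "\<bar>x\<bar> > M")
        case False
        moreover have "norm (g x) / M \<le> 1" using gM[of x] M by simp
        ultimately show ?thesis by (simp add: max_def min_def)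
      qed (simp add: g0)
      finally have "(\<lambda>n. (norm (g x - v n x))\<^sup>2) \<longlonglongrightarrow> (norm (g x - g x))\<^sup>2" by (intro tendsto_intros)
      then show ?case by simp
    qed
    fix n
    have "norm ((norm (g x - v n x))\<^sup>2) \<le> (2 * M)\<^sup>2 * indicator {-(M+1)..M+1} x" for x
    proof (cases "\<bar>x\<bar> > M + 1")
      case False
      have "norm (g x - v n x) \<le> M + M" using norm_triangle_ineq4[of "g x" "v n x"] gM[of x] vb[of n x] by linarith
      then have "(norm (g x - v n x))\<^sup>2 \<le> (2 * M)\<^sup>2" by (intro power_mono) auto
      then show ?thesis using False by (auto simp: indicator_def)
    qed (auto simp: v0 g0)
    then show "AE x in lborel. norm ((norm (g x - v n x))\<^sup>2) \<le> (2 * M)\<^sup>2 * indicator {-(M+1)..M+1} x" by simp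
  qed (use indi[of "(2 * M)\<^sup>2" "M + 1"] in auto)
  from LIMSEQ_less[OF this[unfolded Bochner_Integration.integral_zero], of "e / 4"] e
  have "\<forall>\<^sub>F n in sequentially. (LINT x|lborel. (norm (g x - v n x))\<^sup>2) < e / 4"
    by simp
  then obtain n where n: "(LINT x|lborel. (norm (g x - v n x))\<^sup>2) < e / 4"
    by (auto simp: eventually_sequentially)
  have L2i: "u \<in> L2" if [measurable]: "u \<in> borel_measurable borel" and "\<And>x. norm (u x) \<le> M" "\<And>x. \<bar>x\<bar> > M + 1 \<Longrightarrow> u x = 0" for u
  proof -
    have "(norm (u x))\<^sup>2 \<le> M\<^sup>2 * indicator {-(M+1)..M+1} x" for x
      using that(2)[of x] that(3)[of x] by (cases "\<bar>x\<bar> > M + 1") (auto simp: indicator_def intro!: power_mono)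
    then have "integrable lborel (\<lambda>x. (norm (u x))\<^sup>2)"
      by (intro Bochner_Integration.integrable_bound[OF indi[of "M\<^sup>2" "M + 1"]]) auto
    then show ?thesis by (simp add: L2_def)
  qed
  have vL: "v n \<in> L2" by (rule L2i) (auto simp: vb v0)
  have gL: "g \<in> L2" by (rule L2i) (auto simp: gM g0)
  have "(LINT x|lborel. (norm (f x - v n x))\<^sup>2) \<le> (LINT x|lborel. 2 * (norm (f x - g x))\<^sup>2 + 2 * (norm (g x - v n x))\<^sup>2)"
    using L2_integrable[OF L2_diff[OF f vL]] L2_integrable[OF L2_diff[OF f gL]] L2_integrable[OF L2_diff[OF gL vL]]
      norm_add_sq[of "f x - g x" "g x - v n x" for x]
    by (intro integral_mono) auto
  also have "\<dots> = 2 * (LINT x|lborel. (norm (f x - g x))\<^sup>2) + 2 * (LINT x|lborel. (norm (g x - v n x))\<^sup>2)"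
    using L2_integrable[OF L2_diff[OF f gL]] L2_integrable[OF L2_diff[OF gL vL]] by simp
  also have "\<dots> < e" using n fg by simp
  finally have *: "(LINT x|lborel. (norm (f x - v n x))\<^sup>2) < e" .
  show ?thesis
    by (rule that[of "v n" "M + 1"]) (use vc order_trans[OF vb[of n], of "M + 1"] v0 * vL in auto)
qed

text \<open>Translation is an isometry, so the error of a continuous compactly supported approximant
  is the same for all shifts. The three contributions enter with factors 4, 4 and 2, whence e /
  16.\<close>

lemma L2_translation_continuous:
  assumes u: "u \<in> L2" and t: "t \<longlonglongrightarrow> 0"
  shows "(\<lambda>n. LINT x|lborel. (norm (u (x - t n) - u x))\<^sup>2) \<longlonglongrightarrow> 0"
proof (rule LIMSEQ_I)
  fix e :: real assume e: "e > 0"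
  obtain v R where vc: "continuous_on UNIV v" and vR: "\<And>x. norm (v x) \<le> R" and v0: "\<And>x. \<bar>x\<bar> > R \<Longrightarrow> v x = 0"
    and uv: "(LINT x|lborel. (norm (u x - v x))\<^sup>2) < e / 16" and vL: "v \<in> L2"
    using L2_continuous_approx[OF u, of "e / 16"] e by auto
  note [measurable] = L2_measurable[OF vL]
  have R: "R \<ge> 0" using vR[of 0] norm_ge_zero[of "v 0"] by linarith
  \<comment> \<open>The indicator confines all shifted supports to one bounded interval, as the
    majorant requires; it is eventually 1.\<close>
  have "(\<lambda>n. LINT x|lborel. (norm (v (x - t n) - v x))\<^sup>2 * indicator {..1} \<bar>t n\<bar>) \<longlonglongrightarrow> (LINT x|(lborel::real measure). (0::real))"
  proof (rule integral_dominated_convergence[where w="\<lambda>x. (2 * R)\<^sup>2 * indicator {-(R+1)..R+1} x"])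
    show "integrable lborel (\<lambda>x. (2 * R)\<^sup>2 * indicator {-(R+1)..R+1} x)" by (simp add: emeasure_lborel_Icc_eq)
    have "(\<lambda>n. (norm (v (x - t n) - v x))\<^sup>2) \<longlonglongrightarrow> (norm (v (x - 0) - v x))\<^sup>2" for x
    proof -
      have "isCont v (x - 0)" using vc by (simp add: continuous_on_eq_continuous_at)
      then have "(\<lambda>n. v (x - t n)) \<longlonglongrightarrow> v (x - 0)"
        by (rule isCont_tendsto_compose) (intro tendsto_intros t)
      then show ?thesis by (intro tendsto_intros)
    qed
    then have *: "(\<lambda>n. (norm (v (x - t n) - v x))\<^sup>2) \<longlonglongrightarrow> 0" for x by simp
    have "(\<lambda>n. (norm (v (x - t n) - v x))\<^sup>2 * indicator {..1} \<bar>t n\<bar>) \<longlonglongrightarrow> 0" for x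
      by (rule Lim_null_comparison[OF _ *[of x]]) (auto simp: indicator_def)
    then show "AE x in lborel. (\<lambda>n. (norm (v (x - t n) - v x))\<^sup>2 * indicator {..1} \<bar>t n\<bar>) \<longlonglongrightarrow> 0" by simp
    fix n
    have "norm ((norm (v (x - t n) - v x))\<^sup>2 * indicator {..1} \<bar>t n\<bar>) \<le> (2 * R)\<^sup>2 * indicator {-(R+1)..R+1} x" for x
    proof (cases "\<bar>t n\<bar> > 1")
      case False
      show ?thesis
      proof (cases "\<bar>x\<bar> > R + 1")
        case True
        then show ?thesis using v0[of x] v0[of "x - t n"] False by auto
      next
        case F: False
        have "norm (v (x - t n) - v x) \<le> R + R" 
          using norm_triangle_ineq4[of "v (x - t n)" "v x"] vR[of x] vR[of "x - t n"] by linarith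
        then have "(norm (v (x - t n) - v x))\<^sup>2 \<le> (2 * R)\<^sup>2" by (intro power_mono) auto
        then show ?thesis using F by (auto simp: indicator_def)
      qed
    qed auto
    then show "AE x in lborel. norm ((norm (v (x - t n) - v x))\<^sup>2 * indicator {..1} \<bar>t n\<bar>) \<le> (2 * R)\<^sup>2 * indicator {-(R+1)..R+1} x" by simp
  qed auto
  then have "\<forall>\<^sub>F n in sequentially. (LINT x|lborel. (norm (v (x - t n) - v x))\<^sup>2 * indicator {..1} \<bar>t n\<bar>) < e / 16"
    using e order_tendstoD(2)[of _ _ _ "e / 16"] by fastforce
  moreover have "\<forall>\<^sub>F n in sequentially. \<bar>t n\<bar> < 1"
    using LIMSEQ_less[OF tendsto_rabs_zero[OF t]] by simp
  ultimately have "\<forall>\<^sub>F n in sequentially. (LINT x|lborel. (norm (v (x - t n) - v x))\<^sup>2) < e / 16"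
    by eventually_elim auto
  then obtain N where N: "\<And>n. n \<ge> N \<Longrightarrow> (LINT x|lborel. (norm (v (x - t n) - v x))\<^sup>2) < e / 16"
    by (auto simp: eventually_sequentially)
  show "\<exists>no. \<forall>n\<ge>no. norm ((LINT x|lborel. (norm (u (x - t n) - u x))\<^sup>2) - 0) < e"
  proof (intro exI allI impI)
    fix n assume "n \<ge> N"
    define d where "d x = u x - v x" for x
    have d: "d \<in> L2" unfolding d_def by (rule L2_diff[OF u vL])
    define a where "a x = v (x - t n) - v x" for x
    have a: "a \<in> L2" unfolding a_def by (rule L2_diff[OF L2_translate(1)[OF vL] vL])
    have dt: "(\<lambda>x. d (x - t n)) \<in> L2" by (rule L2_translate[OF d])
    have "(norm (u (x - t n) - u x))\<^sup>2 \<le> 4 * (norm (d (x - t n)))\<^sup>2 + 4 * (norm (d x))\<^sup>2 + 2 * (norm (a x))\<^sup>2" for x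
    proof -
      have "u (x - t n) - u x = (d (x - t n) - d x) + a x" by (simp add: d_def a_def)
      then have "(norm (u (x - t n) - u x))\<^sup>2 \<le> 2 * (norm (d (x - t n) - d x))\<^sup>2 + 2 * (norm (a x))\<^sup>2"
        using norm_add_sq by metis
      also have "(norm (d (x - t n) - d x))\<^sup>2 \<le> 2 * (norm (d (x - t n)))\<^sup>2 + 2 * (norm (d x))\<^sup>2"
        using norm_add_sq[of "d (x - t n)" "- d x"] by simp
      finally show ?thesis by simp
    qed
    then have "(LINT x|lborel. (norm (u (x - t n) - u x))\<^sup>2)
       \<le> (LINT x|lborel. 4 * (norm (d (x - t n)))\<^sup>2 + 4 * (norm (d x))\<^sup>2 + 2 * (norm (a x))\<^sup>2)"
      using L2_integrable[OF d] L2_integrable[OF a] L2_integrable[OF dt] L2_integrable[OF L2_diff[OF L2_translate(1)[OF u] u]]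
      by (intro integral_mono) auto
    also have "\<dots> = 4 * (LINT x|lborel. (norm (d x))\<^sup>2) + 4 * (LINT x|lborel. (norm (d x))\<^sup>2) + 2 * (LINT x|lborel. (norm (a x))\<^sup>2)"
      using L2_integrable[OF d] L2_integrable[OF a] L2_integrable[OF dt] L2_translate(2)[OF d] by simp
    also have "\<dots> < e" using uv N[OF \<open>n \<ge> N\<close>] e unfolding d_def a_def by simp
    finally show "norm ((LINT x|lborel. (norm (u (x - t n) - u x))\<^sup>2) - 0) < e" by simp
  qed
qed

section \<open>Plancherel for integrable and square-integrable functions\<close>

lemma gauss_integral:
  assumes a: "a > 0"
  shows "integrable lborel (\<lambda>x::real. exp (- (pi * a * x\<^sup>2)))" (is ?A)
    and "(LINT x|lborel. exp (- (pi * a * x\<^sup>2))) = 1 / sqrt a" (is ?B)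
proof -
  define \<sigma> where "\<sigma> = 1 / sqrt (2 * pi * a)"
  have s: "\<sigma> > 0" using a by (simp add: \<sigma>_def)
  have s2: "\<sigma>\<^sup>2 = 1 / (2 * pi * a)" using a by (simp add: \<sigma>_def power_divide)
  have eq: "exp (- (pi * a * x\<^sup>2)) = normal_density 0 \<sigma> x / sqrt a" for x
  proof -
    have "sqrt (2 * pi * \<sigma>\<^sup>2) = 1 / sqrt a" using a by (simp add: s2 real_sqrt_divide)
    moreover have "(x - 0)\<^sup>2 / (2 * \<sigma>\<^sup>2) = pi * a * x\<^sup>2" using a by (simp add: s2 field_simps)
    ultimately show ?thesis using a by (simp add: normal_density_def)
  qed
  show ?A unfolding eq using s by (intro integrable_divide_zero impI) (rule integrable_normal_density)
  show ?B unfolding eq using s by simp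
qed

lemma gauss_fourier:
  assumes a: "a > 0"
  shows "integrable lborel (\<lambda>x::real. of_real (exp (- (pi * a * x\<^sup>2))) * exp (\<i> * of_real (2 * pi * t * x)))" (is ?A)
    and "(LINT x|lborel. of_real (exp (- (pi * a * x\<^sup>2))) * exp (\<i> * of_real (2 * pi * t * x))) 
           = of_real (exp (- (pi * t\<^sup>2 / a)) / sqrt a)" (is ?B)
proof -
  show ?A
    by (rule Bochner_Integration.integrable_bound[OF gauss_integral(1)[OF a]])
       (auto simp: norm_mult)
  \<comment> \<open>Rescaling by \<open>c\<close> turns pi * a * x^2 into x^2 / 2, so the integral
    becomes the characteristic function of the standard normal distribution.\<close>
  define c where "c = 1 / sqrt (2 * pi * a)"
  have c: "c > 0" using a by (simp add: c_def)
  have c2: "c\<^sup>2 = 1 / (2 * pi * a)" using a by (simp add: c_def power_divide)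
  have "(LINT x|lborel. of_real (exp (- (pi * a * x\<^sup>2))) * exp (\<i> * of_real (2 * pi * t * x))) 
     = c *\<^sub>R (LINT x|lborel. of_real (exp (- (pi * a * (0 + c * x)\<^sup>2))) * exp (\<i> * of_real (2 * pi * t * (0 + c * x))))"
    using c by (subst lborel_integral_real_affine[where c=c and t=0]) auto
  also have "(LINT x|lborel. of_real (exp (- (pi * a * (0 + c * x)\<^sup>2))) * exp (\<i> * of_real (2 * pi * t * (0 + c * x))))
    = (LINT x|lborel. sqrt (2 * pi) *\<^sub>R (std_normal_density x *\<^sub>R iexp (2 * pi * t * c * x)))"
  proof (rule Bochner_Integration.integral_cong[OF refl])
    fix x :: real
    have "pi * a * (0 + c * x)\<^sup>2 = x\<^sup>2 / 2"
      using a by (simp add: power_mult_distrib c2)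
    then show "of_real (exp (- (pi * a * (0 + c * x)\<^sup>2))) * exp (\<i> * of_real (2 * pi * t * (0 + c * x)))
      = sqrt (2 * pi) *\<^sub>R (std_normal_density x *\<^sub>R iexp (2 * pi * t * c * x))"
      by (simp add: std_normal_density_def scaleR_conv_of_real mult_ac)
  qed
  also have "\<dots> = sqrt (2 * pi) *\<^sub>R char std_normal_distribution (2 * pi * t * c)"
    unfolding char_def by (simp add: integral_density del: scaleR_scaleR)
  also have "\<dots> = sqrt (2 * pi) *\<^sub>R complex_of_real (exp (- ((2 * pi * t * c)\<^sup>2) / 2))"
    by (simp add: char_std_normal_distribution)
  also have "- ((2 * pi * t * c)\<^sup>2) / 2 = - (pi * t\<^sup>2 / a)"
    using a by (simp add: power_mult_distrib c2) (simp add: power2_eq_square field_simps)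
  also have "c *\<^sub>R sqrt (2 * pi) *\<^sub>R complex_of_real (exp (- (pi * t\<^sup>2 / a))) = of_real (exp (- (pi * t\<^sup>2 / a)) / sqrt a)"
    using a by (simp add: c_def scaleR_conv_of_real real_sqrt_mult)
  finally show ?B .
qed

definition fourier :: "(real \<Rightarrow> complex) \<Rightarrow> real \<Rightarrow> complex" where
  "fourier u t = (LINT x|lborel. u x * exp (- (\<i> * of_real (2 * pi * t * x))))"

lemma norm_exp_i [simp]: "norm (exp (\<i> * of_real t)) = 1" "norm (exp (- (\<i> * of_real t))) = 1"
  by (auto simp: norm_exp_eq_Re)

lemma fourier_integrable: "integrable lborel u \<Longrightarrow> integrable lborel (\<lambda>x. u x * exp (- (\<i> * of_real (2 * pi * t * x))))"
proof -
  assume u: "integrable lborel u"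
  note [measurable] = borel_measurable_integrable[OF u]
  show ?thesis by (rule Bochner_Integration.integrable_bound[OF u]) (auto simp: norm_mult simp del: of_real_mult)
qed

lemma fourier_measurable [measurable]:
  assumes [measurable]: "u \<in> borel_measurable borel"
  shows "fourier u \<in> borel_measurable borel"
proof -
  have "(\<lambda>t. LINT x|lborel. u x * exp (- (\<i> * of_real (2 * pi * t * x)))) \<in> borel_measurable lborel"
    by (rule lborel.borel_measurable_lebesgue_integral) measurable
  then show ?thesis unfolding fourier_def[abs_def] by simp
qed

lemma norm_fourier_le: "norm (fourier u t) \<le> (LINT x|lborel. norm (u x))"
proof -
  have "norm (fourier u t) \<le> (LINT x|lborel. norm (u x * exp (- (\<i> * of_real (2 * pi * t * x)))))"
    unfolding fourier_def by (rule integral_norm_bound)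
  then show ?thesis by (simp add: norm_mult del: of_real_mult)
qed

text \<open>The squared modulus of the Fourier transform is the Fourier transform of the autocorrelation, so
  damping it by a Gaussian averages the autocorrelation over a shrinking neighbourhood of \<open>0\<close>.\<close>

definition autocor :: "(real \<Rightarrow> complex) \<Rightarrow> real \<Rightarrow> complex" where
  "autocor u t = (LINT x|lborel. u x * cnj (u (x - t)))"

lemma autocor_tendsto:
  assumes u: "u \<in> L2" and t: "t \<longlonglongrightarrow> 0"
  shows "(\<lambda>n. autocor u (t n)) \<longlonglongrightarrow> autocor u 0"
proof (rule LIM_zero_cancel, rule Lim_null_comparison)
  have "norm (autocor u (t n) - autocor u 0) \<le> L2_norm u * L2_norm (\<lambda>x. u (x - t n) - u x)" for n
  proof -
    have "autocor u (t n) - autocor u 0 = cnj (L2_inner (\<lambda>x. u (x - t n) - u x) u)"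
      unfolding autocor_def by (simp add: L2_inner_diff L2_translate u) (simp add: L2_inner_def mult.commute flip: Bochner_Integration.integral_cnj)
    then show ?thesis using L2_Cauchy_Schwarz[OF L2_diff[OF L2_translate(1)[OF u] u] u, of "t n"]
      by (simp add: mult.commute)
  qed
  then show "\<forall>\<^sub>F n in sequentially. norm (autocor u (t n) - autocor u 0) \<le> L2_norm u * L2_norm (\<lambda>x. u (x - t n) - u x)"
    by simp
  have "(\<lambda>n. sqrt (LINT x|lborel. (norm (u (x - t n) - u x))\<^sup>2)) \<longlonglongrightarrow> sqrt 0"
    by (intro tendsto_intros L2_translation_continuous u t)
  then show "(\<lambda>n. L2_norm u * L2_norm (\<lambda>x. u (x - t n) - u x)) \<longlonglongrightarrow> 0"
    unfolding L2_norm_def by (auto intro!: tendsto_mult_right_zero)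
qed

lemma norm_autocor_le: "u \<in> L2 \<Longrightarrow> norm (autocor u t) \<le> (L2_norm u)\<^sup>2"
  using L2_Cauchy_Schwarz[OF _ L2_translate(1), of u u t] L2_translate(2)[of u t]
  by (simp add: autocor_def L2_inner_def L2_norm_def power2_eq_square)

lemma autocor_measurable [measurable]:
  assumes [measurable]: "u \<in> borel_measurable borel"
  shows "autocor u \<in> borel_measurable borel"
proof -
  have "(\<lambda>t. LINT x|lborel. u x * cnj (u (x - t))) \<in> borel_measurable lborel"
    by (rule lborel.borel_measurable_lebesgue_integral) measurable
  then show ?thesis unfolding autocor_def[abs_def] by simp
qed

lemma autocor_kernel_integrable:
  fixes u :: "real \<Rightarrow> complex"
  assumes u: "integrable lborel u"
  shows "integrable (lborel \<Otimes>\<^sub>M lborel) (\<lambda>(x, t). u x * cnj (u (x - t)))"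
proof (rule lborel_pair.Fubini_integrable)
  note [measurable] = borel_measurable_integrable[OF u]
  have i: "integrable lborel (\<lambda>t. u (x - t))" for x
    using lborel_integrable_real_affine[OF u, of "-1" x] by simp
  have e: "(LINT t|lborel. norm (u (x - t))) = (LINT t|lborel. norm (u t))" for x
    using lborel_integral_real_affine[of "-1" "\<lambda>t. norm (u t)" x] by simp
  show "(\<lambda>(x, t). u x * cnj (u (x - t))) \<in> borel_measurable (lborel \<Otimes>\<^sub>M lborel)" by measurable
  show "integrable lborel (\<lambda>x. LINT t|lborel. norm (case (x, t) of (x, t) \<Rightarrow> u x * cnj (u (x - t))))"
    using u by (simp add: norm_mult e)
  show "AE x in lborel. integrable lborel (\<lambda>t. case (x, t) of (x, t) \<Rightarrow> u x * cnj (u (x - t)))"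
    using i by simp
qed

lemma fourier_autocor:
  assumes u: "integrable lborel u"
  shows "integrable lborel (autocor u)" "fourier (autocor u) s = fourier u s * cnj (fourier u s)"
proof -
  note [measurable] = borel_measurable_integrable[OF u]
  note k = autocor_kernel_integrable[OF u]
  show ai: "integrable lborel (autocor u)"
    using lborel_pair.integrable_snd[OF k] unfolding autocor_def[abs_def] .
  let ?e = "\<lambda>t. exp (- (\<i> * of_real (2 * pi * s * t)))"
  have k': "integrable (lborel \<Otimes>\<^sub>M lborel) (\<lambda>(x, t). u x * cnj (u (x - t)) * ?e t)"
    by (rule Bochner_Integration.integrable_bound[OF k]) (auto simp: norm_mult simp del: of_real_mult)
  have "fourier (autocor u) s = (LINT t|lborel. (LINT x|lborel. u x * cnj (u (x - t)) * ?e t))"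
    unfolding fourier_def autocor_def by simp
  also have "\<dots> = (LINT x|lborel. (LINT t|lborel. u x * cnj (u (x - t)) * ?e t))"
    by (rule lborel_pair.Fubini_integral[OF k'])
  also have "\<dots> = (LINT x|lborel. u x * ?e x * cnj (fourier u s))"
  proof (rule Bochner_Integration.integral_cong[OF refl])
    fix x
    \<comment> \<open>Substituting x - t for t splits the exponential into a factor in x and a
      conjugate factor in t.\<close>
    have "(LINT t|lborel. u x * cnj (u (x - t)) * ?e t) = (LINT t|lborel. u x * cnj (u (x - (x - t))) * ?e (x - t))"
      using lborel_integral_real_affine[of "-1" "\<lambda>t. u x * cnj (u (x - t)) * ?e t" x] by simp
    also have "\<dots> = (LINT t|lborel. (u x * ?e x) * cnj (u t * ?e t))"
      by (rule Bochner_Integration.integral_cong[OF refl])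
         (simp add: exp_cnj ring_distribs exp_add[symmetric] exp_diff[symmetric] mult_ac)
    also have "\<dots> = u x * ?e x * cnj (fourier u s)"
      unfolding fourier_def by (simp del: complex_cnj_mult)
    finally show "(LINT t|lborel. u x * cnj (u (x - t)) * ?e t) = u x * ?e x * cnj (fourier u s)" .
  qed
  also have "\<dots> = fourier u s * cnj (fourier u s)"
    unfolding fourier_def by simp
  finally show "fourier (autocor u) s = fourier u s * cnj (fourier u s)" .
qed

text \<open>Fubini moves the transform onto the Gaussian, whose transform is again a Gaussian. The
  final rescaling makes this weight independent of \<open>e\<close>, so that letting
  \<open>e\<close> tend to 0 affects only the argument of \<open>v\<close>.\<close>

lemma gauss_damped_fourier:
  fixes v :: "real \<Rightarrow> complex"
  assumes v: "integrable lborel v" and e: "e > 0"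
  shows "(LINT s|lborel. exp (- (pi * e\<^sup>2 * s\<^sup>2)) * fourier v s) = (LINT t|lborel. exp (- (pi * t\<^sup>2)) * v (e * t))"
proof -
  note [measurable] = borel_measurable_integrable[OF v]
  let ?F = "\<lambda>s x. exp (- (pi * e\<^sup>2 * s\<^sup>2)) * (v x * exp (- (\<i> * of_real (2 * pi * s * x))))"
  have g: "integrable lborel (\<lambda>s. exp (- (pi * e\<^sup>2 * s\<^sup>2)))" by (rule gauss_integral) (use e in auto)
  have k: "integrable (lborel \<Otimes>\<^sub>M lborel) (\<lambda>(s, x). ?F s x)"
  proof (rule lborel_pair.Fubini_integrable)
    show "integrable lborel (\<lambda>s. LINT x|lborel. norm (case (s, x) of (s, x) \<Rightarrow> ?F s x))"
      using g by (simp add: norm_mult del: of_real_mult)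
    show "AE s in lborel. integrable lborel (\<lambda>x. case (s, x) of (s, x) \<Rightarrow> ?F s x)"
      using fourier_integrable[OF v] by (simp del: of_real_mult)
  qed measurable
  have "(LINT s|lborel. exp (- (pi * e\<^sup>2 * s\<^sup>2)) * fourier v s) = (LINT s|lborel. LINT x|lborel. ?F s x)"
    unfolding fourier_def by simp
  also have "\<dots> = (LINT x|lborel. LINT s|lborel. ?F s x)"
    by (rule lborel_pair.Fubini_integral[symmetric]) (use k in simp)
  also have "\<dots> = (LINT x|lborel. v x * of_real (exp (- (pi * x\<^sup>2 / e\<^sup>2)) / e))"
  proof (rule Bochner_Integration.integral_cong[OF refl])
    fix x
    have "(LINT s|lborel. ?F s x) = v x * (LINT s|lborel. of_real (exp (- (pi * e\<^sup>2 * s\<^sup>2))) * exp (\<i> * of_real (2 * pi * (- x) * s)))"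
      by (subst integral_mult_right_zero[symmetric], rule Bochner_Integration.integral_cong[OF refl]) (simp add: mult_ac)
    also have "(LINT s|lborel. of_real (exp (- (pi * e\<^sup>2 * s\<^sup>2))) * exp (\<i> * of_real (2 * pi * (- x) * s))) = of_real (exp (- (pi * (- x)\<^sup>2 / e\<^sup>2)) / sqrt (e\<^sup>2))"
      by (rule gauss_fourier) (use e in auto)
    finally show "(LINT s|lborel. ?F s x) = v x * of_real (exp (- (pi * x\<^sup>2 / e\<^sup>2)) / e)" using e by simp
  qed
  also have "\<dots> = \<bar>e\<bar> *\<^sub>R (LINT t|lborel. v (0 + e * t) * of_real (exp (- (pi * (0 + e * t)\<^sup>2 / e\<^sup>2)) / e))"
    by (rule lborel_integral_real_affine) (use e in auto)
  also have "\<dots> = (LINT t|lborel. exp (- (pi * t\<^sup>2)) * v (e * t))"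
    using e by (simp add: power_mult_distrib scaleR_conv_of_real mult_ac)
  finally show ?thesis .
qed

text \<open>As the damping vanishes, monotone convergence yields the left side and dominated
  convergence yields the autocorrelation at 0, which is the squared norm. The integral on the left
  is a nonnegative one because its finiteness is part of the claim.\<close>

theorem plancherel:
  assumes u: "integrable lborel u" and u2: "u \<in> L2"
  shows "(\<integral>\<^sup>+s. ennreal ((norm (fourier u s))\<^sup>2) \<partial>lborel) = ennreal (LINT x|lborel. (norm (u x))\<^sup>2)"
proof -
  note [measurable] = borel_measurable_integrable[OF u]
  define e where "e n = 1 / real (Suc n)" for n
  have e: "e n > 0" for n by (simp add: e_def)
  have e0: "e \<longlonglongrightarrow> 0" unfolding e_def using LIMSEQ_inverse_real_of_nat by (simp add: inverse_eq_divide)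
  have edec: "e (Suc n) \<le> e n" for n by (simp add: e_def frac_le)
  define J where "J n = (LINT s|lborel. exp (- (pi * (e n)\<^sup>2 * s\<^sup>2)) * (norm (fourier u s))\<^sup>2)" for n
  have Ji: "integrable lborel (\<lambda>s. exp (- (pi * (e n)\<^sup>2 * s\<^sup>2)) * (norm (fourier u s))\<^sup>2)" for n
  proof (rule Bochner_Integration.integrable_bound)
    show "integrable lborel (\<lambda>s. exp (- (pi * (e n)\<^sup>2 * s\<^sup>2)) * (LINT x|lborel. norm (u x))\<^sup>2)"
      using gauss_integral(1)[of "(e n)\<^sup>2"] e[of n] by simp
    show "AE s in lborel. norm (exp (- (pi * (e n)\<^sup>2 * s\<^sup>2)) * (norm (fourier u s))\<^sup>2) \<le> norm (exp (- (pi * (e n)\<^sup>2 * s\<^sup>2)) * (LINT x|lborel. norm (u x))\<^sup>2)"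
      by (auto simp: abs_mult intro!: mult_left_mono power_mono norm_fourier_le)
  qed measurable
  have J: "of_real (J n) = (LINT t|lborel. exp (- (pi * t\<^sup>2)) * autocor u (e n * t))" for n
  proof -
    have "of_real (J n) = (LINT s|lborel. exp (- (pi * (e n)\<^sup>2 * s\<^sup>2)) * fourier (autocor u) s)"
      unfolding J_def fourier_autocor(2)[OF u] by (simp flip: integral_complex_of_real complex_norm_square)
    then show ?thesis using gauss_damped_fourier[OF fourier_autocor(1)[OF u] e[of n]] by simp
  qed
  have "(\<lambda>n. LINT t|lborel. exp (- (pi * t\<^sup>2)) * autocor u (e n * t)) \<longlonglongrightarrow> (LINT t|lborel. exp (- (pi * t\<^sup>2)) * autocor u 0)"
  proof (rule integral_dominated_convergence[where w="\<lambda>t. exp (- (pi * t\<^sup>2)) * (L2_norm u)\<^sup>2"])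
    show "integrable lborel (\<lambda>t. exp (- (pi * t\<^sup>2)) * (L2_norm u)\<^sup>2)"
      using gauss_integral(1)[of 1] by simp
    have "(\<lambda>n. exp (- (pi * t\<^sup>2)) * autocor u (e n * t)) \<longlonglongrightarrow> exp (- (pi * t\<^sup>2)) * autocor u 0" for t
      by (intro tendsto_intros autocor_tendsto u2 tendsto_mult_left_zero e0)
    then show "AE t in lborel. (\<lambda>n. exp (- (pi * t\<^sup>2)) * autocor u (e n * t)) \<longlonglongrightarrow> exp (- (pi * t\<^sup>2)) * autocor u 0" by simp
    show "AE t in lborel. norm (exp (- (pi * t\<^sup>2)) * autocor u (e n * t)) \<le> exp (- (pi * t\<^sup>2)) * (L2_norm u)\<^sup>2" for n
      by (auto simp: norm_mult intro!: norm_autocor_le u2)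
  qed measurable
  also have "(LINT t|lborel. exp (- (pi * t\<^sup>2)) * autocor u 0) = of_real (LINT t|lborel. exp (- (pi * t\<^sup>2))) * autocor u 0"
    by (simp flip: integral_complex_of_real)
  also have "\<dots> = of_real ((L2_norm u)\<^sup>2)"
    using gauss_integral(2)[of 1] L2_inner_self[of u] by (simp add: autocor_def L2_inner_def)
  finally have "(\<lambda>n. complex_of_real (J n)) \<longlonglongrightarrow> of_real ((L2_norm u)\<^sup>2)" by (simp add: J)
  then have JL: "J \<longlonglongrightarrow> (L2_norm u)\<^sup>2" by (simp only: tendsto_of_real_iff)
  have "(\<lambda>n. \<integral>\<^sup>+s. ennreal (exp (- (pi * (e n)\<^sup>2 * s\<^sup>2)) * (norm (fourier u s))\<^sup>2) \<partial>lborel) \<longlonglongrightarrow> (\<integral>\<^sup>+s. ennreal ((norm (fourier u s))\<^sup>2) \<partial>lborel)"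
  proof (rule nn_integral_LIMSEQ)
    have le: "exp (- (pi * (e n)\<^sup>2 * s\<^sup>2)) * (norm (fourier u s))\<^sup>2 \<le> exp (- (pi * (e (Suc n))\<^sup>2 * s\<^sup>2)) * (norm (fourier u s))\<^sup>2" for n s
      using edec[of n] e[of "Suc n"] by (intro mult_right_mono) (auto intro!: mult_right_mono mult_left_mono power_mono)
    show "incseq (\<lambda>n s. ennreal (exp (- (pi * (e n)\<^sup>2 * s\<^sup>2)) * (norm (fourier u s))\<^sup>2))"
      by (intro incseq_SucI le_funI ennreal_leI le)
    fix s
    have "(\<lambda>n. exp (- (pi * (e n)\<^sup>2 * s\<^sup>2)) * (norm (fourier u s))\<^sup>2) \<longlonglongrightarrow> exp (- (pi * 0\<^sup>2 * s\<^sup>2)) * (norm (fourier u s))\<^sup>2"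
      by (intro tendsto_intros e0)
    then show "(\<lambda>n. ennreal (exp (- (pi * (e n)\<^sup>2 * s\<^sup>2)) * (norm (fourier u s))\<^sup>2)) \<longlonglongrightarrow> ennreal ((norm (fourier u s))\<^sup>2)"
      by (intro tendsto_ennrealI) simp
  qed measurable
  moreover have "(\<integral>\<^sup>+s. ennreal (exp (- (pi * (e n)\<^sup>2 * s\<^sup>2)) * (norm (fourier u s))\<^sup>2) \<partial>lborel) = ennreal (J n)" for n
    unfolding J_def by (rule nn_integral_eq_integral[OF Ji]) simp
  ultimately have "(\<lambda>n. ennreal (J n)) \<longlonglongrightarrow> (\<integral>\<^sup>+s. ennreal ((norm (fourier u s))\<^sup>2) \<partial>lborel)" by simp
  moreover have "(\<lambda>n. ennreal (J n)) \<longlonglongrightarrow> ennreal ((L2_norm u)\<^sup>2)" by (intro tendsto_ennrealI JL)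
  ultimately show ?thesis using LIMSEQ_unique L2_norm_sq[OF u2] by metis
qed

section \<open>The Gabor transform\<close>

definition gab :: "(real \<Rightarrow> complex) \<Rightarrow> real \<times> real \<Rightarrow> complex" where
  "gab f z = L2_inner f (gabor z)"

lemma gabor_alt: "gabor z x = of_real (2 powr (1/4) * exp (- (pi * (x - fst z)\<^sup>2))) * exp (\<i> * of_real (2 * pi * snd z * x))"
  unfolding gabor_def exp_add exp_of_real by (simp add: mult_ac)

lemma cnj_gabor: "cnj (gabor z x) = of_real (2 powr (1/4) * exp (- (pi * (x - fst z)\<^sup>2))) * exp (- (\<i> * of_real (2 * pi * snd z * x)))"
  unfolding gabor_alt by (simp add: exp_cnj)

lemma norm_gabor: "norm (gabor z x) = 2 powr (1/4) * exp (- (pi * (x - fst z)\<^sup>2))"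
  unfolding gabor_alt by (simp add: norm_mult del: of_real_mult)

lemma gabor_measurable [measurable (raw)]:
  assumes z: "z \<in> measurable M borel" and x [measurable]: "x \<in> borel_measurable M"
  shows "(\<lambda>w. gabor (z w) (x w)) \<in> borel_measurable M"
proof -
  have [measurable]: "(\<lambda>w. fst (z w)) \<in> borel_measurable M" "(\<lambda>w. snd (z w)) \<in> borel_measurable M"
    by (auto intro!: measurable_compose[OF z] borel_measurable_continuous_onI continuous_intros)
  show ?thesis unfolding gabor_def by measurable
qed

lemma powr_quarter_sq: "((2::real) powr (1/4))\<^sup>2 = sqrt 2"
  proof -
  have "((2::real) powr (1/4))\<^sup>2 = 2 powr (1/4) * 2 powr (1/4)" by (simp only: power2_eq_square)
  also have "\<dots> = 2 powr (1/2)" by (simp flip: powr_add)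
  finally show ?thesis by (simp add: powr_half_sqrt)
qed

lemma norm_gabor_sq: "(norm (gabor z x))\<^sup>2 = sqrt 2 * exp (- (pi * 2 * (x - fst z)\<^sup>2))"
  unfolding norm_gabor power_mult_distrib powr_quarter_sq by (simp add: power2_eq_square exp_add[symmetric])

lemma gauss_shift:
  assumes a: "a > 0"
  shows "integrable lborel (\<lambda>x. exp (- (pi * a * (x - p)\<^sup>2)))" "(LINT x|lborel. exp (- (pi * a * (x - p)\<^sup>2))) = 1 / sqrt a"
    "integrable lborel (\<lambda>x. exp (- (pi * a * (p - x)\<^sup>2)))" "(LINT x|lborel. exp (- (pi * a * (p - x)\<^sup>2))) = 1 / sqrt a"
proof -
  show 1: "integrable lborel (\<lambda>x. exp (- (pi * a * (x - p)\<^sup>2)))"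
    using lborel_integrable_real_affine[OF gauss_integral(1)[OF a], of 1 "-p"] by simp
  show 2: "(LINT x|lborel. exp (- (pi * a * (x - p)\<^sup>2))) = 1 / sqrt a"
    using lborel_integral_real_affine[of 1 "\<lambda>x. exp (- (pi * a * x\<^sup>2))" "-p"] gauss_integral(2)[OF a] by simp
  show "integrable lborel (\<lambda>x. exp (- (pi * a * (p - x)\<^sup>2)))" using 1 by (simp add: power2_commute)
  show "(LINT x|lborel. exp (- (pi * a * (p - x)\<^sup>2))) = 1 / sqrt a" using 2 by (simp add: power2_commute)
qed

lemma gabor_L2: "gabor z \<in> L2"
proof -
  have [measurable]: "gabor z \<in> borel_measurable borel" unfolding gabor_def[abs_def] by measurable
  show ?thesis using gauss_shift(1)[of 2 "fst z"] by (simp add: L2_def norm_gabor_sq)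
qed

definition window :: "(real \<Rightarrow> complex) \<Rightarrow> real \<Rightarrow> real \<Rightarrow> complex" where
  "window f p x = f x * of_real (2 powr (1/4) * exp (- (pi * (x - p)\<^sup>2)))"

lemma gab_fourier: "gab f (p, t) = fourier (window f p) t"
  unfolding gab_def L2_inner_def fourier_def window_def cnj_gabor by (simp add: mult.assoc)

lemma gab_measurable:
  assumes "f \<in> L2" shows "gab f \<in> borel_measurable borel"
proof -
  note [measurable] = L2_measurable[OF assms]
  have "(\<lambda>z. LINT x|lborel. f x * cnj (gabor z x)) \<in> borel_measurable lborel"
    by (rule lborel.borel_measurable_lebesgue_integral) measurable
  then show ?thesis unfolding gab_def[abs_def] L2_inner_def by simp
qed

lemma window_integrable: assumes f: "f \<in> L2" shows "integrable lborel (window f p)" "window f p \<in> L2"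
proof -
  note [measurable] = L2_measurable[OF f]
  have [measurable]: "window f p \<in> borel_measurable borel" unfolding window_def[abs_def] by measurable
  have n: "norm (window f p x) = norm (f x * cnj (gabor (p, 0) x))" for x
    by (simp add: window_def norm_mult norm_gabor)
  show "integrable lborel (window f p)"
    by (rule Bochner_Integration.integrable_bound[OF L2_inner_integrable[OF f gabor_L2[of "(p, 0)"]]]) (auto simp: n)
  have "integrable lborel (\<lambda>x. (norm (window f p x))\<^sup>2)"
  proof (rule Bochner_Integration.integrable_bound)
    show "integrable lborel (\<lambda>x. sqrt 2 * (norm (f x))\<^sup>2)" using f by (simp add: L2_integrable)
    have "(norm (window f p x))\<^sup>2 \<le> sqrt 2 * (norm (f x))\<^sup>2" for x
      unfolding n norm_mult complex_mod_cnj power_mult_distrib norm_gabor_sq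
      using mult_left_le[of "exp (- (pi * 2 * (x - p)\<^sup>2))" "sqrt 2 * (norm (f x))\<^sup>2"] by (simp add: mult_ac)
    then show "AE x in lborel. norm ((norm (window f p x))\<^sup>2) \<le> norm (sqrt 2 * (norm (f x))\<^sup>2)" by (simp add: abs_mult)
  qed measurable
  then show "window f p \<in> L2" by (simp add: L2_def)
qed

text \<open>For each fixed position the transform is the Fourier transform of
  \<open>window f p\<close>, so Plancherel applies in the frequency. By Tonelli the positions are
  then integrated first: the squared window is a probability density in p.\<close>

lemma gab_plancherel:
  assumes f: "f \<in> L2"
  shows "integrable lborel (\<lambda>z. (norm (gab f z))\<^sup>2)" "(LINT z|lborel. (norm (gab f z))\<^sup>2) = (L2_norm f)\<^sup>2"
proof -
  note [measurable] = L2_measurable[OF f] gab_measurable[OF f]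
  have "(\<integral>\<^sup>+z. ennreal ((norm (gab f z))\<^sup>2) \<partial>lborel) = (\<integral>\<^sup>+z. ennreal ((norm (gab f z))\<^sup>2) \<partial>(lborel \<Otimes>\<^sub>M lborel))"
    by (simp add: lborel_prod)
  also have "\<dots> = (\<integral>\<^sup>+p. \<integral>\<^sup>+t. ennreal ((norm (gab f (p, t)))\<^sup>2) \<partial>lborel \<partial>lborel)"
    by (rule lborel.nn_integral_fst[symmetric]) (use f in \<open>simp add: lborel_prod\<close>)
  also have "\<dots> = (\<integral>\<^sup>+p. \<integral>\<^sup>+x. ennreal ((norm (window f p x))\<^sup>2) \<partial>lborel \<partial>lborel)"
    using plancherel[OF window_integrable[OF f]] L2_integrable[OF window_integrable(2)[OF f]]
    by (simp add: gab_fourier nn_integral_eq_integral)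
  also have "\<dots> = (\<integral>\<^sup>+x. \<integral>\<^sup>+p. ennreal ((norm (window f p x))\<^sup>2) \<partial>lborel \<partial>lborel)"
    by (rule lborel_pair.Fubini') (simp add: window_def)
  also have "\<dots> = (\<integral>\<^sup>+x. ennreal ((norm (f x))\<^sup>2) \<partial>lborel)"
  proof (rule nn_integral_cong)
    fix x
    have "(norm (window f p x))\<^sup>2 = (norm (f x))\<^sup>2 * (sqrt 2 * exp (- (pi * 2 * (x - p)\<^sup>2)))" for p
      using norm_gabor_sq[of "(p, 0)" x] by (simp add: window_def norm_mult norm_gabor power_mult_distrib)
    moreover have "integrable lborel (\<lambda>p. (norm (f x))\<^sup>2 * (sqrt 2 * exp (- (pi * 2 * (x - p)\<^sup>2))))"
      using gauss_shift(3)[of 2 x] by simp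
    moreover have "(LINT p|lborel. (norm (f x))\<^sup>2 * (sqrt 2 * exp (- (pi * 2 * (x - p)\<^sup>2)))) = (norm (f x))\<^sup>2"
      using gauss_shift(4)[of 2 x] by simp
    ultimately show "(\<integral>\<^sup>+p. ennreal ((norm (window f p x))\<^sup>2) \<partial>lborel) = ennreal ((norm (f x))\<^sup>2)"
      by (simp only:) (subst nn_integral_eq_integral; simp)
  qed
  also have "\<dots> = ennreal ((L2_norm f)\<^sup>2)"
    unfolding L2_norm_sq[OF f] by (rule nn_integral_eq_integral[OF L2_integrable[OF f]]) simp
  finally have *: "(\<integral>\<^sup>+z. ennreal ((norm (gab f z))\<^sup>2) \<partial>lborel) = ennreal ((L2_norm f)\<^sup>2)" .
  show "integrable lborel (\<lambda>z. (norm (gab f z))\<^sup>2)"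
    by (rule integrableI_nonneg) (use * f in auto)
  show "(LINT z|lborel. (norm (gab f z))\<^sup>2) = (L2_norm f)\<^sup>2"
    by (subst integral_eq_nn_integral) (use * f in auto)
qed

lemma gab_add: "f \<in> L2 \<Longrightarrow> g \<in> L2 \<Longrightarrow> gab (\<lambda>x. f x + g x) z = gab f z + gab g z"
  unfolding gab_def by (rule L2_inner_add) (auto simp: gabor_L2)

lemma gab_scale: "gab (\<lambda>x. c * f x) z = c * gab f z"
  unfolding gab_def by (rule L2_inner_scale)

lemma complex_polarization:
  "4 * (a * cnj b) = of_real ((norm (a + b))\<^sup>2) - of_real ((norm (a + (-1) * b))\<^sup>2)
     + \<i> * (of_real ((norm (a + \<i> * b))\<^sup>2) - of_real ((norm (a + (-\<i>) * b))\<^sup>2))"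
proof -
  have "\<i> * \<i> = -1" by simp
  then show ?thesis
    unfolding complex_norm_square complex_cnj_add complex_cnj_mult complex_cnj_minus complex_cnj_one complex_cnj_i
    by algebra
qed

text \<open>Polarisation of the isometry \<open>gab_plancherel\<close>, applied to f + c g for the
  four fourth roots of unity c.\<close>

theorem moyal:
  assumes f: "f \<in> L2" and g: "g \<in> L2"
  shows "L2_inner f g = (LINT z|lborel. gab f z * cnj (gab g z))"
proof -
  define N where "N c = (LINT x|lborel. (norm (f x + c * g x))\<^sup>2)" for c
  define G where "G c = (LINT z|lborel. (norm (gab f z + c * gab g z))\<^sup>2)" for c
  have L: "(\<lambda>x. f x + c * g x) \<in> L2" for c by (intro L2_add L2_scale f g)
  have gab_lin: "gab (\<lambda>x. f x + c * g x) z = gab f z + c * gab g z" for c z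
    by (subst gab_add[OF f L2_scale[OF g]]) (simp add: gab_scale)
  have I1: "integrable lborel (\<lambda>x. (norm (f x + c * g x))\<^sup>2)" for c by (rule L2_integrable[OF L])
  have I2: "integrable lborel (\<lambda>z. (norm (gab f z + c * gab g z))\<^sup>2)" for c
    using gab_plancherel(1)[OF L[of c]] by (simp add: gab_lin)
  have NG: "N c = G c" for c
    using gab_plancherel(2)[OF L[of c]] unfolding gab_lin L2_norm_sq[OF L] N_def G_def by simp
  have I1c: "integrable lborel (\<lambda>x. complex_of_real ((norm (f x + c * g x))\<^sup>2))" for c
    by (rule integrable_of_real[OF I1])
  have I2c: "integrable lborel (\<lambda>z. complex_of_real ((norm (gab f z + c * gab g z))\<^sup>2))" for c
    by (rule integrable_of_real[OF I2])
  have "4 * L2_inner f g = (LINT x|lborel. 4 * (f x * cnj (g x)))"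
    unfolding L2_inner_def by simp
  also have "\<dots> = of_real (N 1) - of_real (N (-1)) + \<i> * (of_real (N \<i>) - of_real (N (-\<i>)))"
    unfolding complex_polarization N_def using I1c[of 1] I1c[of "-1"] I1c[of \<i>] I1c[of "-\<i>"]
    by (simp del: of_real_power)
  also have "\<dots> = (LINT z|lborel. 4 * (gab f z * cnj (gab g z)))"
    unfolding complex_polarization NG G_def using I2c[of 1] I2c[of "-1"] I2c[of \<i>] I2c[of "-\<i>"]
    by (simp del: of_real_power)
  finally show ?thesis by simp
qed

text \<open>The modulus of the reproducing kernel of the transform. Completing the square about the
  midpoint \<open>m\<close> leaves a Gaussian Fourier integral.\<close>

lemma norm_gab_gabor: "norm (gab (gabor z) w) = exp (- (pi / 2 * (fst z - fst w)\<^sup>2)) * exp (- (pi / 2 * (snd z - snd w)\<^sup>2))"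
proof -
  define m where "m = (fst z + fst w) / 2"
  define d where "d = exp (- (pi / 2 * (fst z - fst w)\<^sup>2))"
  define t where "t = snd z - snd w"
  have *: "gabor z x * cnj (gabor w x) = (of_real (sqrt 2 * d) * exp (\<i> * of_real (2 * pi * t * m))) *
      (of_real (exp (- (pi * 2 * (x - m)\<^sup>2))) * exp (\<i> * of_real (2 * pi * t * (x - m))))" for x
  proof -
    have 1: "2 powr (1/4) * exp (- (pi * (x - fst z)\<^sup>2)) * (2 powr (1/4) * exp (- (pi * (x - fst w)\<^sup>2))) = sqrt 2 * d * exp (- (pi * 2 * (x - m)\<^sup>2))"
    proof -
      have "- (pi * (x - fst z)\<^sup>2) + - (pi * (x - fst w)\<^sup>2) = - (pi / 2 * (fst z - fst w)\<^sup>2) + - (pi * 2 * (x - m)\<^sup>2)"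
        unfolding m_def by (simp add: field_simps power2_eq_square)
      then have "exp (- (pi * (x - fst z)\<^sup>2)) * exp (- (pi * (x - fst w)\<^sup>2)) = d * exp (- (pi * 2 * (x - m)\<^sup>2))"
        unfolding d_def by (simp only: exp_add[symmetric])
      then show ?thesis using powr_quarter_sq by (simp add: power2_eq_square mult_ac)
    qed
    have 2: "exp (\<i> * of_real (2 * pi * snd z * x)) * exp (- (\<i> * of_real (2 * pi * snd w * x))) = exp (\<i> * of_real (2 * pi * t * m)) * exp (\<i> * of_real (2 * pi * t * (x - m)))"
      unfolding exp_add[symmetric] t_def by (simp add: algebra_simps)
    have "gabor z x * cnj (gabor w x) = of_real (2 powr (1/4) * exp (- (pi * (x - fst z)\<^sup>2)) * (2 powr (1/4) * exp (- (pi * (x - fst w)\<^sup>2))))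
       * (exp (\<i> * of_real (2 * pi * snd z * x)) * exp (- (\<i> * of_real (2 * pi * snd w * x))))"
      unfolding gabor_alt cnj_gabor by (simp add: exp_cnj mult_ac)
    then show ?thesis unfolding 1 2 by (simp add: mult_ac)
  qed
  have "gab (gabor z) w = (of_real (sqrt 2 * d) * exp (\<i> * of_real (2 * pi * t * m))) *
     (LINT x|lborel. of_real (exp (- (pi * 2 * (x - m)\<^sup>2))) * exp (\<i> * of_real (2 * pi * t * (x - m))))"
    unfolding gab_def L2_inner_def * by (rule integral_mult_right_zero)
  also have "(LINT x|lborel. of_real (exp (- (pi * 2 * (x - m)\<^sup>2))) * exp (\<i> * of_real (2 * pi * t * (x - m)))) = 
     (LINT x|lborel. of_real (exp (- (pi * 2 * x\<^sup>2))) * exp (\<i> * of_real (2 * pi * t * x)))"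
    using lborel_integral_real_affine[of 1 "\<lambda>x. of_real (exp (- (pi * 2 * x\<^sup>2))) * exp (\<i> * of_real (2 * pi * t * x)) :: complex" "-m"] by simp
  also have "\<dots> = of_real (exp (- (pi * t\<^sup>2 / 2)) / sqrt 2)" by (rule gauss_fourier) simp
  finally have "norm (gab (gabor z) w) = d * exp (- (pi * t\<^sup>2 / 2))"
    by (simp add: norm_mult norm_divide d_def real_sqrt_mult del: of_real_mult)
  then show ?thesis unfolding d_def t_def by simp
qed

section \<open>A polynomial kernel\<close>

lemma borel_measurable_fst_snd [measurable (raw)]:
  fixes f :: "'a \<Rightarrow> real \<times> real"
  assumes "f \<in> measurable M borel"
  shows "(\<lambda>w. fst (f w)) \<in> borel_measurable M" "(\<lambda>w. snd (f w)) \<in> borel_measurable M"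
  by (auto intro!: measurable_compose[OF assms] borel_measurable_continuous_onI continuous_intros)

text \<open>The reproducing kernel is Gaussian, but the ratio of a Gaussian to its translate is
  unbounded. With polynomial decay a shift by \<rho> costs a factor polynomial in \<rho>, which
  \<open>eps\<close> can absorb for \<rho> = r. The product form lets integrals and lattice sums be
  taken one coordinate at a time.\<close>

definition ker :: "real \<times> real \<Rightarrow> real" where
  "ker z = 1 / ((1 + (fst z)\<^sup>2) * (1 + (snd z)\<^sup>2))"

lemma ker_nonneg [simp]: "ker z \<ge> 0" by (simp add: ker_def)

lemma ker_measurable [measurable]: "ker \<in> borel_measurable borel"
  unfolding ker_def[abs_def] by measurable

text \<open>Peetre's inequality, from b^2 <= 2 (a - b)^2 + 2 a^2.\<close>

lemma peetre: "1 / (1 + (a::real)\<^sup>2) \<le> 2 * (1 + (a - b)\<^sup>2) * (1 / (1 + b\<^sup>2))"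
proof -
  have "b\<^sup>2 \<le> 2 * (a - b)\<^sup>2 + 2 * a\<^sup>2"
    using zero_le_power2[of "2 * a - b"] by (simp add: power2_eq_square algebra_simps)
  moreover have "2 * (1 + (a - b)\<^sup>2) * (1 + a\<^sup>2) = 2 + 2 * (a - b)\<^sup>2 + 2 * a\<^sup>2 + 2 * ((a - b)\<^sup>2 * a\<^sup>2)"
    by algebra
  moreover have "0 \<le> (a - b)\<^sup>2 * a\<^sup>2" by simp
  ultimately have "1 + b\<^sup>2 \<le> 2 * (1 + (a - b)\<^sup>2) * (1 + a\<^sup>2)" by linarith
  then show ?thesis by (simp add: divide_simps add_pos_nonneg mult.commute)
qed

lemma ker_peetre:
  assumes "dist z z' \<le> \<rho>"
  shows "ker (z - w) \<le> 4 * (1 + \<rho>\<^sup>2)\<^sup>2 * ker (z' - w)"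
proof -
  have \<rho>: "\<rho> \<ge> 0" using assms zero_le_dist[of z z'] by linarith
  have f: "\<bar>fst z - fst z'\<bar> \<le> \<rho>" and s: "\<bar>snd z - snd z'\<bar> \<le> \<rho>"
    using assms dist_fst_le[of z z'] dist_snd_le[of z z'] by (auto simp: dist_real_def)
  have f': "(fst z - fst z')\<^sup>2 \<le> \<rho>\<^sup>2" and s': "(snd z - snd z')\<^sup>2 \<le> \<rho>\<^sup>2"
    using f s abs_le_square_iff[of _ \<rho>] \<rho> by auto
  have 1: "1 / (1 + (fst z - fst w)\<^sup>2) \<le> 2 * (1 + \<rho>\<^sup>2) * (1 / (1 + (fst z' - fst w)\<^sup>2))"
    by (rule order_trans[OF peetre[of _ "fst z' - fst w"]]) (use f' in \<open>intro mult_right_mono; simp\<close>)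
  have 2: "1 / (1 + (snd z - snd w)\<^sup>2) \<le> 2 * (1 + \<rho>\<^sup>2) * (1 / (1 + (snd z' - snd w)\<^sup>2))"
    by (rule order_trans[OF peetre[of _ "snd z' - snd w"]]) (use s' in \<open>intro mult_right_mono; simp\<close>)
  have "1 / (1 + (fst z - fst w)\<^sup>2) * (1 / (1 + (snd z - snd w)\<^sup>2)) \<le> 
     (2 * (1 + \<rho>\<^sup>2) * (1 / (1 + (fst z' - fst w)\<^sup>2))) * (2 * (1 + \<rho>\<^sup>2) * (1 / (1 + (snd z' - snd w)\<^sup>2)))"
    by (rule mult_mono[OF 1 2]) auto
  also have "\<dots> = 4 * (1 + \<rho>\<^sup>2)\<^sup>2 * (1 / (1 + (fst z' - fst w)\<^sup>2) * (1 / (1 + (snd z' - snd w)\<^sup>2)))"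
    unfolding power2_eq_square[of "1 + \<rho>\<^sup>2"] by (simp only: mult_ac)
  finally show ?thesis by (simp add: ker_def)
qed

lemma lborel_prod_mult:
  fixes f g :: "real \<Rightarrow> real"
  assumes f: "integrable lborel f" and g: "integrable lborel g"
  shows "integrable lborel (\<lambda>z. f (fst z) * g (snd z))"
    "(LINT z|lborel. f (fst z) * g (snd z)) = (LINT x|lborel. f x) * (LINT y|lborel. g y)"
proof -
  have "integrable (lborel \<Otimes>\<^sub>M lborel) (\<lambda>(x, y). f x * g y)"
    by (rule lborel_pair.Fubini_integrable) (use f g in \<open>auto simp: abs_mult\<close>)
  then have i: "integrable (lborel \<Otimes>\<^sub>M lborel) (\<lambda>z. f (fst z) * g (snd z))"
    by (simp add: case_prod_unfold)
  then show "integrable lborel (\<lambda>z. f (fst z) * g (snd z))" by (simp add: lborel_prod)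
  show "(LINT z|lborel. f (fst z) * g (snd z)) = (LINT x|lborel. f x) * (LINT y|lborel. g y)"
    using lborel_pair.integral_fst'[OF i] by (simp add: lborel_prod)
qed

lemma ker_integrable: "integrable lborel ker"
proof -
  have "integrable lborel (\<lambda>x::real. 1 / (1 + x\<^sup>2))"
    using integrable_inverse_1_plus_square
    by (simp add: set_integrable_def einterval_def inverse_eq_divide)
  from lborel_prod_mult(1)[OF this this] show ?thesis by (simp add: ker_def[abs_def])
qed

lemma lborel_integral_shift:
  fixes f :: "'a::euclidean_space \<Rightarrow> 'b::{banach, second_countable_topology}"
  assumes f: "integrable lborel f"
  shows "integrable lborel (\<lambda>w. f (w - z))" "(LINT w|lborel. f (w - z)) = (LINT w|lborel. f w)"
     "integrable lborel (\<lambda>w. f (z - w))" "(LINT w|lborel. f (z - w)) = (LINT w|lborel. f w)"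
proof -
  have D: "distr lborel borel (\<lambda>w. t + c *\<^sub>R w) = (lborel :: 'a measure)" if "\<bar>c\<bar> = 1" for t c
  proof -
    have "c \<noteq> 0" using that by auto
    then show ?thesis using that by (subst (2) lborel_affine[of c t]) (simp_all add: density_1)
  qed
  have i: "integrable lborel (\<lambda>w. f (t + c *\<^sub>R w))" and e: "(LINT w|lborel. f (t + c *\<^sub>R w)) = (LINT w|lborel. f w)"
    if "\<bar>c\<bar> = 1" for t c
  proof -
    have f': "f \<in> borel_measurable borel" using f by auto
    show "integrable lborel (\<lambda>w. f (t + c *\<^sub>R w))"
      using f integrable_distr_eq[of "\<lambda>w. t + c *\<^sub>R w" lborel borel f] f' D[OF that, of t] by simp
    show "(LINT w|lborel. f (t + c *\<^sub>R w)) = (LINT w|lborel. f w)"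
      using integral_distr[of "\<lambda>w. t + c *\<^sub>R w" lborel borel f] f' D[OF that, of t] by simp
  qed
  show "integrable lborel (\<lambda>w. f (w - z))" "(LINT w|lborel. f (w - z)) = (LINT w|lborel. f w)"
    using i[of 1 "-z"] e[of 1 "-z"] by simp_all
  show "integrable lborel (\<lambda>w. f (z - w))" "(LINT w|lborel. f (z - w)) = (LINT w|lborel. f w)"
    using i[of "-1" z] e[of "-1" z] by simp_all
qed

text \<open>An averaged energy density: it controls the transform in a whole disc, while its
  integral and its lattice sums stay below a multiple of the squared norm.\<close>

definition smear :: "(real \<Rightarrow> complex) \<Rightarrow> real \<times> real \<Rightarrow> real" where
  "smear f z = (LINT w|lborel. (norm (gab f w))\<^sup>2 * ker (z - w))"

lemma ker_le_1: "ker z \<le> 1"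
  unfolding ker_def by (simp add: divide_simps add_pos_nonneg mult_ge1_I)

lemma smear_integrable: 
  assumes "f \<in> L2" shows "integrable lborel (\<lambda>w. (norm (gab f w))\<^sup>2 * ker (z - w))"
proof -
  note [measurable] = gab_measurable[OF assms]
  show ?thesis
    by (rule Bochner_Integration.integrable_bound[OF gab_plancherel(1)[OF assms]])
       (auto simp: abs_mult ker_le_1 mult_left_le)
qed

lemma smear_nonneg: "smear f z \<ge> 0" unfolding smear_def by simp

text \<open>Moyal's identity against \<open>gabor z\<close> reproduces the value at z. Splitting the
  kernel modulus \<open>q\<close> into two square roots in Cauchy-Schwarz gives the average of the
  energy with weight \<open>q\<close>, times the integral of \<open>q\<close>, which is 2. The
  remaining factor 4 comes from \<open>ker_peetre\<close>.\<close>

lemma gab_le_smear: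
  assumes f: "f \<in> L2" and d: "dist z z' \<le> \<rho>"
  shows "(norm (gab f z))\<^sup>2 \<le> 8 * (1 + \<rho>\<^sup>2)\<^sup>2 * smear f z'"
proof -
  note [measurable] = gab_measurable[OF f]
  define q where "q w = exp (- (pi / 2 * (fst z - fst w)\<^sup>2)) * exp (- (pi / 2 * (snd z - snd w)\<^sup>2))" for w
  have [measurable]: "q \<in> borel_measurable borel" unfolding q_def[abs_def] by measurable
  have q0: "q w \<ge> 0" for w by (simp add: q_def)
  have q1: "q w \<le> 1" for w by (simp add: q_def mult_le_one)
  have i1: "integrable lborel (\<lambda>x. exp (- (pi / 2 * (p - x)\<^sup>2)))" and e1: "(LINT x|lborel. exp (- (pi / 2 * (p - x)\<^sup>2))) = sqrt 2" for p
    using gauss_shift(3,4)[of "1/2" p] by (simp_all add: real_sqrt_divide)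
  have qi: "integrable lborel q" and q2: "(LINT w|lborel. q w) = 2"
    unfolding q_def[abs_def] using lborel_prod_mult[OF i1[of "fst z"] i1[of "snd z"]] unfolding e1 by simp_all
  have Ui: "integrable lborel (\<lambda>w. (norm (gab f w))\<^sup>2 * q w)"
    by (rule Bochner_Integration.integrable_bound[OF gab_plancherel(1)[OF f]]) (auto simp: abs_mult q0 q1 mult_left_le)
  have "gab f z = (LINT w|lborel. gab f w * cnj (gab (gabor z) w))"
    unfolding gab_def[of f z] by (rule moyal[OF f gabor_L2])
  then have "norm (gab f z) \<le> (LINT w|lborel. norm (gab f w * cnj (gab (gabor z) w)))"
    by (simp only: integral_norm_bound)
  also have "\<dots> = (LINT w|lborel. \<bar>(norm (gab f w) * sqrt (q w)) * sqrt (q w)\<bar>)"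
  proof (rule Bochner_Integration.integral_cong[OF refl])
    fix w
    have "norm (cnj (gab (gabor z) w)) = q w" by (simp only: complex_mod_cnj norm_gab_gabor q_def)
    then show "norm (gab f w * cnj (gab (gabor z) w)) = \<bar>(norm (gab f w) * sqrt (q w)) * sqrt (q w)\<bar>"
      using q0[of w] by (simp add: norm_mult abs_mult)
  qed
  also have "\<dots> \<le> sqrt (LINT w|lborel. (norm (gab f w) * sqrt (q w))\<^sup>2) * sqrt (LINT w|lborel. (sqrt (q w))\<^sup>2)"
    by (rule Cauchy_Schwarz_integral(2)) (use Ui qi in \<open>auto simp: power_mult_distrib q0\<close>)
  finally have "norm (gab f z) \<le> sqrt (LINT w|lborel. (norm (gab f w))\<^sup>2 * q w) * sqrt 2"
    by (simp add: power_mult_distrib q0 q2)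
  then have "(norm (gab f z))\<^sup>2 \<le> (sqrt (LINT w|lborel. (norm (gab f w))\<^sup>2 * q w) * sqrt 2)\<^sup>2"
    by (intro power_mono) auto
  also have "\<dots> = (LINT w|lborel. (norm (gab f w))\<^sup>2 * q w) * 2"
    by (simp add: power_mult_distrib q0)
  also have "(LINT w|lborel. (norm (gab f w))\<^sup>2 * q w) \<le> (LINT w|lborel. 4 * (1 + \<rho>\<^sup>2)\<^sup>2 * ((norm (gab f w))\<^sup>2 * ker (z' - w)))"
  proof (rule integral_mono[OF Ui])
    show "integrable lborel (\<lambda>w. 4 * (1 + \<rho>\<^sup>2)\<^sup>2 * ((norm (gab f w))\<^sup>2 * ker (z' - w)))"
      using smear_integrable[OF f] by simp
    fix w
    have g: "exp (- (pi / 2 * a\<^sup>2)) \<le> 1 / (1 + a\<^sup>2)" for a :: real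
    proof -
      have "1 + a\<^sup>2 \<le> exp (a\<^sup>2)" by (rule exp_ge_add_one_self)
      also have "\<dots> \<le> exp (pi / 2 * a\<^sup>2)" using pi_gt3 mult_right_mono[of 1 "pi / 2" "a\<^sup>2"] by simp
      finally show ?thesis by (simp add: exp_minus field_simps add_pos_nonneg)
    qed
    have "q w \<le> ker (z - w)" unfolding q_def ker_def
      using mult_mono[OF g[of "fst z - fst w"] g[of "snd z - snd w"]] by simp
    also have "\<dots> \<le> 4 * (1 + \<rho>\<^sup>2)\<^sup>2 * ker (z' - w)" by (rule ker_peetre[OF d])
    finally have "(norm (gab f w))\<^sup>2 * q w \<le> (norm (gab f w))\<^sup>2 * (4 * (1 + \<rho>\<^sup>2)\<^sup>2 * ker (z' - w))"
      by (rule mult_left_mono) simp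
    then show "(norm (gab f w))\<^sup>2 * q w \<le> 4 * (1 + \<rho>\<^sup>2)\<^sup>2 * ((norm (gab f w))\<^sup>2 * ker (z' - w))"
      by (simp only: mult_ac)
  qed
  finally show ?thesis by (simp add: smear_def)
qed

text \<open>By \<open>peetre\<close> each term is at most 4 times its counterpart at any point of
  [n, n + 1). Integration over these disjoint intervals bounds the sum by an integral that does not
  see the shift x.\<close>

lemma sum_inverse_square_shift:
  assumes F: "finite F"
  shows "(\<Sum>n\<in>F. 1 / (1 + (x - of_int n)\<^sup>2)) \<le> 4 * (LINT s|lborel. 1 / (1 + (s::real)\<^sup>2))"
proof -
  have i: "integrable lborel (\<lambda>s::real. 1 / (1 + s\<^sup>2))"
    using integrable_inverse_1_plus_square
    by (simp add: set_integrable_def einterval_def inverse_eq_divide)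
  have ix: "integrable lborel (\<lambda>s::real. 1 / (1 + (x - s)\<^sup>2))" by (rule lborel_integral_shift(3)[OF i])
  define I where "I n = {of_int n..<of_int n + (1::real)}" for n :: int
  have Im [measurable]: "I n \<in> sets borel" for n by (simp add: I_def)
  have ii: "integrable lborel (\<lambda>s. 4 * (indicator (I n) s * (1 / (1 + (x - s)\<^sup>2))))" for n
    by (intro integrable_mult_right) (use integrable_real_mult_indicator[OF Im[of n, folded sets_lborel] ix] in \<open>simp add: mult.commute\<close>)
  have ind: "(\<Sum>n\<in>F. indicator (I n) s) \<le> (1::real)" for s
  proof -
    have "(\<Sum>n\<in>F. indicator (I n) s) \<le> (\<Sum>n\<in>F. if n = \<lfloor>s\<rfloor> then 1 else 0 :: real)"
      by (rule sum_mono) (auto simp: indicator_def I_def intro!: floor_unique[symmetric])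
    also have "\<dots> \<le> 1" using F by simp
    finally show ?thesis .
  qed
  have "(\<Sum>n\<in>F. 1 / (1 + (x - of_int n)\<^sup>2)) \<le> (\<Sum>n\<in>F. (LINT s|lborel. 4 * (indicator (I n) s * (1 / (1 + (x - s)\<^sup>2)))))"
  proof (rule sum_mono)
    fix n
    have "1 / (1 + (x - of_int n)\<^sup>2) = (LINT s|lborel. indicator (I n) s * (1 / (1 + (x - of_int n)\<^sup>2)))"
      by (simp add: I_def)
    also have "\<dots> \<le> (LINT s|lborel. 4 * (indicator (I n) s * (1 / (1 + (x - s)\<^sup>2))))"
    proof (rule integral_mono)
      show "integrable lborel (\<lambda>s. indicator (I n) s * (1 / (1 + (x - of_int n)\<^sup>2)))"
        by (simp add: I_def)
      show "integrable lborel (\<lambda>s. 4 * (indicator (I n) s * (1 / (1 + (x - s)\<^sup>2))))"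
        by (rule ii)
      fix s
      show "indicator (I n) s * (1 / (1 + (x - of_int n)\<^sup>2)) \<le> 4 * (indicator (I n) s * (1 / (1 + (x - s)\<^sup>2)))"
      proof (cases "s \<in> I n")
        case True
        have "1 / (1 + (x - of_int n)\<^sup>2) \<le> 2 * (1 + ((x - of_int n) - (x - s))\<^sup>2) * (1 / (1 + (x - s)\<^sup>2))" by (rule peetre)
        also have "\<dots> \<le> 2 * (1 + 1) * (1 / (1 + (x - s)\<^sup>2))"
          using True by (intro mult_right_mono mult_left_mono add_left_mono) (auto simp: I_def abs_square_le_1)
        finally show ?thesis using True by simp
      qed auto
    qed
    finally show "1 / (1 + (x - of_int n)\<^sup>2) \<le> (LINT s|lborel. 4 * (indicator (I n) s * (1 / (1 + (x - s)\<^sup>2))))" .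
  qed
  also have "\<dots> = (LINT s|lborel. (\<Sum>n\<in>F. 4 * (indicator (I n) s * (1 / (1 + (x - s)\<^sup>2)))))"
    by (rule Bochner_Integration.integral_sum[symmetric]) (rule ii)
  also have "\<dots> \<le> (LINT s|lborel. 4 * (1 / (1 + (x - s)\<^sup>2)))"
  proof (rule integral_mono)
    show "integrable lborel (\<lambda>s. \<Sum>n\<in>F. 4 * (indicator (I n) s * (1 / (1 + (x - s)\<^sup>2))))"
      by (intro Bochner_Integration.integrable_sum ii)
    fix s
    show "(\<Sum>n\<in>F. 4 * (indicator (I n) s * (1 / (1 + (x - s)\<^sup>2)))) \<le> 4 * (1 / (1 + (x - s)\<^sup>2))"
    proof -
      have "(\<Sum>n\<in>F. 4 * (indicator (I n) s * (1 / (1 + (x - s)\<^sup>2)))) = (\<Sum>n\<in>F. indicator (I n) s) * (4 * (1 / (1 + (x - s)\<^sup>2)))"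
        unfolding sum_distrib_right by (rule sum.cong) auto
      also have "\<dots> \<le> 1 * (4 * (1 / (1 + (x - s)\<^sup>2)))" by (intro mult_right_mono ind) auto
      finally show ?thesis by simp
    qed
  qed (use integrable_mult_right[OF ix, of 4] in simp)
  also have "\<dots> = 4 * (LINT s|lborel. 1 / (1 + (s::real)\<^sup>2))"
    using lborel_integral_shift(4)[OF i, of x] by (subst integral_mult_right_zero) simp
  finally show ?thesis .
qed

text \<open>This number also bounds the exponents in the estimates of \<open>theta\<close>, whose
  factors approach 1 faster than an inverse square.\<close>

definition lattice_const :: real where
  "lattice_const = 4 * (LINT s|lborel. 1 / (1 + (s::real)\<^sup>2))"

lemma sum_ker_lattice:
  assumes F: "finite F"
  shows "(\<Sum>(m, n)\<in>F. ker ((of_int m, of_int n) - w)) \<le> lattice_const\<^sup>2"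
proof -
  \<comment> \<open>Enlarging \<open>F\<close> to the product of its projections makes the sum
    factor.\<close>
  have "(\<Sum>(m, n)\<in>F. ker ((of_int m, of_int n) - w)) \<le> (\<Sum>(m, n)\<in>fst ` F \<times> snd ` F. ker ((of_int m, of_int n) - w))"
    by (rule sum_mono2) (use F in \<open>auto simp: rev_image_eqI\<close>)
  also have "\<dots> = (\<Sum>m\<in>fst ` F. 1 / (1 + (fst w - of_int m)\<^sup>2)) * (\<Sum>n\<in>snd ` F. 1 / (1 + (snd w - of_int n)\<^sup>2))"
    unfolding sum_product sum.cartesian_product by (simp add: ker_def power2_commute case_prod_unfold)
  also have "\<dots> \<le> lattice_const * lattice_const"
    unfolding lattice_const_def by (intro mult_mono sum_inverse_square_shift) (use F in \<open>auto intro: sum_nonneg\<close>)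
  finally show ?thesis by (simp add: power2_eq_square)
qed

section \<open>The transform as a Gaussian times an entire function\<close>

text \<open>In the exponent of the Gabor function the square of p splits off, and the terms linear
  in x combine to 2 pi x (p - i \<theta>). The exponential series in this variable is then
  integrated term by term.\<close>

lemma gab_entire:
  assumes f: "f \<in> L2"
  obtains E where "E holomorphic_on UNIV"
    "\<And>p t. gab f (p, t) = of_real (exp (- (pi * p\<^sup>2))) * E (Complex p (- t))"
proof -
  note [measurable] = L2_measurable[OF f]
  define G where "G x = f x * of_real (2 powr (1/4) * exp (- (pi * x\<^sup>2)))" for x
  have [measurable]: "G \<in> borel_measurable borel" unfolding G_def[abs_def] by measurable
  \<comment> \<open>Half of the Gaussian pays for the exponential by completing a square; the other
    half remains square integrable and is paired with \<open>f\<close>.\<close>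
  have GR: "integrable lborel (\<lambda>x. norm (G x) * exp (2 * pi * R * \<bar>x\<bar>))" for R
  proof -
    have "(\<lambda>x. of_real (exp (- (pi / 2 * x\<^sup>2)))) \<in> L2"
      using gauss_integral(1)[of 1] by (simp add: L2_def exp_double[symmetric])
    from L2_inner_integrable[OF f this]
    have "integrable lborel (\<lambda>x. 2 powr (1/4) * exp (2 * pi * R\<^sup>2) * norm (f x * cnj (of_real (exp (- (pi / 2 * x\<^sup>2))))))"
      by (intro integrable_mult_right integrable_norm)
    then show ?thesis
    proof (rule Bochner_Integration.integrable_bound)
      have "exp (- (pi * x\<^sup>2)) * exp (2 * pi * R * \<bar>x\<bar>) \<le> exp (2 * pi * R\<^sup>2) * exp (- (pi / 2 * x\<^sup>2))" for x
      proof -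
        have "0 \<le> (pi / 2) * (\<bar>x\<bar> - 2 * R)\<^sup>2" by simp
        also have "\<dots> = pi / 2 * x\<^sup>2 - 2 * pi * R * \<bar>x\<bar> + 2 * pi * R\<^sup>2" by (simp add: power2_diff algebra_simps)
        finally show ?thesis by (simp flip: exp_add)
      qed
      then have "norm (f x) * 2 powr (1/4) * (exp (- (pi * x\<^sup>2)) * exp (2 * pi * R * \<bar>x\<bar>)) \<le> norm (f x) * 2 powr (1/4) * (exp (2 * pi * R\<^sup>2) * exp (- (pi / 2 * x\<^sup>2)))" for x
        by (intro mult_left_mono) auto
      then show "AE x in lborel. norm (norm (G x) * exp (2 * pi * R * \<bar>x\<bar>)) \<le> norm (2 powr (1/4) * exp (2 * pi * R\<^sup>2) * norm (f x * cnj (of_real (exp (- (pi / 2 * x\<^sup>2))))))"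
        by (auto simp: G_def norm_mult abs_mult mult_ac)
    qed measurable
  qed
  define E where "E z = (LINT x|lborel. G x * exp (of_real (2 * pi * x) * z))" for z
  define c where "c n = (LINT x|lborel. G x * of_real ((2 * pi * x) ^ n)) / fact n" for n
  have "(\<lambda>n. c n * (z - 0) ^ n) sums E z" for z
  proof -
    define T where "T n x = G x * ((of_real (2 * pi * x) * z) ^ n /\<^sub>R fact n)" for n x
    have [measurable]: "T n \<in> borel_measurable borel" for n unfolding T_def[abs_def] by measurable
    have nT: "norm (T n x) = norm (G x) * ((2 * pi * norm z * \<bar>x\<bar>) ^ n /\<^sub>R fact n)" for n x
      by (simp add: T_def norm_mult norm_power abs_mult mult_ac)
    have sT: "(\<lambda>n. norm (T n x)) sums (norm (G x) * exp (2 * pi * norm z * \<bar>x\<bar>))" for x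
      unfolding nT by (intro sums_mult exp_converges)
    have part: "(\<Sum>n<N. norm (T n x)) \<le> norm (G x) * exp (2 * pi * norm z * \<bar>x\<bar>)" for N x
      using sum_le_suminf[OF sums_summable[OF sT[of x]], of "{..<N}"] sums_unique[OF sT[of x]] by simp
    have iT: "integrable lborel (T n)" for n
    proof (rule Bochner_Integration.integrable_bound[OF GR[of "norm z"]])
      have "norm (T n x) \<le> norm (G x) * exp (2 * pi * norm z * \<bar>x\<bar>)" for x
        by (rule order_trans[OF member_le_sum[of n "{..<Suc n}" "\<lambda>n. norm (T n x)"] part]) auto
      then show "AE x in lborel. norm (T n x) \<le> norm (norm (G x) * exp (2 * pi * norm z * \<bar>x\<bar>))"
        by (simp add: abs_mult)
    qed measurable
    have "(\<lambda>n. LINT x|lborel. T n x) sums (LINT x|lborel. (\<Sum>n. T n x))"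
    proof (rule sums_integral[OF iT])
      show "AE x in lborel. summable (\<lambda>n. norm (T n x))" using sT by (auto intro: sums_summable)
      show "summable (\<lambda>n. LINT x|lborel. norm (T n x))"
      proof (rule summableI_nonneg_bounded)
        fix N
        have "(\<Sum>n<N. (LINT x|lborel. norm (T n x))) = (LINT x|lborel. (\<Sum>n<N. norm (T n x)))"
          using iT by (intro Bochner_Integration.integral_sum[symmetric]) auto
        also have "\<dots> \<le> (LINT x|lborel. norm (G x) * exp (2 * pi * norm z * \<bar>x\<bar>))"
          using iT GR part by (intro integral_mono) auto
        finally show "(\<Sum>n<N. (LINT x|lborel. norm (T n x))) \<le> (LINT x|lborel. norm (G x) * exp (2 * pi * norm z * \<bar>x\<bar>))" .
      qed auto
    qed
    also have "(\<lambda>n. LINT x|lborel. T n x) = (\<lambda>n. c n * (z - 0) ^ n)"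
    proof
      fix n
      have "T n x = G x * of_real ((2 * pi * x) ^ n) * (z ^ n / fact n)" for x
        by (simp add: T_def power_mult_distrib scaleR_conv_of_real field_simps)
      then have "(LINT x|lborel. T n x) = (LINT x|lborel. G x * of_real ((2 * pi * x) ^ n)) * (z ^ n / fact n)"
        by simp
      then show "(LINT x|lborel. T n x) = c n * (z - 0) ^ n" by (simp add: c_def)
    qed
    also have "(\<lambda>x. \<Sum>n. T n x) = (\<lambda>x. G x * exp (of_real (2 * pi * x) * z))"
    proof
      fix x
      have "(\<lambda>n. T n x) sums (G x * exp (of_real (2 * pi * x) * z))"
        unfolding T_def by (intro sums_mult exp_converges)
      then show "(\<Sum>n. T n x) = G x * exp (of_real (2 * pi * x) * z)" by (rule sums_unique[symmetric])
    qed
    finally show ?thesis by (simp add: E_def)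
  qed
  then have ball: "E holomorphic_on ball 0 r" for r
    by (intro power_series_holomorphic[of _ _ c]) auto
  have "E holomorphic_on UNIV"
  proof -
    have "E field_differentiable (at z)" for z
      using ball[of "norm z + 1"] by (auto simp: holomorphic_on_open field_differentiable_def)
    then show ?thesis by (simp add: holomorphic_on_def field_differentiable_at_within)
  qed
  moreover have "gab f (p, t) = of_real (exp (- (pi * p\<^sup>2))) * E (Complex p (- t))" for p t
  proof -
    have "f x * cnj (gabor (p, t) x) = of_real (exp (- (pi * p\<^sup>2))) * (G x * exp (of_real (2 * pi * x) * Complex p (- t)))" for x
    proof -
      have "- (pi * (x - p)\<^sup>2) = - (pi * p\<^sup>2) + - (pi * x\<^sup>2) + 2 * pi * x * p" by (simp add: power2_diff algebra_simps)
      then have 1: "exp (- (pi * (x - p)\<^sup>2)) = exp (- (pi * p\<^sup>2)) * exp (- (pi * x\<^sup>2)) * exp (2 * pi * x * p)"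
        by (simp only: exp_add)
      have "of_real (2 * pi * x) * Complex p (- t) = of_real (2 * pi * x * p) + (- (\<i> * of_real (2 * pi * t * x)))"
        by (simp add: complex_eq_iff)
      then have 2: "exp (of_real (2 * pi * x) * Complex p (- t)) = of_real (exp (2 * pi * x * p)) * exp (- (\<i> * of_real (2 * pi * t * x)))"
        by (simp only: exp_add exp_of_real)
      show ?thesis unfolding cnj_gabor 2 G_def fst_conv snd_conv 1 by (simp add: mult_ac)
    qed
    then show ?thesis unfolding gab_def L2_inner_def E_def by simp
  qed
  ultimately show ?thesis using that by blast
qed

section \<open>Integrability of polynomial weights\<close>

lemma one_plus_abs_powr_integrable:
  assumes b: "b > 1"
  shows "integrable lborel (\<lambda>x::real. (1 + \<bar>x\<bar>) powr (- b))"
proof -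
  define g where "g x = indicator {0..} x * (1 + \<bar>x\<bar>) powr (- b)" for x :: real
  have [measurable]: "g \<in> borel_measurable borel" unfolding g_def[abs_def] by measurable
  have "(\<integral>\<^sup>+x. ennreal ((1 + x) powr (- b)) * indicator {0..} x \<partial>lborel) = ennreal (0 - - (1 / (b - 1)) * (1 + 0) powr (1 - b))"
  proof (rule nn_integral_FTC_atLeast)
    show "((\<lambda>x. - (1 / (b - 1)) * (1 + x) powr (1 - b)) has_real_derivative (1 + x) powr (- b)) (at x)" if "0 \<le> x" for x
    proof -
      have "((\<lambda>x. (1 + x) powr (1 - b)) has_real_derivative (1 - b) * (1 + x) powr (- b)) (at x)"
        using DERIV_fun_powr[of "\<lambda>x. 1 + x" 1 x "1 - b"] that by (auto intro!: derivative_eq_intros)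
      from DERIV_cmult[OF this, of "- (1 / (b - 1))"] show ?thesis
        by (rule DERIV_cong) (use b in \<open>simp add: field_simps\<close>)
    qed
    have "((\<lambda>x. (1 + x) powr (1 - b)) \<longlongrightarrow> 0) at_top"
      using b by (intro tendsto_neg_powr filterlim_tendsto_add_at_top[OF tendsto_const filterlim_ident]) auto
    then show "((\<lambda>x. - (1 / (b - 1)) * (1 + x) powr (1 - b)) \<longlongrightarrow> 0) at_top"
      by (intro tendsto_mult_right_zero)
  qed auto
  also have "(\<integral>\<^sup>+x. ennreal ((1 + x) powr (- b)) * indicator {0..} x \<partial>lborel) = (\<integral>\<^sup>+x. ennreal (g x) \<partial>lborel)"
    by (rule nn_integral_cong) (auto simp: g_def indicator_def)
  finally have gi: "integrable lborel g" by (intro integrableI_nonneg) (auto simp: g_def)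
  have "integrable lborel (\<lambda>x. g x + g (0 - x))"
    by (intro Bochner_Integration.integrable_add gi lborel_integral_shift(3)[OF gi])
  then show ?thesis
    by (rule Bochner_Integration.integrable_bound) (auto simp: g_def indicator_def)
qed

text \<open>The norm dominates both coordinates, so the power splits into two one-dimensional powers
  of exponent b / 2 > 1.\<close>

lemma one_plus_norm_powr_integrable:
  assumes b: "b > 2"
  shows "integrable lborel (\<lambda>z::real \<times> real. (1 + norm z) powr (- b))"
proof (rule Bochner_Integration.integrable_bound)
  show "integrable lborel (\<lambda>z::real \<times> real. (1 + \<bar>fst z\<bar>) powr (- (b / 2)) * (1 + \<bar>snd z\<bar>) powr (- (b / 2)))"
    using b by (intro lborel_prod_mult one_plus_abs_powr_integrable) auto
  have "(1 + norm z) powr (- b) \<le> (1 + \<bar>fst z\<bar>) powr (- (b / 2)) * (1 + \<bar>snd z\<bar>) powr (- (b / 2))" for z :: "real \<times> real"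
  proof -
    have "(1 + norm z) powr (- b) = (1 + norm z) powr (- (b / 2)) * (1 + norm z) powr (- (b / 2))"
      by (simp flip: powr_add)
    also have "\<dots> \<le> (1 + \<bar>fst z\<bar>) powr (- (b / 2)) * (1 + \<bar>snd z\<bar>) powr (- (b / 2))"
      using norm_fst_le[of "fst z" "snd z"] norm_snd_le[of "snd z" "fst z"] b by (intro mult_mono powr_mono2') auto
    finally show ?thesis .
  qed
  then show "AE z::real \<times> real in lborel. norm ((1 + norm z) powr (- b)) \<le> norm ((1 + \<bar>fst z\<bar>) powr (- (b / 2)) * (1 + \<bar>snd z\<bar>) powr (- (b / 2)))"
    by (simp add: abs_mult)
qed measurable

text \<open>Reciprocal of the weight in \<open>H_norm\<close>, hence the weight in which the
  transform of the residual has to be small.\<close>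

definition hweight :: "real \<Rightarrow> real \<times> real \<Rightarrow> real" where
  "hweight d z = 1 / (norm z powr d + 1)"

lemma hweight_measurable [measurable]: "hweight d \<in> borel_measurable borel"
  unfolding hweight_def[abs_def] by measurable

lemma hweight_bounds: "0 < hweight d z" "hweight d z \<le> 1"
  unfolding hweight_def by (auto simp: add_nonneg_pos)

lemma hweight_le: assumes d: "d \<ge> 0" shows "hweight d z \<le> 2 powr d * (1 + norm z) powr (- d)"
proof -
  have "((1 + norm z) / 2) powr d \<le> (max 1 (norm z)) powr d" using d by (intro powr_mono2) auto
  also have "\<dots> \<le> norm z powr d + 1" by (auto simp: max_def)
  finally have "((1 + norm z) / 2) powr d \<le> norm z powr d + 1" .
  moreover have "((1 + norm z) / 2) powr d = (1 + norm z) powr d / 2 powr d" by (rule powr_divide)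
  ultimately have *: "(1 + norm z) powr d / 2 powr d \<le> norm z powr d + 1" by simp
  have "1 + norm z > 0" by (simp add: add_pos_nonneg)
  then have "(1 + norm z) powr d > 0" by simp
  moreover have "norm z powr d + 1 > 0" by (simp add: add_nonneg_pos)
  ultimately show ?thesis using * unfolding hweight_def powr_minus
    by (simp add: field_simps)
qed

text \<open>This is where \<open>\<delta> > 1\<close> enters.\<close>

lemma hweight_convolution:
  assumes d: "d > 1"
  obtains C where "C > 0" "\<And>z0. integrable lborel (\<lambda>z. hweight d z / (1 + norm (z - z0)))"
    "\<And>z0. (LINT z|lborel. hweight d z / (1 + norm (z - z0))) \<le> C"
proof -
  define h where "h z = 2 powr d * (1 + norm z) powr (- (1 + d))" for z :: "real \<times> real"
  have hi: "integrable lborel h" unfolding h_def[abs_def]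
    by (intro integrable_mult_right one_plus_norm_powr_integrable) (use d in auto)
  have hz: "integrable lborel (\<lambda>z. h z + h (z - z0))" for z0
    by (intro Bochner_Integration.integrable_add hi lborel_integral_shift(1)[OF hi])
  have pt: "hweight d z / (1 + norm (z - z0)) \<le> h z + h (z - z0)" for z z0
  proof -
    define s where "s = 1 + norm z"
    define t where "t = 1 + norm (z - z0)"
    have st: "s \<ge> 1" "t \<ge> 1" by (auto simp: s_def t_def)
    \<comment> \<open>The smaller of s and t takes over both exponents. The resulting power 1 + d
      exceeds 2, which is what integrability in the plane requires.\<close>
    have "s powr (- d) * t powr (- 1) \<le> s powr (- (1 + d)) + t powr (- (1 + d))"
    proof (cases "s \<le> t")
      case True
      then have "s powr (- d) * t powr (- 1) \<le> s powr (- d) * s powr (- 1)"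
        using st by (intro mult_left_mono powr_mono2') auto
      also have "\<dots> = s powr (- (1 + d))" by (simp only: powr_add[symmetric]) (simp add: algebra_simps)
      finally show ?thesis by (smt (verit) powr_ge_zero)
    next
      case False
      then have "s powr (- d) * t powr (- 1) \<le> t powr (- d) * t powr (- 1)"
        using st d by (intro mult_right_mono powr_mono2') auto
      also have "\<dots> = t powr (- (1 + d))" by (simp only: powr_add[symmetric]) (simp add: algebra_simps)
      finally show ?thesis by (smt (verit) powr_ge_zero)
    qed
    moreover have "hweight d z * t powr (- 1) \<le> 2 powr d * s powr (- d) * t powr (- 1)"
      unfolding s_def by (intro mult_right_mono hweight_le) (use d in auto)
    moreover have "hweight d z / t = hweight d z * t powr (- 1)"
      using st by (simp add: powr_minus_divide)
    ultimately have "hweight d z / t \<le> 2 powr d * (s powr (- (1 + d)) + t powr (- (1 + d)))"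
      by (smt (verit) mult.assoc mult_left_mono powr_ge_zero)
    then show ?thesis by (simp add: h_def s_def t_def algebra_simps)
  qed
  have i: "integrable lborel (\<lambda>z. hweight d z / (1 + norm (z - z0)))" for z0
  proof (rule Bochner_Integration.integrable_bound[OF hz[of z0]])
    have "norm (hweight d z / (1 + norm (z - z0))) \<le> norm (h z + h (z - z0))" for z
    proof -
      have "0 \<le> hweight d z / (1 + norm (z - z0))" using hweight_bounds(1)[of d z] by simp
      with pt[of z z0] show ?thesis unfolding real_norm_def by linarith
    qed
    then show "AE z in lborel. norm (hweight d z / (1 + norm (z - z0))) \<le> norm (h z + h (z - z0))"
      by (rule AE_I2)
  qed measurable
  have le: "(LINT z|lborel. hweight d z / (1 + norm (z - z0))) \<le> 2 * (LINT z|lborel. h z) + 1" for z0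
  proof -
    have "(LINT z|lborel. hweight d z / (1 + norm (z - z0))) \<le> (LINT z|lborel. h z + h (z - z0))"
      by (rule integral_mono[OF i hz pt])
    also have "\<dots> = (LINT z|lborel. h z) + (LINT z|lborel. h (z - z0))"
      by (intro Bochner_Integration.integral_add hi lborel_integral_shift(1)[OF hi])
    also have "(LINT z|lborel. h (z - z0)) = (LINT z|lborel. h z)" by (rule lborel_integral_shift(2)[OF hi])
    finally show ?thesis by simp
  qed
  have "(LINT z|lborel. h z) \<ge> 0" by (rule integral_nonneg_AE) (simp add: h_def)
  then show ?thesis by (intro that[of "2 * (LINT z|lborel. h z) + 1"] i le) auto
qed

section \<open>Finite Blaschke products\<close>

text \<open>Near a zero of \<open>s\<close> the quotient is that of the two difference quotients,
  completed by the derivatives; these are holomorphic, and the denominator is nonzero there because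
  the zero is simple.\<close>

lemma holomorphic_divide_simple_zeros:
  assumes S: "open S" and f: "f holomorphic_on S" and s: "s holomorphic_on S"
    and z: "\<And>z. z \<in> S \<Longrightarrow> s z = 0 \<Longrightarrow> deriv s z \<noteq> 0 \<and> f z = 0"
  obtains h where "h holomorphic_on S" "\<And>z. z \<in> S \<Longrightarrow> f z = s z * h z"
proof
  define h where "h z = (if s z = 0 then deriv f z / deriv s z else f z / s z)" for z
  show "f z = s z * h z" if "z \<in> S" for z using z[OF that] by (auto simp: h_def)
  show "h holomorphic_on S"
    unfolding holomorphic_on_open[OF S]
  proof
    fix a assume a: "a \<in> S"
    have "\<exists>T. open T \<and> a \<in> T \<and> h holomorphic_on T"
    proof (cases "s a = 0")
      case False
      have "open (S \<inter> s -` (- {0}))"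
        by (rule continuous_open_preimage[OF holomorphic_on_imp_continuous_on[OF s] S]) auto
      moreover have "h holomorphic_on (S \<inter> s -` (- {0}))"
        by (rule holomorphic_transform[of "\<lambda>z. f z / s z"])
           (auto simp: h_def intro!: holomorphic_intros holomorphic_on_subset[OF f] holomorphic_on_subset[OF s])
      ultimately show ?thesis using a False by blast
    next
      case True
      define F where "F z = (if z = a then deriv f a else (f z - f a) / (z - a))" for z
      define G where "G z = (if z = a then deriv s a else (s z - s a) / (z - a))" for z
      have F: "F holomorphic_on S" unfolding F_def[abs_def] by (rule pole_lemma_open[OF f S])
      have G: "G holomorphic_on S" unfolding G_def[abs_def] by (rule pole_lemma_open[OF s S])
      have "open (S \<inter> G -` (- {0}))"
        by (rule continuous_open_preimage[OF holomorphic_on_imp_continuous_on[OF G] S]) auto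
      moreover have "h holomorphic_on (S \<inter> G -` (- {0}))"
      proof (rule holomorphic_transform[of "\<lambda>z. F z / G z"])
        show "(\<lambda>z. F z / G z) holomorphic_on S \<inter> G -` (- {0})"
          by (auto intro!: holomorphic_intros holomorphic_on_subset[OF F] holomorphic_on_subset[OF G])
        show "F x / G x = h x" if "x \<in> S \<inter> G -` (- {0})" for x
          using that z[OF a True] True by (auto simp: F_def G_def h_def)
      qed
      moreover have "G a \<noteq> 0" using z[OF a True] by (simp add: G_def)
      ultimately show ?thesis using a by blast
    qed
    then show "\<exists>f'. (h has_field_derivative f') (at a)"
      by (meson holomorphic_on_open)
  qed
qed

text \<open>Factors are divided out one at a time: as no two share a zero, the quotient so far still
  vanishes where the next one does.\<close>

lemma holomorphic_divide_prod:
  assumes I: "finite I" and S: "open S" and f: "f holomorphic_on S"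
    and s: "\<And>i. i \<in> I \<Longrightarrow> s i holomorphic_on S"
    and z: "\<And>i z. i \<in> I \<Longrightarrow> z \<in> S \<Longrightarrow> s i z = 0 \<Longrightarrow> deriv (s i) z \<noteq> 0 \<and> f z = 0"
    and d: "\<And>i j z. i \<in> I \<Longrightarrow> j \<in> I \<Longrightarrow> i \<noteq> j \<Longrightarrow> z \<in> S \<Longrightarrow> s i z = 0 \<Longrightarrow> s j z \<noteq> 0"
  obtains h where "h holomorphic_on S" "\<And>z. z \<in> S \<Longrightarrow> f z = (\<Prod>i\<in>I. s i z) * h z"
proof -
  have "\<exists>h. h holomorphic_on S \<and> (\<forall>z\<in>S. f z = (\<Prod>i\<in>I. s i z) * h z)"
    using I s z d
  proof (induction I)
    case empty
    then show ?case using f by (intro exI[of _ f]) auto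
  next
    case (insert i I)
    have "\<exists>h. h holomorphic_on S \<and> (\<forall>z\<in>S. f z = (\<Prod>i\<in>I. s i z) * h z)"
    proof (rule insert.IH)
      show "s j holomorphic_on S" if "j \<in> I" for j
        using insert.prems(1) that by blast
      show "deriv (s j) z \<noteq> 0 \<and> f z = 0" if "j \<in> I" "z \<in> S" "s j z = 0" for j z
        using insert.prems(2)[of j z] that by blast
      show "s k z \<noteq> 0" if "j \<in> I" "k \<in> I" "j \<noteq> k" "z \<in> S" "s j z = 0" for j k z
        using insert.prems(3)[of j k z] that by blast
    qed
    then obtain h where h: "h holomorphic_on S" "\<And>z. z \<in> S \<Longrightarrow> f z = (\<Prod>i\<in>I. s i z) * h z" by blast
    obtain k where k: "k holomorphic_on S" "\<And>z. z \<in> S \<Longrightarrow> h z = s i z * k z"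
    proof (rule holomorphic_divide_simple_zeros[OF S h(1)])
      show "s i holomorphic_on S" using insert.prems(1) by blast
      show "deriv (s i) z \<noteq> 0 \<and> h z = 0" if "z \<in> S" "s i z = 0" for z
      proof -
        have "deriv (s i) z \<noteq> 0 \<and> f z = 0" using insert.prems(2)[of i z] that by blast
        moreover have "(\<Prod>i\<in>I. s i z) \<noteq> 0"
          using insert.prems(3)[of i _ z] that insert.hyps by (metis insertCI prod_zero_iff)
        ultimately show ?thesis using h(2)[OF that(1)] by simp
      qed
    qed auto
    show ?case
      by (rule exI[of _ k]) (use k h insert.hyps in \<open>simp add: mult_ac\<close>)
  qed
  then show ?thesis using that by blast
qed

text \<open>Here \<open>g\<close> is \<open>f\<close> divided by its finite Blaschke product. On the
  circle |w| = b one has |b^2 - cnj l * w| = b |w - l|, so \<open>g\<close> and \<open>f\<close>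
  have the same modulus there, and the maximum principle carries the bound inside.\<close>

lemma blaschke_bound:
  assumes b: "b > 0" and f: "f holomorphic_on UNIV" and Z: "finite Z" "\<And>l. l \<in> Z \<Longrightarrow> norm l < b" "\<And>l. l \<in> Z \<Longrightarrow> f l = 0"
    and M: "\<And>z. norm z = b \<Longrightarrow> norm (f z) \<le> M" and z: "norm z < b"
  shows "norm (f z) \<le> M * (\<Prod>l\<in>Z. norm (of_real b * (z - l)) / norm (of_real (b\<^sup>2) - cnj l * z))"
proof -
  obtain h where h: "h holomorphic_on UNIV" "\<And>z. f z = (\<Prod>l\<in>Z. z - l) * h z"
  proof (rule holomorphic_divide_prod[where S=UNIV and f=f and I=Z and s="\<lambda>l z. z - l"])
    show "deriv (\<lambda>z. z - l) w \<noteq> 0 \<and> f w = 0" if "l \<in> Z" "w - l = 0" for l w :: complex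
    proof -
      have "((\<lambda>z. z - l) has_field_derivative 1) (at w)" by (auto intro!: derivative_eq_intros)
      then show ?thesis using that Z(3) DERIV_imp_deriv by fastforce
    qed
  qed (use f Z(1) in \<open>auto intro!: holomorphic_intros\<close>)
  define g where "g z = h z * (\<Prod>l\<in>Z. (of_real (b\<^sup>2) - cnj l * z) / of_real b)" for z
  have g: "g holomorphic_on UNIV" unfolding g_def[abs_def] using b by (intro holomorphic_intros h(1)) auto
  have gs: "norm (g w) \<le> M" if w: "norm w = b" for w
  proof -
    have *: "norm ((of_real (b\<^sup>2) - cnj l * w) / of_real b) = norm (w - l)" for l
    proof -
      have "of_real (b\<^sup>2) - cnj l * w = w * cnj (w - l)"
        using complex_norm_square[of w] w by (simp add: algebra_simps)
      then have "norm (of_real (b\<^sup>2) - cnj l * w) = b * norm (w - l)" by (simp add: norm_mult w flip: complex_cnj_diff)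
      then show ?thesis using b by (simp add: norm_divide)
    qed
    have "norm (g w) = norm (f w)"
      unfolding g_def h(2) norm_mult prod_norm[symmetric] * by (simp add: mult.commute)
    then show ?thesis using M[OF w] by simp
  qed
  have "norm (g z) \<le> M"
  proof (rule maximum_modulus_frontier[of g "ball 0 b"])
    show "g holomorphic_on interior (ball 0 b)" "continuous_on (closure (ball 0 b)) g"
      using g by (auto intro: holomorphic_on_subset holomorphic_on_imp_continuous_on continuous_on_subset)
    show "norm (g w) \<le> M" if "w \<in> frontier (ball 0 b)" for w using that b gs by auto
  qed (use z in auto)
  have nz: "of_real (b\<^sup>2) - cnj l * z \<noteq> 0" if "l \<in> Z" for l
  proof
    assume "of_real (b\<^sup>2) - cnj l * z = 0"
    then have "norm (cnj l * z) = norm (complex_of_real (b\<^sup>2))" by (metis eq_iff_diff_eq_0)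
    then have "norm l * norm z = b * b" using b by (simp add: norm_mult power2_eq_square)
    moreover have "norm l * norm z < b * b" using Z(2)[OF that] z b by (intro mult_strict_mono') auto
    ultimately show False by simp
  qed
  have "f z = g z * (\<Prod>l\<in>Z. of_real b * (z - l) / (of_real (b\<^sup>2) - cnj l * z))"
  proof -
    have "(\<Prod>l\<in>Z. (of_real (b\<^sup>2) - cnj l * z) / of_real b) * (\<Prod>l\<in>Z. of_real b * (z - l) / (of_real (b\<^sup>2) - cnj l * z)) = (\<Prod>l\<in>Z. z - l)"
      unfolding prod.distrib[symmetric] using nz b by (intro prod.cong) auto
    then show ?thesis unfolding g_def h(2) by (simp add: mult_ac)
  qed
  then have "norm (f z) = norm (g z) * (\<Prod>l\<in>Z. norm (of_real b * (z - l)) / norm (of_real (b\<^sup>2) - cnj l * z))"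
    by (simp add: norm_mult prod_norm[symmetric] norm_divide)
  also have "\<dots> \<le> M * (\<Prod>l\<in>Z. norm (of_real b * (z - l)) / norm (of_real (b\<^sup>2) - cnj l * z))"
    using \<open>norm (g z) \<le> M\<close> by (intro mult_right_mono prod_nonneg) auto
  finally show ?thesis .
qed

text \<open>Write 16 (a - l) = (16 a - l) - 15 l and use 15 |a| <= |16 a - l|. It is applied to
  fourth powers of z and l; 16 is the fourth power of b^2 / A^2 = 2.\<close>

lemma rotation_factor_bound:
  fixes a l :: complex
  assumes "norm l \<le> norm a" "a \<noteq> 0"
  shows "16 * norm (a - l) \<le> (1 + norm l / norm a) * norm (16 * a - l)"
proof -
  have "16 * norm (a - l) = norm ((16 * a - l) - 15 * l)"
  proof -
    have "(16 * a - l) - 15 * l = 16 * (a - l)" by (simp add: algebra_simps)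
    then show ?thesis by (simp only: norm_mult norm_numeral)
  qed
  also have "\<dots> \<le> norm (16 * a - l) + 15 * norm l"
    using norm_triangle_ineq4[of "16 * a - l" "15 * l"] by (simp add: norm_mult)
  also have "15 * norm l \<le> (norm l / norm a) * norm (16 * a - l)"
  proof -
    have "16 * norm a - norm l \<le> norm (16 * a - l)"
      using norm_triangle_ineq2[of "16 * a" l] by (simp add: norm_mult)
    then have "15 * norm a \<le> norm (16 * a - l)" using assms by simp
    then have "(norm l / norm a) * (15 * norm a) \<le> (norm l / norm a) * norm (16 * a - l)"
      by (intro mult_left_mono) auto
    then show ?thesis using assms by simp
  qed
  finally show ?thesis by (simp add: algebra_simps)
qed

text \<open>The logarithm of one Blaschke factor depends on the angle between z and l; its angular
  mean is - ln (b / A) = - ln 2 / 2. Rotation by i recovers most of this mean: the product over an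
  orbit depends on l^4 only and is at most (1 + x) / 4 with x = |l|^4 / A^4. Its fourth root gives
  the mean with a loss of x / 4. Over the disc this loss averages to 1/12, and ln 2 / 2 - 1/12 still
  exceeds 1/4.\<close>

lemma blaschke_orbit:
  assumes A: "A > 0" and b: "b > 0" "b\<^sup>2 = 2 * A\<^sup>2" and z: "norm z = A"
    and Z: "finite Z" "\<And>l. l \<in> Z \<Longrightarrow> norm l \<le> A" "\<And>l. l \<in> Z \<Longrightarrow> \<i> * l \<in> Z"
  shows "(\<Prod>l\<in>Z. norm (of_real b * (z - l)) / norm (of_real (b\<^sup>2) - cnj l * z)) \<le> exp (- (\<Sum>l\<in>Z. ln 2 / 2 - norm l ^ 4 / (4 * A ^ 4)))"
proof -
  define P where "P l = norm (of_real b * (z - l)) / norm (of_real (b\<^sup>2) - cnj l * z)" for l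
  have P0: "P l \<ge> 0" for l by (simp add: P_def)
  have rot: "(\<Prod>l\<in>Z. G (\<i> * l)) = (\<Prod>l\<in>Z. G l)" for G :: "complex \<Rightarrow> real"
  proof -
    have inj: "inj_on (\<lambda>l. \<i> * l) Z" by (auto simp: inj_on_def)
    have im: "(\<lambda>l. \<i> * l) ` Z = Z"
      by (rule card_subset_eq[OF Z(1)]) (use Z(3) in \<open>auto simp: card_image[OF inj]\<close>)
    then have "bij_betw (\<lambda>l. \<i> * l) Z Z" using inj by (simp add: bij_betw_def)
    then show ?thesis by (rule prod.reindex_bij_betw)
  qed
  \<comment> \<open>Comparing fourth powers avoids a choice of orbit representatives, and it covers
    l = 0, which is an orbit by itself.\<close>
  define Q where "Q l = P l * P (\<i> * l) * P (\<i> * (\<i> * l)) * P (\<i> * (\<i> * (\<i> * l)))" for l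
  have "(\<Prod>l\<in>Z. P l) ^ 4 = (\<Prod>l\<in>Z. Q l)"
    unfolding Q_def prod.distrib
    using rot[of P] rot[of "\<lambda>l. P (\<i> * l)"] rot[of "\<lambda>l. P (\<i> * (\<i> * l))"] by (simp add: power4_eq_xxxx)
  also have "\<dots> \<le> (\<Prod>l\<in>Z. exp (- (ln 2 / 2 - norm l ^ 4 / (4 * A ^ 4))) ^ 4)"
  proof (rule prod_mono, intro conjI)
    fix l assume l: "l \<in> Z"
    show "0 \<le> Q l" by (simp add: Q_def P0)
    define x where "x = norm l ^ 4 / A ^ 4"
    have nl: "norm (l ^ 4) \<le> norm (z ^ 4)" using Z(2)[OF l] z by (simp add: norm_power power_mono)
    have znz: "z \<noteq> 0" using z A by auto
    have "b ^ 4 = (b\<^sup>2)\<^sup>2" "b ^ 8 = (b\<^sup>2) ^ 4" by (simp_all flip: power_mult)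
    then have b4: "b ^ 4 = 4 * A ^ 4" and b8: "b ^ 8 = 16 * A ^ 8" by (simp_all add: b power_mult_distrib flip: power_mult)
    have num: "norm (of_real b * (z - l)) * norm (of_real b * (z - \<i> * l)) * norm (of_real b * (z - \<i> * (\<i> * l))) * norm (of_real b * (z - \<i> * (\<i> * (\<i> * l)))) = b ^ 4 * norm (z ^ 4 - l ^ 4)"
    proof -
      have "(z - l) * (z - \<i> * l) * (z - \<i> * (\<i> * l)) * (z - \<i> * (\<i> * (\<i> * l))) = z ^ 4 - l ^ 4"
        by (simp add: power4_eq_xxxx algebra_simps)
      then have "norm (z ^ 4 - l ^ 4) = norm (z - l) * norm (z - \<i> * l) * norm (z - \<i> * (\<i> * l)) * norm (z - \<i> * (\<i> * (\<i> * l)))"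
        by (simp only: norm_mult[symmetric])
      then show ?thesis using b unfolding norm_mult[of "of_real b"] by (simp only: norm_of_real abs_of_pos power4_eq_xxxx mult_ac)
    qed
    have den: "norm (of_real (b\<^sup>2) - cnj l * z) * norm (of_real (b\<^sup>2) - cnj (\<i> * l) * z) * norm (of_real (b\<^sup>2) - cnj (\<i> * (\<i> * l)) * z) * norm (of_real (b\<^sup>2) - cnj (\<i> * (\<i> * (\<i> * l))) * z)
      = norm (of_real (b ^ 8) - cnj l ^ 4 * z ^ 4)"
    proof -
      have "(c - m * z) * (c - cnj \<i> * m * z) * (c - cnj \<i> * (cnj \<i> * m) * z) * (c - cnj \<i> * (cnj \<i> * (cnj \<i> * m)) * z) = c ^ 4 - m ^ 4 * z ^ 4" for c m :: complex
        by (simp add: power4_eq_xxxx algebra_simps)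
      from this[of "of_real (b\<^sup>2)" "cnj l"] show ?thesis
        by (simp flip: norm_mult power_mult)
    qed
    have den2: "norm (of_real (b ^ 8) - cnj l ^ 4 * z ^ 4) = A ^ 4 * norm (16 * z ^ 4 - l ^ 4)"
    proof -
      have "complex_of_real (A ^ 8) = z ^ 4 * cnj z ^ 4"
      proof -
        have "complex_of_real A ^ 8 = (of_real (A\<^sup>2)) ^ 4" by (simp flip: power_mult)
        also have "of_real (A\<^sup>2) = z * cnj z" using complex_norm_square[of z] z by simp
        finally show ?thesis by (simp add: power_mult_distrib)
      qed
      then have "complex_of_real (b ^ 8) - cnj l ^ 4 * z ^ 4 = z ^ 4 * cnj (16 * z ^ 4 - l ^ 4)"
        by (simp add: b8 algebra_simps)
      then show ?thesis using z by (simp add: norm_mult norm_power del: complex_cnj_diff complex_cnj_mult complex_cnj_power)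
    qed
    have dpos: "norm (16 * z ^ 4 - l ^ 4) > 0"
    proof -
      have "16 * norm (z ^ 4) - norm (l ^ 4) \<le> norm (16 * z ^ 4 - l ^ 4)"
        using norm_triangle_ineq2[of "16 * z ^ 4" "l ^ 4"] by (simp add: norm_mult)
      moreover have "norm (z ^ 4) > 0" using znz by simp
      ultimately show ?thesis using nl by linarith
    qed
    have "Q l = b ^ 4 * norm (z ^ 4 - l ^ 4) / (A ^ 4 * norm (16 * z ^ 4 - l ^ 4))"
      unfolding Q_def P_def times_divide_times_eq num den den2 ..
    also have "\<dots> = (1/4) * (16 * norm (z ^ 4 - l ^ 4) / norm (16 * z ^ 4 - l ^ 4))"
      using A by (simp add: b4)
    also have "16 * norm (z ^ 4 - l ^ 4) / norm (16 * z ^ 4 - l ^ 4) \<le> 1 + x"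
      using rotation_factor_bound[OF nl] znz z dpos by (simp add: x_def norm_power divide_simps)
    also have "1 + x \<le> exp x" by (rule exp_ge_add_one_self)
    finally have "Q l \<le> 1/4 * exp x" by simp
    also have "1/4 * exp x = exp (- (ln 2 / 2 - norm l ^ 4 / (4 * A ^ 4))) ^ 4"
    proof -
      have "exp (- (ln 2 / 2 - norm l ^ 4 / (4 * A ^ 4))) ^ 4 = exp (x - 2 * ln 2)"
        by (simp add: x_def exp_of_nat_mult[symmetric] algebra_simps)
      also have "\<dots> = exp x / exp (ln 2) ^ 2" by (simp only: exp_diff) (simp add: exp_double)
      finally show ?thesis by (simp add: power2_eq_square)
    qed
    finally show "Q l \<le> exp (- (ln 2 / 2 - norm l ^ 4 / (4 * A ^ 4))) ^ 4" .
  qed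
  also have "\<dots> = exp (- (\<Sum>l\<in>Z. ln 2 / 2 - norm l ^ 4 / (4 * A ^ 4))) ^ 4"
    by (simp add: prod_power_distrib exp_sum[OF Z(1)] flip: sum_negf)
  finally have "(\<Prod>l\<in>Z. P l) ^ 4 \<le> exp (- (\<Sum>l\<in>Z. ln 2 / 2 - norm l ^ 4 / (4 * A ^ 4))) ^ 4" .
  then show ?thesis unfolding P_def[symmetric] by (rule power_le_imp_le_base[of _ 3, simplified]) simp
qed

section \<open>Lattice points in discs\<close>

definition gauss_lattice :: "complex \<Rightarrow> complex set" where
  "gauss_lattice s = {z. Re (z - s) \<in> \<int> \<and> Im (z - s) \<in> \<int>}"

definition unit_cell :: "complex \<Rightarrow> complex set" where
  "unit_cell l = cbox (l - Complex (1/2) (1/2)) (l + Complex (1/2) (1/2))"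

lemma unit_cell_iff: "z \<in> unit_cell l \<longleftrightarrow> \<bar>Re (z - l)\<bar> \<le> 1/2 \<and> \<bar>Im (z - l)\<bar> \<le> 1/2"
  unfolding unit_cell_def in_cbox_complex_iff by (auto simp: abs_if split: if_splits)

lemma emeasure_unit_cell: "emeasure lborel (unit_cell l) = 1"
  unfolding unit_cell_def
  by (subst emeasure_lborel_cbox) (auto simp: Basis_complex_def inner_complex_def)

lemma unit_cell_norm: "z \<in> unit_cell l \<Longrightarrow> norm (z - l) \<le> 1"
  using cmod_le[of "z - l"] by (auto simp: unit_cell_iff)

lemma unit_cell_cover: "\<exists>l\<in>gauss_lattice s. z \<in> unit_cell l"
proof
  define l where "l = s + Complex (of_int (round (Re (z - s)))) (of_int (round (Im (z - s))))"
  show "l \<in> gauss_lattice s" by (simp add: gauss_lattice_def l_def)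
  show "z \<in> unit_cell l"
    using of_int_round_abs_le[of "Re (z - s)"] of_int_round_abs_le[of "Im (z - s)"]
    by (simp add: unit_cell_iff l_def abs_minus_commute algebra_simps)
qed

lemma finite_gauss_lattice_ball: "finite (gauss_lattice s \<inter> ball 0 t)"
proof -
  obtain N :: nat where N: "real N \<ge> t + norm s" using real_arch_simple by blast
  have "gauss_lattice s \<inter> ball 0 t \<subseteq> (\<lambda>(m, n). s + Complex (of_int m) (of_int n)) ` ({-int N..int N} \<times> {-int N..int N})"
  proof
    fix z assume z: "z \<in> gauss_lattice s \<inter> ball 0 t"
    then obtain m n where mn: "Re (z - s) = of_int m" "Im (z - s) = of_int n"
      by (auto simp: gauss_lattice_def elim!: Ints_cases)
    have "norm (z - s) \<le> real N" using z N norm_triangle_ineq4[of z s] by simp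
    then have "\<bar>Re (z - s)\<bar> \<le> real N" "\<bar>Im (z - s)\<bar> \<le> real N"
      using abs_Re_le_cmod[of "z - s"] abs_Im_le_cmod[of "z - s"] by linarith+
    then have "\<bar>m\<bar> \<le> int N" "\<bar>n\<bar> \<le> int N" unfolding mn by linarith+
    moreover have "z = s + Complex (of_int m) (of_int n)" using mn by (simp add: complex_eq_iff)
    ultimately show "z \<in> (\<lambda>(m, n). s + Complex (of_int m) (of_int n)) ` ({-int N..int N} \<times> {-int N..int N})"
      by (intro image_eqI[of _ _ "(m, n)"]) auto
  qed
  then show ?thesis by (rule finite_subset) auto
qed

text \<open>The unit cells around the lattice points in the disc cover the disc of radius t - 1;
  compare areas.\<close>

lemma card_gauss_lattice_ball:
  assumes t: "t \<ge> 1"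
  shows "real (card (gauss_lattice s \<inter> ball 0 t)) \<ge> pi * (t - 1)\<^sup>2"
proof -
  define L where "L = gauss_lattice s \<inter> ball 0 t"
  have L: "finite L" unfolding L_def by (rule finite_gauss_lattice_ball)
  have "ball (0::complex) (t - 1) \<subseteq> (\<Union>l\<in>L. unit_cell l)"
  proof
    fix z :: complex assume z: "z \<in> ball 0 (t - 1)"
    obtain l where l: "l \<in> gauss_lattice s" "z \<in> unit_cell l" using unit_cell_cover by blast
    have "norm l \<le> norm z + norm (z - l)" using norm_triangle_ineq4[of z "z - l"] by simp
    then have "norm l < t" using z unit_cell_norm[OF l(2)] by simp
    then show "z \<in> (\<Union>l\<in>L. unit_cell l)" using l by (auto simp: L_def)
  qed
  then have "emeasure lborel (ball (0::complex) (t - 1)) \<le> emeasure lborel (\<Union>l\<in>L. unit_cell l)"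
    by (rule emeasure_mono) (use L in \<open>auto simp: unit_cell_def\<close>)
  also have "\<dots> \<le> (\<Sum>l\<in>L. emeasure lborel (unit_cell l))"
    by (rule emeasure_subadditive_finite) (use L in \<open>auto simp: unit_cell_def\<close>)
  also have "\<dots> = ennreal (real (card L))" by (simp add: emeasure_unit_cell ennreal_of_nat_eq_real_of_nat)
  also have "emeasure lborel (ball (0::complex) (t - 1)) = ennreal (pi * (t - 1)\<^sup>2)"
    using t by (simp add: emeasure_ball unit_ball_vol_2)
  finally show ?thesis by (simp add: L_def)
qed

text \<open>A staircase above the square, of step width 1/16; the jumps are odd multiples of 1/256
  because the first m odd numbers add up to m^2. It is used with v = (|l| / T)^2, so that every jump
  becomes a count of lattice points in a disc.\<close>

lemma square_le_step:
  assumes v: "0 \<le> v" "v \<le> (1::real)"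
  shows "v\<^sup>2 \<le> (\<Sum>j<16. (2 * real j + 1) / 256 * (if real j / 16 \<le> v then 1 else 0))"
proof -
  define k where "k = nat \<lfloor>16 * v\<rfloor>"
  have k: "real k \<le> 16 * v" "16 * v < real k + 1" using v by (auto simp: k_def)
  have *: "(\<Sum>j<n. 2 * real j + 1) = (real n)\<^sup>2" for n
    by (induction n) (auto simp: power2_eq_square algebra_simps)
  define m where "m = min 16 (k + 1)"
  have m: "v \<le> real m / 16" using k v by (auto simp: m_def min_def)
  have "v\<^sup>2 \<le> (real m / 16)\<^sup>2" using m v by (intro power_mono) auto
  also have "\<dots> = (\<Sum>j<m. (2 * real j + 1) / 256)" by (simp add: *[of m, symmetric] sum_divide_distrib power_divide)
  also have "\<dots> \<le> (\<Sum>j<m. (2 * real j + 1) / 256 * (if real j / 16 \<le> v then 1 else 0))"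
  proof (rule sum_mono)
    fix j assume "j \<in> {..<m}"
    then have "real j \<le> real k" by (auto simp: m_def)
    then have "real j / 16 \<le> v" using k by simp
    then show "(2 * real j + 1) / 256 \<le> (2 * real j + 1) / 256 * (if real j / 16 \<le> v then 1 else 0)" by simp
  qed
  also have "\<dots> \<le> (\<Sum>j<16. (2 * real j + 1) / 256 * (if real j / 16 \<le> v then 1 else 0))"
    by (rule sum_mono2) (auto simp: m_def)
  finally show ?thesis .
qed

text \<open>Because e^69 <= (272/100)^69 <= 2^100.\<close>

lemma ln_2_ge: "ln 2 \<ge> (69/100 :: real)"
proof -
  have "exp (69/100 :: real) ^ 100 = exp 1 ^ 69"
    by (simp flip: exp_of_nat_mult)
  also have "\<dots> \<le> (272/100) ^ 69" using e_less_272 by (intro power_mono) auto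
  also have "\<dots> \<le> 2 ^ 100" by (simp add: power_divide)
  finally have "exp (69/100 :: real) \<le> 2" by (rule power_le_imp_le_base[of _ 99, simplified]) simp
  then show ?thesis by (subst ln_ge_iff) auto
qed

text \<open>The numerical heart of the matter: over two lattices of covolume one the average of the weight
  exceeds \<open>1/4\<close>, so the sum beats the growth \<open>\<pi>A\<^sup>2/2\<close>. The integral of the weight over the disc is
  bounded below by a lower Riemann sum with 16 annuli of equal area.\<close>

lemma lattice_weight_sum:
  assumes T: "T \<ge> 4" and A: "T \<le> A"
  shows "(\<Sum>l\<in>gauss_lattice s \<inter> ball 0 T. ln 2 / 2 - norm l ^ 4 / (4 * A ^ 4)) \<ge> pi * (253/1000 * T\<^sup>2 - T)"
proof -
  define L where "L = gauss_lattice s \<inter> ball 0 T"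
  have L: "finite L" unfolding L_def by (rule finite_gauss_lattice_ball)
  \<comment> \<open>Half of the lower bound 69/100 for ln 2. The \<open>c j\<close> below are a
    quarter of the jumps in \<open>square_le_step\<close>.\<close>
  define \<alpha> where "\<alpha> = (345/1000 :: real)"
  define N where "N t = real (card (gauss_lattice s \<inter> ball 0 t))" for t
  define c where "c j = (2 * real j + 1) / 1024" for j
  have csum: "(\<Sum>j<16. c j) = 1/4" by (simp add: c_def numeral_eq_Suc)
  have "\<alpha> * N T - (\<Sum>j<16. c j * (N T - N (T * sqrt (real j / 16)))) \<le> (\<Sum>l\<in>L. ln 2 / 2 - norm l ^ 4 / (4 * A ^ 4))"
  proof -
    have pt: "\<alpha> - (\<Sum>j<16. c j * (if l \<in> ball 0 (T * sqrt (real j / 16)) then 0 else 1)) \<le> ln 2 / 2 - norm l ^ 4 / (4 * A ^ 4)" if l: "l \<in> L" for l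
    proof -
      define v where "v = (norm l / T)\<^sup>2"
      have v: "0 \<le> v" "v \<le> 1" using l T by (auto simp: v_def L_def power_le_one)
      have "norm l ^ 4 / A ^ 4 \<le> norm l ^ 4 / T ^ 4" using T A by (intro divide_left_mono power_mono) auto
      also have "\<dots> = v\<^sup>2" by (simp add: v_def power_divide flip: power_mult)
      also have "\<dots> \<le> (\<Sum>j<16. (2 * real j + 1) / 256 * (if real j / 16 \<le> v then 1 else 0))" by (rule square_le_step[OF v])
      also have "\<dots> = (\<Sum>j<16. (2 * real j + 1) / 256 * (if l \<in> ball 0 (T * sqrt (real j / 16)) then 0 else 1))"
      proof (rule sum.cong[OF refl])
        fix j
        have "real j / 16 \<le> v \<longleftrightarrow> sqrt (real j / 16) \<le> norm l / T"
          unfolding v_def using T by (simp add: real_le_lsqrt sqrt_le_D real_sqrt_le_iff' )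
        also have "\<dots> \<longleftrightarrow> l \<notin> ball 0 (T * sqrt (real j / 16))" using T by (simp add: field_simps not_less)
        finally show "(2 * real j + 1) / 256 * (if real j / 16 \<le> v then 1 else 0) = (2 * real j + 1) / 256 * (if l \<in> ball 0 (T * sqrt (real j / 16)) then 0 else 1)" by simp
      qed
      also have "\<dots> = 4 * (\<Sum>j<16. c j * (if l \<in> ball 0 (T * sqrt (real j / 16)) then 0 else 1))"
        unfolding sum_distrib_left by (rule sum.cong) (auto simp: c_def)
      finally have "norm l ^ 4 / (4 * A ^ 4) \<le> (\<Sum>j<16. c j * (if l \<in> ball 0 (T * sqrt (real j / 16)) then 0 else 1))" by simp
      then show ?thesis using ln_2_ge by (simp add: \<alpha>_def)
    qed
    have cnt: "(\<Sum>l\<in>L. (if l \<in> ball 0 (T * sqrt (real j / 16)) then 0 else 1)) = N T - N (T * sqrt (real j / 16))" if "j < 16" for j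
    proof -
      have "T * sqrt (real j / 16) \<le> T * 1" using T that by (intro mult_left_mono) auto
      then have sub: "gauss_lattice s \<inter> ball 0 (T * sqrt (real j / 16)) \<subseteq> L" by (auto simp: L_def)
      have "(\<Sum>l\<in>L. (if l \<in> ball 0 (T * sqrt (real j / 16)) then 0 else 1 :: real)) = real (card (L - (gauss_lattice s \<inter> ball 0 (T * sqrt (real j / 16)))))"
        using L by (subst sum.mono_neutral_cong_right[of L "L - (gauss_lattice s \<inter> ball 0 (T * sqrt (real j / 16)))" _ "\<lambda>_. 1"]) (auto simp: L_def)
      also have "\<dots> = N T - N (T * sqrt (real j / 16))"
        using card_Diff_subset[OF finite_subset[OF sub L] sub] card_mono[OF L sub] by (simp add: N_def L_def of_nat_diff)
      finally show ?thesis .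
    qed
    have "(\<Sum>j<16. c j * (N T - N (T * sqrt (real j / 16)))) = (\<Sum>j<16. c j * (\<Sum>l\<in>L. (if l \<in> ball 0 (T * sqrt (real j / 16)) then 0 else 1)))"
      by (rule sum.cong[OF refl]) (use cnt in simp)
    also have "\<dots> = (\<Sum>l\<in>L. \<Sum>j<16. c j * (if l \<in> ball 0 (T * sqrt (real j / 16)) then 0 else 1))"
      unfolding sum_distrib_left by (rule sum.swap)
    finally have "\<alpha> * N T - (\<Sum>j<16. c j * (N T - N (T * sqrt (real j / 16)))) = (\<Sum>l\<in>L. \<alpha> - (\<Sum>j<16. c j * (if l \<in> ball 0 (T * sqrt (real j / 16)) then 0 else 1)))"
      by (simp add: sum_subtractf N_def L_def mult.commute)
    also have "\<dots> \<le> (\<Sum>l\<in>L. ln 2 / 2 - norm l ^ 4 / (4 * A ^ 4))" by (rule sum_mono) (rule pt)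
    finally show ?thesis .
  qed
  \<comment> \<open>After regrouping, every count has a nonnegative coefficient, so lower bounds for
    the number of lattice points suffice.\<close>
  moreover have "\<alpha> * N T - (\<Sum>j<16. c j * (N T - N (T * sqrt (real j / 16)))) = (\<alpha> - 1/4) * N T + (\<Sum>j<16. c j * N (T * sqrt (real j / 16)))"
    unfolding right_diff_distrib sum_subtractf sum_distrib_right[symmetric] csum by (simp add: algebra_simps)
  moreover have "(\<alpha> - 1/4) * (pi * (T\<^sup>2 - 2 * T)) \<le> (\<alpha> - 1/4) * N T"
  proof (rule mult_left_mono)
    have "pi * (T\<^sup>2 - 2 * T) \<le> pi * (T - 1)\<^sup>2" by (intro mult_left_mono) (auto simp: power2_eq_square algebra_simps)
    also have "\<dots> \<le> N T" using card_gauss_lattice_ball[of T s] T by (simp add: N_def)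
    finally show "pi * (T\<^sup>2 - 2 * T) \<le> N T" .
  qed (simp add: \<alpha>_def)
  moreover have "(\<Sum>j<16. c j * (pi * (T\<^sup>2 * real j / 16 - 2 * T))) \<le> (\<Sum>j<16. c j * N (T * sqrt (real j / 16)))"
  proof (intro sum_mono mult_left_mono)
    fix j assume j: "j \<in> {..<16::nat}"
    show "pi * (T\<^sup>2 * real j / 16 - 2 * T) \<le> N (T * sqrt (real j / 16))"
    \<comment> \<open>For j = 0 the disc is empty and the bound negative. For j >= 1 the hypothesis
      T >= 4 makes the radius at least 1, as \<open>card_gauss_lattice_ball\<close> demands.\<close>
    proof (cases "j = 0")
      case True
      then show ?thesis using T by (simp add: N_def mult_nonneg_nonpos order_trans[of _ 0])
    next
      case False
      define t where "t = T * sqrt (real j / 16)"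
      have "sqrt (1/16) \<le> sqrt (real j / 16)" using False by (intro real_sqrt_le_mono) auto
      moreover have "sqrt (1/16 :: real) = 1/4" by (rule real_sqrt_unique) (auto simp: power2_eq_square)
      ultimately have "4 * (1/4) \<le> t" unfolding t_def using T by (intro mult_mono) auto
      then have t1: "t \<ge> 1" by simp
      have tT: "t \<le> T * 1" unfolding t_def using T j by (intro mult_left_mono) auto
      have "t\<^sup>2 = T\<^sup>2 * real j / 16" by (simp add: t_def power_mult_distrib)
      then have "pi * (T\<^sup>2 * real j / 16 - 2 * T) \<le> pi * (t - 1)\<^sup>2"
        using tT by (intro mult_left_mono) (auto simp: power2_diff)
      also have "\<dots> \<le> N t" using card_gauss_lattice_ball[OF t1, of s] by (simp add: N_def)
      finally show ?thesis by (simp only: t_def)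
    qed
  qed (simp add: c_def)
  \<comment> \<open>Here 2600 = 2 * 1240 + 120, from the sums of j^2 and of j below 16; the fraction
    is the lower Riemann sum for 1/6. Together with \<alpha> - 1/4 = 95/1000 it exceeds
    253/1000.\<close>
  moreover have "(\<Sum>j<16. c j * (pi * (T\<^sup>2 * real j / 16 - 2 * T))) = pi * (T\<^sup>2 * (2600/16384) - T / 2)"
    by (simp add: c_def numeral_eq_Suc algebra_simps)
  ultimately have "(\<alpha> - 1/4) * (pi * (T\<^sup>2 - 2 * T)) + pi * (T\<^sup>2 * (2600/16384) - T / 2) \<le> (\<Sum>l\<in>L. ln 2 / 2 - norm l ^ 4 / (4 * A ^ 4))"
    by linarith
  moreover have "pi * (253/1000 * T\<^sup>2 - T) \<le> (\<alpha> - 1/4) * (pi * (T\<^sup>2 - 2 * T)) + pi * (T\<^sup>2 * (2600/16384) - T / 2)"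
  proof -
    have *: "253/1000 * q - t \<le> (345/1000 - 1/4) * (q - 2 * t) + (q * (2600/16384) - t / 2)"
      if "q \<ge> 0" "t \<ge> 0" for q t :: real
    proof -
      have "(345/1000 - 1/4) * (q - 2 * t) + (q * (2600/16384) - t / 2) - (253/1000 * q - t)
          = (345/1000 - 1/4 + 2600/16384 - 253/1000) * q + (1/2 - 2 * (345/1000 - 1/4)) * t"
        by (simp add: field_simps)
      also have "\<dots> \<ge> 0" using that by (intro add_nonneg_nonneg mult_nonneg_nonneg) auto
      finally show ?thesis by (simp only: diff_ge_0_iff_ge)
    qed
    have "253/1000 * T\<^sup>2 - T \<le> (\<alpha> - 1/4) * (T\<^sup>2 - 2 * T) + (T\<^sup>2 * (2600/16384) - T / 2)"
      unfolding \<alpha>_def by (rule *) (use T in auto)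
    then have "pi * (253/1000 * T\<^sup>2 - T) \<le> pi * ((\<alpha> - 1/4) * (T\<^sup>2 - 2 * T) + (T\<^sup>2 * (2600/16384) - T / 2))"
      by (intro mult_left_mono) auto
    then show ?thesis by (simp add: algebra_simps)
  qed
  ultimately show ?thesis unfolding L_def by linarith
qed

section \<open>Truncated theta function\<close>

definition half_shift :: complex where "half_shift = Complex (1/2) (1/2)"

text \<open>For the shifted lattice, i times \<open>half_shift\<close> is \<open>half_shift\<close>
  - 1. This is the symmetry required by \<open>blaschke_orbit\<close>.\<close>

lemma gauss_lattice_rotate:
  "l \<in> gauss_lattice 0 \<Longrightarrow> \<i> * l \<in> gauss_lattice 0"
  "l \<in> gauss_lattice half_shift \<Longrightarrow> \<i> * l \<in> gauss_lattice half_shift"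
proof -
  show "l \<in> gauss_lattice 0 \<Longrightarrow> \<i> * l \<in> gauss_lattice 0"
    by (simp add: gauss_lattice_def)
  assume l: "l \<in> gauss_lattice half_shift"
  then have "Re (\<i> * l - half_shift) = - Im (l - half_shift) - 1" "Im (\<i> * l - half_shift) = Re (l - half_shift)"
    by (simp_all add: half_shift_def)
  then show "\<i> * l \<in> gauss_lattice half_shift" using l by (simp add: gauss_lattice_def del: minus_complex.sel)
qed

lemma gauss_lattice_disjoint: "gauss_lattice 0 \<inter> gauss_lattice half_shift = {}"
proof -
  have False if "Re l \<in> \<int>" "Re l - 1/2 \<in> \<int>" for l
  proof -
    from that obtain m n where "Re l = of_int m" "Re l - 1/2 = of_int n" by (metis Ints_cases)
    then have "of_int (2 * (m - n)) = (1::real)" by simp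
    then have "2 * (m - n) = 1" by (metis of_int_1 of_int_eq_iff)
    then show False by presburger
  qed
  then show ?thesis by (auto simp: gauss_lattice_def half_shift_def)
qed

text \<open>Jensen-type bound: double-density zeros in a disc make \<open>f\<close> small on the boundary of that disc,
  although nothing is known about the zeros of \<open>f\<close> outside.\<close>

lemma double_lattice_bound:
  assumes f: "f holomorphic_on UNIV" and T: "T \<ge> 4" "T \<le> A" and z: "norm z = A"
    and zero: "\<And>l. l \<in> gauss_lattice 0 \<union> gauss_lattice half_shift \<Longrightarrow> norm l < T \<Longrightarrow> f l = 0"
    and M: "\<And>w. norm w = sqrt 2 * A \<Longrightarrow> norm (f w) \<le> M"
  shows "norm (f z) \<le> M * exp (- (pi * (506/1000 * T\<^sup>2 - 2 * T)))"
proof -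
  have A: "A > 0" using T by simp
  define b where "b = sqrt 2 * A"
  have b: "b > 0" "b\<^sup>2 = 2 * A\<^sup>2" "A < b" using A by (auto simp: b_def power_mult_distrib)
  define Z where "Z = (gauss_lattice 0 \<inter> ball 0 T) \<union> (gauss_lattice half_shift \<inter> ball 0 T)"
  have Zf: "finite Z" unfolding Z_def using finite_gauss_lattice_ball by auto
  have ZT: "norm l < T" if "l \<in> Z" for l using that by (auto simp: Z_def)
  have M0: "M \<ge> 0"
  proof -
    have "norm (of_real (sqrt 2 * A) :: complex) = sqrt 2 * A" using A by (simp add: norm_mult)
    from M[OF this] show ?thesis using norm_ge_zero order_trans by blast
  qed
  have "norm (f z) \<le> M * (\<Prod>l\<in>Z. norm (of_real b * (z - l)) / norm (of_real (b\<^sup>2) - cnj l * z))"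
  proof (rule blaschke_bound[OF b(1) f Zf])
    show "norm l < b" if "l \<in> Z" for l using ZT[OF that] T b by simp
    show "f l = 0" if "l \<in> Z" for l using that zero by (auto simp: Z_def)
    show "norm (f w) \<le> M" if "norm w = b" for w using that M by (simp add: b_def)
  qed (use z b in auto)
  also have "(\<Prod>l\<in>Z. norm (of_real b * (z - l)) / norm (of_real (b\<^sup>2) - cnj l * z)) \<le> exp (- (\<Sum>l\<in>Z. ln 2 / 2 - norm l ^ 4 / (4 * A ^ 4)))"
  proof (rule blaschke_orbit[OF A b(1,2) z Zf])
    show "norm l \<le> A" if "l \<in> Z" for l using ZT[OF that] T by simp
    show "\<i> * l \<in> Z" if "l \<in> Z" for l
      using that gauss_lattice_rotate[of l] by (auto simp: Z_def norm_mult)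
  qed
  also have "(\<Sum>l\<in>Z. ln 2 / 2 - norm l ^ 4 / (4 * A ^ 4)) = 
     (\<Sum>l\<in>gauss_lattice 0 \<inter> ball 0 T. ln 2 / 2 - norm l ^ 4 / (4 * A ^ 4)) + (\<Sum>l\<in>gauss_lattice half_shift \<inter> ball 0 T. ln 2 / 2 - norm l ^ 4 / (4 * A ^ 4))"
    unfolding Z_def by (rule sum.union_disjoint) (use finite_gauss_lattice_ball gauss_lattice_disjoint in auto)
  also have "exp (- \<dots>) \<le> exp (- (pi * (506/1000 * T\<^sup>2 - 2 * T)))"
    using lattice_weight_sum[OF T, of 0] lattice_weight_sum[OF T, of half_shift] by (simp add: algebra_simps)
  finally show ?thesis using M0 by (simp add: mult_left_mono)
qed

section \<open>The theta function, its zeros and its size\<close>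

text \<open>The factor belonging to the column of zeros Re z = n. The sign in the exponent is chosen
  so that the factor tends to 1 on the side facing the origin; columns with |n| well above |Re z|
  thus contribute almost nothing.\<close>

definition theta_factor :: "int \<Rightarrow> complex \<Rightarrow> complex" where
  "theta_factor n z = (if n > 0 then 1 - exp (of_real (2 * pi) * (z - of_int n)) else 1 - exp (- (of_real (2 * pi) * (z - of_int n))))"

lemma exp_2pi_eq_1: "exp (of_real (2 * pi) * w) = 1 \<longleftrightarrow> Re w = 0 \<and> Im w \<in> \<int>"
proof -
  have "exp (of_real (2 * pi) * w) = 1 \<longleftrightarrow> Re w = 0 \<and> (\<exists>n::int. 2 * pi * Im w = of_int (2 * n) * pi)"
    unfolding exp_eq_1 by simp
  also have "(\<exists>n::int. 2 * pi * Im w = of_int (2 * n) * pi) \<longleftrightarrow> Im w \<in> \<int>"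
    by (auto simp: Ints_def)
  finally show ?thesis .
qed

lemma theta_factor_zero_iff: "theta_factor n z = 0 \<longleftrightarrow> Re z = of_int n \<and> Im z \<in> \<int>"
proof -
  have *: "- (of_real (2 * pi) * (z - of_int n)) = of_real (2 * pi) * (of_int n - z)" by (simp add: algebra_simps)
  show ?thesis
    using exp_2pi_eq_1[of "z - of_int n"] exp_2pi_eq_1[of "of_int n - z"] unfolding theta_factor_def *
    by (auto simp del: of_real_mult)
qed

lemma theta_factor_deriv: "(theta_factor n has_field_derivative 
   (if n > 0 then - (of_real (2 * pi) * exp (of_real (2 * pi) * (z - of_int n))) else of_real (2 * pi) * exp (- (of_real (2 * pi) * (z - of_int n))))) (at z)"
  unfolding theta_factor_def[abs_def] by (cases "n > 0") (auto intro!: derivative_eq_intros)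

lemma theta_factor_holomorphic: "theta_factor n holomorphic_on S"
  unfolding theta_factor_def[abs_def] by (cases "n > 0") (auto intro!: holomorphic_intros)

lemma theta_factor_deriv_nz: "deriv (theta_factor n) z \<noteq> 0"
  using DERIV_imp_deriv[OF theta_factor_deriv[of n z]] by auto

text \<open>A theta function of the lattice \<open>\<int>[\<i>]\<close>, truncated to the zeros with \<open>\<bar>Re z\<bar> \<le> N\<close>; the truncation
  avoids infinite products and is harmless on bounded sets.\<close>

definition theta :: "nat \<Rightarrow> complex \<Rightarrow> complex" where
  "theta N z = exp (of_real pi * z) * (\<Prod>n\<in>{-int N..int N}. theta_factor n z)"

lemma theta_divide:
  assumes S: "open S" and f: "f holomorphic_on S"
    and z: "\<And>z. z \<in> S \<Longrightarrow> Re z \<in> \<int> \<Longrightarrow> Im z \<in> \<int> \<Longrightarrow> f z = 0"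
  obtains h where "h holomorphic_on S" "\<And>z. z \<in> S \<Longrightarrow> f z = theta N z * h z"
proof -
  obtain h where h: "h holomorphic_on S" "\<And>z. z \<in> S \<Longrightarrow> f z = (\<Prod>n\<in>{-int N..int N}. theta_factor n z) * h z"
  proof (rule holomorphic_divide_prod[where I="{-int N..int N}" and s=theta_factor, OF _ S f])
    show "deriv (theta_factor i) w \<noteq> 0 \<and> f w = 0" if "w \<in> S" "theta_factor i w = 0" for i w
      using that z[of w] theta_factor_deriv_nz by (auto simp: theta_factor_zero_iff)
    show "theta_factor j w \<noteq> 0" if "i \<noteq> j" "theta_factor i w = 0" for i j w
      using that by (auto simp: theta_factor_zero_iff)
  qed (auto simp: theta_factor_holomorphic)
  show ?thesis
  proof (rule that)
    show "(\<lambda>z. exp (- (of_real pi * z)) * h z) holomorphic_on S" by (intro holomorphic_intros h(1))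
    show "f z = theta N z * (exp (- (of_real pi * z)) * h z)" if "z \<in> S" for z
      using h(2)[OF that] by (simp add: theta_def exp_minus)
  qed
qed

text \<open>The piecewise linear growth exponent of \<open>theta\<close> interpolates x^2 at the
  integers: the difference is s - s^2 for the fractional part s of x. The summand x, which stems
  from exp (pi z), makes the exponent even although n = 0 is counted with the negative
  columns.\<close>

lemma sum_pos_part:
  assumes "0 \<le> x" "x \<le> real N"
  shows "0 \<le> x + 2 * (\<Sum>n=1..N. max 0 (x - real n)) - x\<^sup>2" "x + 2 * (\<Sum>n=1..N. max 0 (x - real n)) - x\<^sup>2 \<le> 1/4"
proof -
  define m where "m = nat \<lfloor>x\<rfloor>"
  define s where "s = x - real m"
  have s: "0 \<le> s" "s < 1" using assms unfolding s_def m_def by (simp_all, linarith)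
  have x: "x = real m + s" by (simp add: s_def)
  have mN: "m \<le> N" using assms s x by linarith
  have "(\<Sum>n=1..N. max 0 (x - real n)) = (\<Sum>n=1..m. max 0 (x - real n))"
    by (rule sum.mono_neutral_right) (use mN s x in auto)
  also have "\<dots> = (\<Sum>n=1..m. x - real n)" by (rule sum.cong) (use s x in auto)
  also have "\<dots> = real m * x - real m * (real m + 1) / 2"
    by (simp add: sum_subtractf) (induction m; simp add: field_simps)
  finally have S: "(\<Sum>n=1..N. max 0 (x - real n)) = real m * x - real m * (real m + 1) / 2" .
  have "x + 2 * (\<Sum>n=1..N. max 0 (x - real n)) - x\<^sup>2 = s - s\<^sup>2"
    unfolding S by (simp add: x power2_eq_square field_simps)
  moreover have "s\<^sup>2 \<le> s" using s by (simp add: power2_eq_square mult_left_le)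
  moreover have "s - s\<^sup>2 \<le> 1/4" using zero_le_power2[of "s - 1/2"] by (simp add: power2_eq_square algebra_simps)
  ultimately show "0 \<le> x + 2 * (\<Sum>n=1..N. max 0 (x - real n)) - x\<^sup>2" "x + 2 * (\<Sum>n=1..N. max 0 (x - real n)) - x\<^sup>2 \<le> 1/4" by auto
qed

text \<open>The growth exponent of one factor in units of 2 pi. \<open>theta_rest\<close> is what
  remains once this exponential is taken out; it tends to 1 on both sides of the column.\<close>

definition theta_slope :: "int \<Rightarrow> real \<Rightarrow> real" where
  "theta_slope n x = (if n > 0 then max 0 (x - of_int n) else max 0 (of_int n - x))"

definition theta_rest :: "int \<Rightarrow> complex \<Rightarrow> complex" where
  "theta_rest n z = (if Re z \<ge> of_int n then 1 - exp (- (of_real (2 * pi) * (z - of_int n))) else 1 - exp (of_real (2 * pi) * (z - of_int n)))"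

lemma norm_theta_factor: "norm (theta_factor n z) = exp (2 * pi * theta_slope n (Re z)) * norm (theta_rest n z)"
proof -
  define w where "w = of_real (2 * pi) * (z - of_int n)"
  have Rw: "Re w = 2 * pi * (Re z - of_int n)" by (simp add: w_def)
  have 1: "norm (1 - exp w) = exp (Re w) * norm (1 - exp (- w))"
  proof -
    have "1 - exp w = - exp w * (1 - exp (- w))" by (simp add: exp_minus algebra_simps)
    then show ?thesis by (simp only: norm_mult norm_minus_cancel norm_exp_eq_Re)
  qed
  have 2: "norm (1 - exp (- w)) = exp (- Re w) * norm (1 - exp w)"
    using 1 by (simp add: exp_minus)
  show ?thesis unfolding theta_factor_def theta_rest_def w_def[symmetric] theta_slope_def
    using 1 2 Rw by (auto simp: max_def algebra_simps)
qed

lemma theta_slope_sum: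
  assumes "\<bar>x\<bar> \<le> real N"
  shows "x\<^sup>2 \<le> x + 2 * (\<Sum>n\<in>{-int N..int N}. theta_slope n x)" "x + 2 * (\<Sum>n\<in>{-int N..int N}. theta_slope n x) \<le> x\<^sup>2 + 1/4"
proof -
  have sp: "(\<Sum>n\<in>{-int N..int N}. theta_slope n x) = (\<Sum>n=1..N. max 0 (x - real n)) + (max 0 (- x) + (\<Sum>n=1..N. max 0 (- x - real n)))"
  proof -
    have "{-int N..int N} = (int ` {1..N}) \<union> ((\<lambda>n. - int n) ` {0..N})"
    proof (intro equalityI subsetI)
      fix k assume k: "k \<in> {-int N..int N}"
      show "k \<in> (int ` {1..N}) \<union> ((\<lambda>n. - int n) ` {0..N})"
      proof (cases "k > 0")
        case True then show ?thesis using k by (intro UnI1 image_eqI[of _ _ "nat k"]) auto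
      next
        case False then show ?thesis using k by (intro UnI2 image_eqI[of _ _ "nat (- k)"]) auto
      qed
    qed auto
    then have "(\<Sum>n\<in>{-int N..int N}. theta_slope n x) = (\<Sum>n\<in>int ` {1..N}. theta_slope n x) + (\<Sum>n\<in>(\<lambda>n. - int n) ` {0..N}. theta_slope n x)"
      by (simp only:) (rule sum.union_disjoint, auto)
    also have "(\<Sum>n\<in>int ` {1..N}. theta_slope n x) = (\<Sum>n=1..N. max 0 (x - real n))"
      by (subst sum.reindex) (auto simp: theta_slope_def inj_on_def)
    also have "(\<Sum>n\<in>(\<lambda>n. - int n) ` {0..N}. theta_slope n x) = (\<Sum>n=0..N. max 0 (- x - real n))"
      by (subst sum.reindex) (auto simp: theta_slope_def inj_on_def intro!: sum.cong arg_cong2[where f=max])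
    also have "\<dots> = max 0 (- x) + (\<Sum>n=1..N. max 0 (- x - real n))"
      by (simp add: sum.atLeast_Suc_atMost)
    finally show ?thesis .
  qed
  have neg: "(\<Sum>n=1..N. max 0 (y - real n)) = 0" if "y \<le> 0" for y
    by (rule sum.neutral) (use that in auto)
  show "x\<^sup>2 \<le> x + 2 * (\<Sum>n\<in>{-int N..int N}. theta_slope n x)" "x + 2 * (\<Sum>n\<in>{-int N..int N}. theta_slope n x) \<le> x\<^sup>2 + 1/4"
    using sum_pos_part[of x N] sum_pos_part[of "-x" N] neg[of x] neg[of "-x"] assms unfolding sp
    by (cases "x \<ge> 0"; auto)+
qed

lemma theta_norm_eq:
  "norm (theta N z) * exp (- (pi * (Re z)\<^sup>2)) = 
   exp (pi * (Re z + 2 * (\<Sum>n\<in>{-int N..int N}. theta_slope n (Re z)) - (Re z)\<^sup>2)) * (\<Prod>n\<in>{-int N..int N}. norm (theta_rest n z))"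
proof -
  define S where "S = (\<Sum>n\<in>{-int N..int N}. theta_slope n (Re z))"
  have n: "norm (theta N z) = exp (pi * Re z) * (exp (2 * pi * S) * (\<Prod>n\<in>{-int N..int N}. norm (theta_rest n z)))"
    by (simp add: theta_def norm_mult prod_norm[symmetric] norm_theta_factor prod.distrib exp_sum S_def sum_distrib_left)
  have "pi * (Re z + 2 * S - (Re z)\<^sup>2) = pi * Re z + 2 * pi * S + - (pi * (Re z)\<^sup>2)"
    by (simp add: algebra_simps)
  then show ?thesis unfolding S_def[symmetric] n by (simp only: exp_add mult_ac)
qed

lemma exp_le_inverse_square: "exp (- (2 * pi * \<bar>y\<bar>)) \<le> 1 / (1 + y\<^sup>2)"
proof -
  have "1 + y\<^sup>2 \<le> (1 + \<bar>y\<bar>)\<^sup>2" by (simp add: power2_sum)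
  also have "\<dots> \<le> (exp \<bar>y\<bar>)\<^sup>2" by (intro power_mono exp_ge_add_one_self) auto
  also have "\<dots> = exp (2 * \<bar>y\<bar>)" by (simp add: exp_double)
  also have "\<dots> \<le> exp (2 * pi * \<bar>y\<bar>)" using pi_gt3 by (simp add: mult_right_mono)
  finally show ?thesis by (simp add: exp_minus divide_simps add_pos_nonneg)
qed

lemma theta_exp_sum: "(\<Sum>n\<in>{-int N..int N}. exp (- (2 * pi * \<bar>x - of_int n\<bar>))) \<le> lattice_const"
  unfolding lattice_const_def
  by (rule order_trans[OF sum_mono sum_inverse_square_shift]) (auto intro: exp_le_inverse_square)

lemma norm_theta_rest_diff: "norm (theta_rest n z - 1) = exp (- (2 * pi * \<bar>Re z - of_int n\<bar>))"
  unfolding theta_rest_def by (auto simp: norm_exp_eq_Re algebra_simps)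

lemma theta_upper:
  assumes "\<bar>Re z\<bar> \<le> real N"
  shows "norm (theta N z) * exp (- (pi * (Re z)\<^sup>2)) \<le> exp (pi + lattice_const)"
proof -
  have "norm (theta_rest n z) \<le> exp (exp (- (2 * pi * \<bar>Re z - of_int n\<bar>)))" for n
  proof -
    have "norm (theta_rest n z) \<le> 1 + norm (theta_rest n z - 1)"
      using norm_triangle_ineq[of 1 "theta_rest n z - 1"] by simp
    also have "\<dots> \<le> exp (norm (theta_rest n z - 1))" by (rule exp_ge_add_one_self)
    finally show ?thesis unfolding norm_theta_rest_diff .
  qed
  then have "(\<Prod>n\<in>{-int N..int N}. norm (theta_rest n z)) \<le> (\<Prod>n\<in>{-int N..int N}. exp (exp (- (2 * pi * \<bar>Re z - of_int n\<bar>))))"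
    by (intro prod_mono) auto
  also have "\<dots> \<le> exp lattice_const" using theta_exp_sum[of "Re z" N] by (simp flip: exp_sum)
  finally have 1: "(\<Prod>n\<in>{-int N..int N}. norm (theta_rest n z)) \<le> exp lattice_const" .
  have "exp (pi * (Re z + 2 * (\<Sum>n\<in>{-int N..int N}. theta_slope n (Re z)) - (Re z)\<^sup>2)) \<le> exp (pi * 1)"
    using theta_slope_sum(2)[OF assms] by simp
  then have "norm (theta N z) * exp (- (pi * (Re z)\<^sup>2)) \<le> exp (pi * 1) * exp lattice_const"
    unfolding theta_norm_eq by (intro mult_mono 1) (auto intro: prod_nonneg)
  then show ?thesis by (simp flip: exp_add)
qed

text \<open>On these lines either \<open>\<bar>Re z - n\<bar> \<ge> 1/2\<close>, or the exponential in each factor is a negative real.\<close>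

lemma theta_rest_lower:
  assumes "Re z - 1/2 \<in> \<int> \<or> Im z - 1/2 \<in> \<int>"
  shows "exp (- (2 * exp (- (2 * pi * \<bar>Re z - of_int n\<bar>)))) \<le> norm (theta_rest n z)"
  using assms
proof
  assume "Re z - 1/2 \<in> \<int>"
  then obtain m where m: "Re z - 1/2 = of_int m" by (auto elim: Ints_cases)
  have "1/2 \<le> \<bar>Re z - of_int n\<bar>"
  proof -
    have "Re z - of_int n = of_int (m - n) + 1/2" using m by simp
    moreover have "real_of_int (m - n) \<ge> 0 \<or> real_of_int (m - n) \<le> -1"
      by (cases "m - n \<ge> 0") linarith+
    ultimately show ?thesis by linarith
  qed
  \<comment> \<open>For 0 < v <= 1/2 one has 1 - v >= 1 / (1 + 2 v) >= exp (- 2 v).\<close>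
  define v where "v = exp (- (2 * pi * \<bar>Re z - of_int n\<bar>))"
  have "2 * pi * (1/2) \<le> 2 * pi * \<bar>Re z - of_int n\<bar>" using \<open>1/2 \<le> \<bar>Re z - of_int n\<bar>\<close> by (intro mult_left_mono) auto
  then have "- (2 * pi * \<bar>Re z - of_int n\<bar>) \<le> - 1" using pi_gt3 by linarith
  then have "v \<le> exp (- 1)" unfolding v_def by (simp only: exp_le_cancel_iff)
  also have "exp (- 1 :: real) \<le> 1/2" using exp_ge_add_one_self[of "1::real"] by (simp add: exp_minus field_simps)
  finally have v: "v \<le> 1/2" "v > 0" by (auto simp: v_def)
  have "exp (- (2 * v)) * (1 + 2 * v) \<le> exp (- (2 * v)) * exp (2 * v)"
    by (intro mult_left_mono exp_ge_add_one_self) auto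
  also have "\<dots> = 1" by (simp flip: exp_add)
  finally have "exp (- (2 * v)) \<le> 1 / (1 + 2 * v)" using v by (simp add: field_simps)
  also have "\<dots> \<le> 1 - v"
  proof -
    have "1 \<le> (1 - v) * (1 + 2 * v)" using v mult_left_mono[of v "1/2" v] by (simp add: algebra_simps)
    then show ?thesis using v by (simp add: divide_simps)
  qed
  also have "\<dots> \<le> norm (theta_rest n z)"
    using norm_triangle_ineq2[of 1 "1 - theta_rest n z"] norm_theta_rest_diff[of n z] by (simp add: v_def norm_minus_commute)
  finally show ?thesis by (simp add: v_def)
next
  assume "Im z - 1/2 \<in> \<int>"
  then obtain m where m: "Im z - 1/2 = of_int m" by (auto elim: Ints_cases)
  then have I: "Im z = of_int m + 1/2" by simp
  have c: "cos (2 * pi * Im z) = -1"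
  proof -
    have "2 * pi * Im z = pi + 2 * pi * of_int m" using I by (simp add: algebra_simps)
    then show ?thesis by (simp add: cos_add)
  qed
  have "Re (theta_rest n z) = 1 + exp (- (2 * pi * \<bar>Re z - of_int n\<bar>))"
    unfolding theta_rest_def using c by (auto simp: Re_exp algebra_simps)
  then have "1 \<le> norm (theta_rest n z)" using complex_Re_le_cmod[of "theta_rest n z"] by (smt (verit) exp_gt_zero)
  moreover have "exp (- (2 * exp (- (2 * pi * \<bar>Re z - of_int n\<bar>)))) \<le> 1" by simp
  ultimately show ?thesis by linarith
qed

text \<open>The condition says that z lies on the grid of half-integer lines, which keeps away from
  the zeros; contours are therefore built from such lines. The bound is free of
  \<open>N\<close>.\<close>

lemma theta_lower:
  assumes N: "\<bar>Re z\<bar> \<le> real N" and "Re z - 1/2 \<in> \<int> \<or> Im z - 1/2 \<in> \<int>"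
  shows "exp (- (2 * lattice_const)) \<le> norm (theta N z) * exp (- (pi * (Re z)\<^sup>2))"
proof -
  have "exp (- (2 * lattice_const)) \<le> (\<Prod>n\<in>{-int N..int N}. exp (- (2 * exp (- (2 * pi * \<bar>Re z - of_int n\<bar>)))))"
    using theta_exp_sum[of "Re z" N] by (simp add: sum_negf flip: exp_sum sum_distrib_left)
  also have "\<dots> \<le> (\<Prod>n\<in>{-int N..int N}. norm (theta_rest n z))"
    by (intro prod_mono conjI theta_rest_lower assms) auto
  also have "\<dots> \<le> exp (pi * (Re z + 2 * (\<Sum>n\<in>{-int N..int N}. theta_slope n (Re z)) - (Re z)\<^sup>2)) * (\<Prod>n\<in>{-int N..int N}. norm (theta_rest n z))"
  proof -
    have "1 \<le> exp (pi * (Re z + 2 * (\<Sum>n\<in>{-int N..int N}. theta_slope n (Re z)) - (Re z)\<^sup>2))"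
      using theta_slope_sum(1)[OF N] by simp
    from mult_right_mono[OF this, of "\<Prod>n\<in>{-int N..int N}. norm (theta_rest n z)"] show ?thesis
      by (simp add: prod_nonneg)
  qed
  finally show ?thesis unfolding theta_norm_eq .
qed

section \<open>Cauchy on a union of grid cells\<close>

text \<open>The half-integers put the zeros of \<open>theta\<close> at the cell centres and the
  edges on the lines where \<open>theta_lower\<close> applies.\<close>

definition corner :: "int \<times> int \<Rightarrow> complex" where
  "corner p = Complex (of_int (fst p) - 1/2) (of_int (snd p) - 1/2)"

definition cell :: "int \<times> int \<Rightarrow> complex set" where
  "cell p = cbox (corner p) (corner (p + (1, 1)))"

text \<open>The bottom edge of the cell, as \<open>ver\<close> is its left edge. The other two edges
  belong to the neighbouring indices, so every edge of the grid has exactly one name.\<close>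

definition hor :: "int \<times> int \<Rightarrow> complex set" where
  "hor p = closed_segment (corner p) (corner (p + (1, 0)))"

definition ver :: "int \<times> int \<Rightarrow> complex set" where
  "ver p = closed_segment (corner p) (corner (p + (0, 1)))"

lemma Re_corner [simp]: "Re (corner p) = of_int (fst p) - 1/2" and Im_corner [simp]: "Im (corner p) = of_int (snd p) - 1/2"
  by (auto simp: corner_def)

lemma cell_iff: "z \<in> cell p \<longleftrightarrow> \<bar>Re z - of_int (fst p)\<bar> \<le> 1/2 \<and> \<bar>Im z - of_int (snd p)\<bar> \<le> 1/2"
  unfolding cell_def in_cbox_complex_iff by (auto simp: abs_if split: if_splits)

lemma hor_iff: "z \<in> hor p \<longleftrightarrow> \<bar>Re z - of_int (fst p)\<bar> \<le> 1/2 \<and> Im z = of_int (snd p) - 1/2"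
  unfolding hor_def by (subst closed_segment_same_Im) (auto simp: closed_segment_eq_real_ivl abs_if split: if_splits)

lemma ver_iff: "z \<in> ver p \<longleftrightarrow> \<bar>Im z - of_int (snd p)\<bar> \<le> 1/2 \<and> Re z = of_int (fst p) - 1/2"
  unfolding ver_def by (subst closed_segment_same_Re) (auto simp: closed_segment_eq_real_ivl abs_if split: if_splits)

lemma norm_sum_diff_le:
  fixes h :: "'a \<Rightarrow> 'b::real_normed_vector"
  assumes "finite S" "finite T"
  shows "norm (sum h S - sum h T) \<le> (\<Sum>p\<in>(S - T) \<union> (T - S). norm (h p))"
proof -
  have "sum h S = sum h (S \<inter> T) + sum h (S - T)" "sum h T = sum h (S \<inter> T) + sum h (T - S)"
    using sum.Int_Diff[OF assms(1), of h T] sum.Int_Diff[OF assms(2), of h S] by (simp_all add: Int_commute)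
  then have "norm (sum h S - sum h T) = norm (sum h (S - T) - sum h (T - S))" by simp
  also have "\<dots> \<le> norm (sum h (S - T)) + norm (sum h (T - S))" by (rule norm_triangle_ineq4)
  also have "\<dots> \<le> (\<Sum>p\<in>S - T. norm (h p)) + (\<Sum>p\<in>T - S. norm (h p))" by (intro add_mono norm_sum)
  also have "\<dots> = (\<Sum>p\<in>(S - T) \<union> (T - S). norm (h p))"
    by (rule sum.union_disjoint[symmetric]) (use assms in auto)
  finally show ?thesis .
qed

text \<open>The edge \<open>hor p\<close> separates the cells p and p - (0, 1); collected are those
  with exactly one of the two in \<open>S\<close>.\<close>

definition hor_bd :: "(int \<times> int) set \<Rightarrow> (int \<times> int) set" where
  "hor_bd S = (S - (+) (0, 1) ` S) \<union> ((+) (0, 1) ` S - S)"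

definition ver_bd :: "(int \<times> int) set \<Rightarrow> (int \<times> int) set" where
  "ver_bd S = ((+) (1, 0) ` S - S) \<union> (S - (+) (1, 0) ` S)"

lemma rectpath_cell_integral:
  assumes f: "continuous_on (hor p \<union> ver (p + (1, 0)) \<union> hor (p + (0, 1)) \<union> ver p) f"
  shows "contour_integral (rectpath (corner p) (corner (p + (1, 1)))) f = 
    contour_integral (linepath (corner p) (corner (p + (1, 0)))) f + contour_integral (linepath (corner (p + (1, 0))) (corner (p + (1, 0) + (0, 1)))) f
    - contour_integral (linepath (corner (p + (0, 1))) (corner (p + (0, 1) + (1, 0)))) f - contour_integral (linepath (corner p) (corner (p + (0, 1)))) f"
proof -
  have c: "Complex (Re (corner (p + (1, 1)))) (Im (corner p)) = corner (p + (1, 0))" "Complex (Re (corner p)) (Im (corner (p + (1, 1)))) = corner (p + (0, 1))"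
      "corner (p + (1, 0) + (0, 1)) = corner (p + (1, 1))" "corner (p + (0, 1) + (1, 0)) = corner (p + (1, 1))"
    by (auto simp: complex_eq_iff)
  have i1: "f contour_integrable_on linepath (corner p) (corner (p + (1, 0)))"
    by (rule contour_integrable_continuous_linepath) (rule continuous_on_subset[OF f], auto simp: hor_def)
  have i2: "f contour_integrable_on linepath (corner (p + (1, 0))) (corner (p + (1, 1)))"
    by (rule contour_integrable_continuous_linepath) (rule continuous_on_subset[OF f], auto simp: ver_def c[symmetric] simp del: c)
  have i3: "f contour_integrable_on linepath (corner (p + (1, 1))) (corner (p + (0, 1)))"
    by (rule contour_integrable_continuous_linepath) (rule continuous_on_subset[OF f], auto simp: hor_def c closed_segment_commute)
  have i4: "f contour_integrable_on linepath (corner (p + (0, 1))) (corner p)"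
    by (rule contour_integrable_continuous_linepath) (rule continuous_on_subset[OF f], auto simp: ver_def closed_segment_commute)
  have r3: "contour_integral (linepath (corner (p + (1, 1))) (corner (p + (0, 1)))) f = - contour_integral (linepath (corner (p + (0, 1))) (corner (p + (1, 1)))) f"
    using contour_integral_reversepath[of "linepath (corner (p + (0, 1))) (corner (p + (1, 1)))" f] by simp
  have r4: "contour_integral (linepath (corner (p + (0, 1))) (corner p)) f = - contour_integral (linepath (corner p) (corner (p + (0, 1)))) f"
    using contour_integral_reversepath[of "linepath (corner p) (corner (p + (0, 1)))" f] by simp
  show ?thesis
    unfolding rectpath_def Let_def c using i1 i2 i3 i4 r3 r4
    by (simp add: contour_integral_join contour_integrable_join)
qed

text \<open>Cauchy's formula on a union of grid cells: the interior edges cancel, so only edges separating the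
  union from its complement contribute.\<close>

lemma grid_cauchy_bound:
  assumes S: "finite S" and H: "H holomorphic_on \<Omega>" and sub: "\<And>p. p \<in> S \<Longrightarrow> cell p \<subseteq> \<Omega>"
    and p0: "p0 \<in> S" and z: "z \<in> interior (cell p0)"
    and Gh: "\<And>p w. p \<in> hor_bd S \<Longrightarrow> w \<in> hor p \<Longrightarrow> norm (H w) / norm (w - z) \<le> G p"
    and Gv: "\<And>p w. p \<in> ver_bd S \<Longrightarrow> w \<in> ver p \<Longrightarrow> norm (H w) / norm (w - z) \<le> G p"
  shows "norm (H z) \<le> (\<Sum>p\<in>hor_bd S. G p) + (\<Sum>p\<in>ver_bd S. G p)"
proof -
  define f where "f w = H w / (w - z)" for w
  have zi: "\<bar>Re z - of_int (fst p0)\<bar> < 1/2" "\<bar>Im z - of_int (snd p0)\<bar> < 1/2"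
    using z unfolding cell_def interior_cbox in_box_complex_iff by (auto simp: abs_if split: if_splits)
  have nez: "w \<noteq> z" if "Re w = of_int k - 1/2 \<or> Im w = of_int k - 1/2" for w k
  proof
    assume "w = z"
    then have "\<bar>real_of_int k - 1/2 - of_int (fst p0)\<bar> < 1/2 \<or> \<bar>real_of_int k - 1/2 - of_int (snd p0)\<bar> < 1/2" using that zi by auto
    then have "0 < real_of_int (k - fst p0) \<and> real_of_int (k - fst p0) < 1 \<or> 0 < real_of_int (k - snd p0) \<and> real_of_int (k - snd p0) < 1"
      by (auto simp: abs_if split: if_splits)
    then have "0 < k - fst p0 \<and> k - fst p0 < 1 \<or> 0 < k - snd p0 \<and> k - snd p0 < 1"
      by (simp only: of_int_0_less_iff of_int_less_1_iff)
    then show False by linarith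
  qed
  have nh: "w \<noteq> z" if "w \<in> hor p" for w p using that nez[of w "snd p"] by (auto simp: hor_iff)
  have nv: "w \<noteq> z" if "w \<in> ver p" for w p using that nez[of w "fst p"] by (auto simp: ver_iff)
  have hv: "hor p \<subseteq> cell p" "ver p \<subseteq> cell p" "hor (p + (0, 1)) \<subseteq> cell p" "ver (p + (1, 0)) \<subseteq> cell p" for p
    by (auto simp: hor_iff ver_iff cell_iff)
  have cont: "f contour_integrable_on linepath (corner p) (corner (p + d))"
    if "closed_segment (corner p) (corner (p + d)) \<subseteq> cell q" "q \<in> S" "z \<notin> closed_segment (corner p) (corner (p + d))" for p q d
    unfolding f_def
  proof (intro contour_integrable_continuous_linepath continuous_intros)
    show "continuous_on (closed_segment (corner p) (corner (p + d))) H"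
      by (rule continuous_on_subset[OF holomorphic_on_imp_continuous_on[OF H]]) (use that sub in blast)
  qed (use that in auto)
  have G0: "G p \<ge> 0" if "norm (H w) / norm (w - z) \<le> G p" for p w
    by (rule order_trans[OF _ that]) simp
  define h where "h p = contour_integral (linepath (corner p) (corner (p + (1, 0)))) f" for p
  define v where "v p = contour_integral (linepath (corner p) (corner (p + (0, 1)))) f" for p
  define R where "R p = contour_integral (rectpath (corner p) (corner (p + (1, 1)))) f" for p
  have R: "R p = h p + v (p + (1, 0)) - h (p + (0, 1)) - v p" if "p \<in> S" for p
    unfolding R_def h_def v_def
  proof (rule rectpath_cell_integral)
    show "continuous_on (hor p \<union> ver (p + (1, 0)) \<union> hor (p + (0, 1)) \<union> ver p) f"
      unfolding f_def
    proof (intro continuous_intros)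
      show "continuous_on (hor p \<union> ver (p + (1, 0)) \<union> hor (p + (0, 1)) \<union> ver p) H"
        by (rule continuous_on_subset[OF holomorphic_on_imp_continuous_on[OF H]]) (use hv[of p] sub[OF that] in blast)
      show "\<forall>w\<in>hor p \<union> ver (p + (1, 0)) \<union> hor (p + (0, 1)) \<union> ver p. w - z \<noteq> 0"
        by (auto dest: nh nv)
    qed
  qed
  have pim: "path_image (rectpath (corner p) (corner (p + (1, 1)))) = cell p - interior (cell p)" for p
    unfolding cell_def interior_cbox by (rule path_image_rectpath_cbox_minus_box) auto
  have R0: "R p0 = 2 * of_real pi * \<i> * H z"
  proof -
    have "((\<lambda>w. H w / (w - z)) has_contour_integral (complex_of_real (2 * pi) * \<i> * winding_number (rectpath (corner p0) (corner (p0 + (1, 1)))) z * H z)) (rectpath (corner p0) (corner (p0 + (1, 1))))"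
    proof (rule Cauchy_integral_formula_convex_simple)
      show "convex (cell p0)" by (simp add: cell_def convex_box)
      show "H holomorphic_on cell p0" by (rule holomorphic_on_subset[OF H sub[OF p0]])
      show "path_image (rectpath (corner p0) (corner (p0 + (1, 1)))) \<subseteq> cell p0 - {z}" using z unfolding pim by auto
    qed (use z in auto)
    moreover have "winding_number (rectpath (corner p0) (corner (p0 + (1, 1)))) z = 1"
      by (rule winding_number_rectpath) (use z in \<open>simp add: cell_def\<close>)
    ultimately show ?thesis unfolding R_def f_def[abs_def] by (simp add: contour_integral_unique)
  qed
  have R1: "R p = 0" if "p \<in> S" "p \<noteq> p0" for p
  proof -
    have zc: "z \<notin> cell p"
    proof
      assume "z \<in> cell p"
      then have "\<bar>real_of_int (fst p) - of_int (fst p0)\<bar> < 1" "\<bar>real_of_int (snd p) - of_int (snd p0)\<bar> < 1"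
        using zi unfolding cell_iff by linarith+
      then have "fst p = fst p0" "snd p = snd p0" by linarith+
      then show False using that by (simp add: prod_eq_iff)
    qed
    have "(f has_contour_integral 0) (rectpath (corner p) (corner (p + (1, 1))))"
    proof (rule Cauchy_theorem_convex_simple)
      show "f holomorphic_on cell p" unfolding f_def[abs_def]
        by (intro holomorphic_intros holomorphic_on_subset[OF H sub[OF that(1)]]) (use zc in auto)
      show "convex (cell p)" by (simp add: cell_def convex_box)
      show "path_image (rectpath (corner p) (corner (p + (1, 1)))) \<subseteq> cell p" unfolding pim by auto
    qed auto
    then show ?thesis unfolding R_def by (rule contour_integral_unique)
  qed
  have "(\<Sum>p\<in>S. R p) = (\<Sum>p\<in>S. if p = p0 then R p0 else 0)" by (rule sum.cong) (use R1 in auto)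
  then have tot: "(\<Sum>p\<in>S. R p) = 2 * of_real pi * \<i> * H z" using S p0 R0 by simp
  \<comment> \<open>The top edges of \<open>S\<close> are the bottom edges of \<open>S\<close> moved
    up by one, and the right edges are left edges moved by one. Each difference of sums then reduces
    to the symmetric difference of the index sets, which is the cancellation of interior
    edges.\<close>
  have sh: "(\<Sum>p\<in>S. h (p + (0, 1))) = (\<Sum>p\<in>(+) (0, 1) ` S. h p)" "(\<Sum>p\<in>S. v (p + (1, 0))) = (\<Sum>p\<in>(+) (1, 0) ` S. v p)"
    by (subst sum.reindex; simp add: add.commute)+
  have "(\<Sum>p\<in>S. R p) = (\<Sum>p\<in>S. h p + v (p + (1, 0)) - h (p + (0, 1)) - v p)" by (rule sum.cong) (use R in auto)
  also have "\<dots> = ((\<Sum>p\<in>S. h p) - (\<Sum>p\<in>(+) (0, 1) ` S. h p)) + ((\<Sum>p\<in>(+) (1, 0) ` S. v p) - (\<Sum>p\<in>S. v p))"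
    unfolding sh[symmetric] by (simp add: sum.distrib sum_subtractf)
  finally have "norm (2 * of_real pi * \<i> * H z) \<le> norm ((\<Sum>p\<in>S. h p) - (\<Sum>p\<in>(+) (0, 1) ` S. h p)) + norm ((\<Sum>p\<in>(+) (1, 0) ` S. v p) - (\<Sum>p\<in>S. v p))"
    unfolding tot by (simp only: norm_triangle_ineq)
  also have "\<dots> \<le> (\<Sum>p\<in>hor_bd S. norm (h p)) + (\<Sum>p\<in>ver_bd S. norm (v p))"
    unfolding hor_bd_def ver_bd_def by (intro add_mono norm_sum_diff_le) (use S in auto)
  also have "\<dots> \<le> (\<Sum>p\<in>hor_bd S. G p) + (\<Sum>p\<in>ver_bd S. G p)"
  proof (intro add_mono sum_mono)
    fix p assume p: "p \<in> hor_bd S"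
    obtain q where q: "q \<in> S" "hor p \<subseteq> cell q"
    proof (cases "p \<in> S")
      case True then show ?thesis using hv(1) that by blast
    next
      case False
      then obtain q where "q \<in> S" "p = q + (0, 1)" using p by (auto simp: hor_bd_def)
      then show ?thesis using hv(3)[of q] that by blast
    qed
    have "norm (h p) \<le> G p * norm (corner (p + (1, 0)) - corner p)" unfolding h_def
    proof (rule contour_integral_bound_linepath)
      show "f contour_integrable_on linepath (corner p) (corner (p + (1, 0)))"
        by (rule cont[OF _ q(1)]) (use q(2) nh[of z p] in \<open>auto simp: hor_def\<close>)
      show "0 \<le> G p" using G0[OF Gh[OF p, of "corner p"]] by (auto simp: hor_def)
      show "norm (f w) \<le> G p" if "w \<in> closed_segment (corner p) (corner (p + (1, 0)))" for w
        using Gh[OF p] that by (simp add: f_def norm_divide hor_def)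
    qed
    moreover have "corner (p + (1, 0)) - corner p = 1" by (simp add: complex_eq_iff)
    ultimately show "norm (h p) \<le> G p" by simp
  next
    fix p assume p: "p \<in> ver_bd S"
    obtain q where q: "q \<in> S" "ver p \<subseteq> cell q"
    proof (cases "p \<in> S")
      case True then show ?thesis using hv(2) that by blast
    next
      case False
      then obtain q where "q \<in> S" "p = q + (1, 0)" using p by (auto simp: ver_bd_def)
      then show ?thesis using hv(4)[of q] that by blast
    qed
    have "norm (v p) \<le> G p * norm (corner (p + (0, 1)) - corner p)" unfolding v_def
    proof (rule contour_integral_bound_linepath)
      show "f contour_integrable_on linepath (corner p) (corner (p + (0, 1)))"
        by (rule cont[OF _ q(1)]) (use q(2) nv[of z p] in \<open>auto simp: ver_def\<close>)
      show "0 \<le> G p" using G0[OF Gv[OF p, of "corner p"]] by (auto simp: ver_def)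
      show "norm (f w) \<le> G p" if "w \<in> closed_segment (corner p) (corner (p + (0, 1)))" for w
        using Gv[OF p] that by (simp add: f_def norm_divide ver_def)
    qed
    moreover have "corner (p + (0, 1)) - corner p = \<i>" by (simp add: complex_eq_iff)
    ultimately show "norm (v p) \<le> G p" by simp
  qed
  finally have "2 * pi * norm (H z) \<le> (\<Sum>p\<in>hor_bd S. G p) + (\<Sum>p\<in>ver_bd S. G p)" by (simp add: norm_mult)
  moreover have "1 * norm (H z) \<le> 2 * pi * norm (H z)" using pi_gt3 by (intro mult_right_mono) auto
  ultimately show ?thesis by linarith
qed

section \<open>Estimates for transforms vanishing on lattice points\<close>

text \<open>The transform at \<open>(p, \<theta>)\<close> is a Gaussian times an entire function of \<open>p - \<i>\<theta>\<close>, hence the conjugation.\<close>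

definition pz :: "complex \<Rightarrow> real \<times> real" where "pz w = (Re w, - Im w)"

definition cz :: "real \<times> real \<Rightarrow> complex" where "cz z = Complex (fst z) (- snd z)"

lemma pz_cz [simp]: "pz (cz z) = z" and cz_pz [simp]: "cz (pz w) = w"
  by (auto simp: pz_def cz_def)

lemma dist_pz: "dist (pz w) (pz w') = norm (w - w')"
  unfolding pz_def by (simp add: dist_Pair_Pair dist_real_def cmod_def power2_commute)

lemma dist_cz: "norm (cz z - cz z') = dist z z'"
  using dist_pz[of "cz z" "cz z'"] by simp

lemma Ints_half_uminus: "- x - 1/2 \<in> \<int> \<longleftrightarrow> x - 1/2 \<in> (\<int> :: real set)"
proof -
  have *: "- y - 1/2 \<in> \<int>" if "y - 1/2 \<in> \<int>" for y :: real
    using Ints_diff[OF Ints_minus[OF that] Ints_1] by (simp add: algebra_simps)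
  show ?thesis using *[of x] *[of "- x"] by auto
qed

lemma pz_mem_Lambda: "pz w \<in> \<Lambda> \<longleftrightarrow> w \<in> gauss_lattice 0"
  by (simp add: pz_def \<Lambda>_def gauss_lattice_def)

lemma pz_mem_Lambda_sharp: "pz w \<in> \<Lambda>_sharp \<longleftrightarrow> w \<in> gauss_lattice half_shift"
proof -
  have "pz w \<in> \<Lambda>_sharp \<longleftrightarrow> Re w - 1/2 \<in> \<int> \<and> - Im w - 1/2 \<in> \<int>"
  proof
    assume "pz w \<in> \<Lambda>_sharp"
    then obtain a b where "a \<in> \<int>" "b \<in> \<int>" "Re w = a + 1/2" "- Im w = b + 1/2"
      by (auto simp: \<Lambda>_sharp_def \<Lambda>_def pz_def)
    then show "Re w - 1/2 \<in> \<int> \<and> - Im w - 1/2 \<in> \<int>" by simp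
  next
    assume "Re w - 1/2 \<in> \<int> \<and> - Im w - 1/2 \<in> \<int>"
    then show "pz w \<in> \<Lambda>_sharp" unfolding \<Lambda>_sharp_def \<Lambda>_def pz_def
      by (intro image_eqI[of _ _ "(Re w - 1/2, - Im w - 1/2)"]) auto
  qed
  then show ?thesis unfolding Ints_half_uminus by (simp add: gauss_lattice_def half_shift_def)
qed

lemma gauss_lattice_add: "a \<in> gauss_lattice 0 \<Longrightarrow> b \<in> gauss_lattice s \<Longrightarrow> a + b \<in> gauss_lattice s"
proof -
  assume a: "a \<in> gauss_lattice 0" and b: "b \<in> gauss_lattice s"
  have "Re (a + b - s) = Re a + Re (b - s)" "Im (a + b - s) = Im a + Im (b - s)" by simp_all
  then show "a + b \<in> gauss_lattice s" using a b unfolding gauss_lattice_def mem_Collect_eq by (metis Ints_add diff_zero)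
qed

text \<open>The Gaussian gain \<open>exp (- A\<^sup>2 / 100)\<close> at \<open>A = r / 10 \<plusminus> 1\<close> is at most \<open>exp (- 2 * r)\<close> once \<open>r \<ge> 24200\<close>;
  a factor \<open>exp r\<close> is spent on absorbing polynomials in \<open>r\<close>.\<close>

definition eps :: "real \<Rightarrow> real" where "eps r = 2048 * exp (- (2 * r / exp 1))"

text \<open>This is the exponent for the squared transform in \<open>outer_estimate\<close>. Its
  leading coefficient 1 - 2 * 506/1000 is barely negative, and A >= 1000 is large enough for it to
  absorb the linear boundary losses. The threshold is 24200 = 2 * 100 * 11^2, with 11 from A >= r /
  11.\<close>

lemma eps_bound:
  assumes r: "r \<ge> 24200" and A: "\<bar>A - r / 10\<bar> \<le> 1"
  shows "8 * (1 + r\<^sup>2)\<^sup>2 * exp (pi * A\<^sup>2 - 2 * (pi * (506/1000 * (A - 2)\<^sup>2 - 2 * (A - 2)))) \<le> eps r"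
proof -
  have Ar: "r / 11 \<le> A" and A1: "A \<ge> 1000" using A r by linarith+
  have "pi * A\<^sup>2 - 2 * (pi * (506/1000 * (A - 2)\<^sup>2 - 2 * (A - 2))) = pi * (- (12/1000) * A\<^sup>2 + (8048/1000) * A - 12048/1000)"
    by (simp add: power2_eq_square field_simps)
  also have "- (12/1000) * A\<^sup>2 + (8048/1000) * A - 12048/1000 \<le> - (1/300) * A\<^sup>2"
  proof -
    have "1000 * A \<le> A\<^sup>2" unfolding power2_eq_square using A1 by (intro mult_right_mono) auto
    then show ?thesis using A1 by linarith
  qed
  also have "pi * (- (1/300) * A\<^sup>2) \<le> 3 * (- (1/300) * A\<^sup>2)"
    using pi_gt3 by (intro mult_right_mono_neg) auto
  also have "\<dots> \<le> - (1/100) * (r / 11)\<^sup>2" using Ar r by (simp add: power_mono)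
  also have "\<dots> \<le> - (2 * r)"
  proof -
    have "24200 * r \<le> r * r" using r by (intro mult_right_mono) auto
    then show ?thesis by (simp add: power2_eq_square)
  qed
  finally have 1: "exp (pi * A\<^sup>2 - 2 * (pi * (506/1000 * (A - 2)\<^sup>2 - 2 * (A - 2)))) \<le> exp (- (2 * r))"
    using mult_left_mono[of _ _ pi] by simp
  have "1 + r\<^sup>2 \<le> (1 + r)\<^sup>2" using r by (simp add: power2_sum)
  also have "\<dots> \<le> (4 * exp (r / 4))\<^sup>2"
  proof (rule power_mono)
    have "1 + r / 4 \<le> exp (r / 4)" by (rule exp_ge_add_one_self)
    then show "1 + r \<le> 4 * exp (r / 4)" by linarith
  qed (use r in simp)
  finally have "(1 + r\<^sup>2)\<^sup>2 \<le> ((4 * exp (r / 4))\<^sup>2)\<^sup>2" by (intro power_mono) auto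
  also have "\<dots> = 256 * exp (r / 4) ^ 4" by (simp add: power_mult_distrib flip: power_mult)
  also have "exp (r / 4) ^ 4 = exp r" by (simp flip: exp_of_nat_mult)
  finally have 2: "(1 + r\<^sup>2)\<^sup>2 \<le> 256 * exp r" .
  have "8 * (1 + r\<^sup>2)\<^sup>2 * exp (pi * A\<^sup>2 - 2 * (pi * (506/1000 * (A - 2)\<^sup>2 - 2 * (A - 2)))) \<le> 8 * (256 * exp r) * exp (- (2 * r))"
    by (intro mult_mono mult_left_mono 1 2) auto
  also have "\<dots> = 2048 * exp (- r)" by (simp flip: exp_add)
  also have "\<dots> \<le> eps r"
  proof -
    have "2 \<le> exp (1::real)" using exp_ge_add_one_self[of 1] by simp
    then have "2 * r / exp 1 \<le> r" using r by (simp add: divide_simps)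
    then show ?thesis by (simp add: eps_def)
  qed
  finally show ?thesis .
qed

definition vanishing :: "(real \<Rightarrow> complex) \<Rightarrow> (real \<times> real) set \<Rightarrow> (real \<times> real) set \<Rightarrow> bool" where
  "vanishing f K D \<longleftrightarrow> (\<forall>z \<in> (\<Lambda> \<inter> D) \<union> (\<Lambda>_sharp \<inter> (D - K)). gab f z = 0)"

text \<open>The Gaussian in \<open>gab_entire\<close> depends on Re only, whereas estimates on
  circles about \<open>c\<close> need a radial one. Since Re (w^2) = 2 (Re w)^2 - |w|^2, the
  nonvanishing entire factor exp (q w) converts one into the other.\<close>

lemma recentred_entire:
  assumes f: "f \<in> L2"
  obtains F where "F holomorphic_on UNIV" "\<And>w. norm (F w) = norm (gab f (pz (c + w))) * exp (pi / 2 * (norm w)\<^sup>2)"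
    "\<And>w. gab f (pz (c + w)) = 0 \<Longrightarrow> F w = 0"
proof -
  obtain E where E: "E holomorphic_on UNIV" "\<And>p t. gab f (p, t) = of_real (exp (- (pi * p\<^sup>2))) * E (Complex p (- t))"
    using gab_entire[OF f] by blast
  define q where "q w = - (of_real (pi * (Re c)\<^sup>2) + of_real (2 * pi * Re c) * w + of_real (pi / 2) * w\<^sup>2)" for w :: complex
  define F where "F w = E (c + w) * exp (q w)" for w
  have "(E \<circ> (\<lambda>w. c + w)) holomorphic_on UNIV"
    by (rule holomorphic_on_compose) (auto intro!: holomorphic_intros holomorphic_on_subset[OF E(1)])
  then have F: "F holomorphic_on UNIV"
    unfolding F_def[abs_def] q_def o_def by (intro holomorphic_intros)
  have EF: "gab f (pz (c + w)) = of_real (exp (- (pi * (Re (c + w))\<^sup>2))) * E (c + w)" for w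
    unfolding pz_def E(2) minus_minus complex.collapse ..
  have "norm (F w) = norm (gab f (pz (c + w))) * exp (pi / 2 * (norm w)\<^sup>2)" for w
  proof -
    have "Re (w\<^sup>2) = (Re w)\<^sup>2 - (Im w)\<^sup>2" by (simp add: power2_eq_square)
    then have "Re (q w) = - (pi * (Re (c + w))\<^sup>2) + pi / 2 * (norm w)\<^sup>2"
      unfolding q_def cmod_power2 by (simp add: power2_eq_square field_simps)
    then have "norm (exp (q w)) = exp (- (pi * (Re (c + w))\<^sup>2)) * exp (pi / 2 * (norm w)\<^sup>2)"
      by (simp only: norm_exp_eq_Re exp_add)
    then show ?thesis unfolding F_def EF by (simp add: norm_mult)
  qed
  moreover have "F w = 0" if "gab f (pz (c + w)) = 0" for w using that unfolding EF F_def by simp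
  ultimately show ?thesis using F that by blast
qed

text \<open>The disc of radius about \<open>r / 10\<close> through \<open>z\<close>, centred on the way from \<open>z\<close> to a nearby point of \<open>K\<close>,
  lies in \<open>D - K\<close>, even when \<open>z\<close> is close to the boundary of \<open>D\<close>.\<close>

lemma outer_estimate:
  assumes f: "f \<in> L2" and van: "vanishing f K (neighborhood r K)" and r: "r \<ge> 24200"
    and z: "z \<in> neighborhood r K" and far: "\<And>w. w \<in> K \<Longrightarrow> dist z w \<ge> r / 4"
  shows "(norm (gab f z))\<^sup>2 \<le> eps r * smear f z"
proof -
  obtain k where k: "k \<in> K" "dist z k < r" using z by (auto simp: neighborhood_def)
  define d where "d = dist z k"
  have d: "r / 4 \<le> d" "d < r" using far[OF k(1)] k(2) by (auto simp: d_def)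
  define c' where "c' = z + (r / 10 / d) *\<^sub>R (k - z)"
  have dpos: "d > 0" using d r by linarith
  have zc': "dist z c' = r / 10"
  proof -
    have "dist z c' = \<bar>r / 10 / d\<bar> * norm (k - z)" by (simp add: c'_def dist_norm)
    also have "norm (k - z) = d" by (simp add: d_def dist_norm norm_minus_commute)
    finally show ?thesis using dpos r by simp
  qed
  have c'k: "dist c' k = d - r / 10"
  proof -
    have "c' - k = (1 - r / 10 / d) *\<^sub>R (z - k)" by (simp add: c'_def algebra_simps)
    then have "dist c' k = \<bar>1 - r / 10 / d\<bar> * d" by (simp add: dist_norm d_def)
    moreover have "r / 10 / d \<le> 1" using d dpos r by (simp add: field_simps)
    ultimately show ?thesis using dpos by (simp add: field_simps)
  qed
  \<comment> \<open>Moving the centre to a lattice point, at a cost of at most 1 in distance, turns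
    both lattices, seen from \<open>c\<close>, into ones invariant under rotation by i.\<close>
  obtain c where c: "c \<in> gauss_lattice 0" "cz c' \<in> unit_cell c" using unit_cell_cover by blast
  have cc': "dist (pz c) c' \<le> 1" using unit_cell_norm[OF c(2)] dist_pz[of c "cz c'"] by (simp add: norm_minus_commute)
  define A where "A = dist z (pz c)"
  have A: "\<bar>A - r / 10\<bar> \<le> 1"
    using cc' zc' dist_triangle[of z "pz c" c'] dist_triangle[of z c' "pz c"] unfolding A_def by (simp add: dist_commute)
  have A1: "A \<ge> 1000" using A r by linarith
  obtain F where F: "F holomorphic_on UNIV" "\<And>w. norm (F w) = norm (gab f (pz (c + w))) * exp (pi / 2 * (norm w)\<^sup>2)"
    "\<And>w. gab f (pz (c + w)) = 0 \<Longrightarrow> F w = 0" using recentred_entire[OF f] by blast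
  define Q where "Q = sqrt (8 * (1 + r\<^sup>2)\<^sup>2 * smear f z)"
  have Q2: "Q\<^sup>2 = 8 * (1 + r\<^sup>2)\<^sup>2 * smear f z" unfolding Q_def using smear_nonneg by simp
  have near: "norm (gab f y) \<le> Q" if "dist y z \<le> r" for y
    using gab_le_smear[OF f that] unfolding Q_def by (intro real_le_rsqrt) auto
  define \<xi> where "\<xi> = cz z - c"
  have nxi: "norm \<xi> = A" using dist_cz[of z "pz c"] by (simp add: \<xi>_def A_def)
  have "norm (F \<xi>) \<le> (Q * exp (pi * A\<^sup>2)) * exp (- (pi * (506/1000 * (A - 2)\<^sup>2 - 2 * (A - 2))))"
  proof (rule double_lattice_bound[OF F(1) _ _ nxi])
    \<comment> \<open>The margin 2 in A - 2 covers the rounding of the centre and the deviation of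
      \<open>A\<close> from r / 10, each at most 1. The zero is also at distance below 2 A < r / 4
      from z and so misses \<open>K\<close>.\<close>
    show "F l = 0" if l: "l \<in> gauss_lattice 0 \<union> gauss_lattice half_shift" "norm l < A - 2" for l
    proof (rule F(3))
      have lc: "dist (pz (c + l)) (pz c) = norm l" by (simp add: dist_pz)
      have "dist (pz (c + l)) k < r"
      proof -
        have "dist (pz (c + l)) k \<le> dist (pz (c + l)) (pz c) + (dist (pz c) c' + dist c' k)"
          by (meson add_left_mono dist_triangle dist_triangle_le order_trans)
        then show ?thesis using lc l(2) cc' c'k A d by linarith
      qed
      then have inD: "pz (c + l) \<in> neighborhood r K" using k(1) by (auto simp: neighborhood_def)
      have notK: "pz (c + l) \<notin> K"
      proof
        assume "pz (c + l) \<in> K"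
        then have "r / 4 \<le> dist z (pz (c + l))" by (rule far)
        also have "\<dots> \<le> A + norm l" using dist_triangle[of z "pz (c + l)" "pz c"] lc by (simp add: A_def dist_commute)
        finally show False using l(2) A r by linarith
      qed
      have "pz (c + l) \<in> \<Lambda> \<union> \<Lambda>_sharp"
        using l(1) gauss_lattice_add[OF c(1)] by (auto simp: pz_mem_Lambda pz_mem_Lambda_sharp)
      then show "gab f (pz (c + l)) = 0" using van inD notK by (auto simp: vanishing_def)
    qed
    \<comment> \<open>The outer circle stays within (sqrt 2 + 1) A <= 3 A <= r of z, where
      \<open>Q\<close> bounds the transform.\<close>
    show "norm (F w) \<le> Q * exp (pi * A\<^sup>2)" if w: "norm w = sqrt 2 * A" for w
    proof -
      have s2: "sqrt 2 \<le> (2::real)" by (rule real_le_lsqrt) auto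
      have "dist (pz (c + w)) z \<le> norm w + A"
        using dist_triangle[of "pz (c + w)" z "pz c"] dist_pz[of "c + w" c] by (simp add: A_def dist_commute)
      also have "\<dots> \<le> 2 * A + A" using w s2 A1 by (simp add: mult_right_mono)
      also have "\<dots> \<le> r" using A r by linarith
      finally have "norm (gab f (pz (c + w))) \<le> Q" by (rule near)
      moreover have "pi / 2 * (norm w)\<^sup>2 = pi * A\<^sup>2" using w by (simp add: power_mult_distrib)
      ultimately show ?thesis unfolding F(2) by (simp add: mult_right_mono)
    qed
  qed (use A1 in auto)
  moreover have "norm (F \<xi>) = norm (gab f z) * exp (pi / 2 * A\<^sup>2)"
    unfolding F(2) nxi by (simp add: \<xi>_def)
  ultimately have "norm (gab f z) * exp (pi / 2 * A\<^sup>2) \<le> Q * exp (pi * A\<^sup>2 + - (pi * (506/1000 * (A - 2)\<^sup>2 - 2 * (A - 2))))"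
    by (simp only: exp_add mult.assoc)
  then have "norm (gab f z) \<le> Q * exp (pi * A\<^sup>2 + - (pi * (506/1000 * (A - 2)\<^sup>2 - 2 * (A - 2)))) * exp (- (pi / 2 * A\<^sup>2))"
    by (simp add: exp_minus field_simps)
  also have "\<dots> = Q * exp (pi / 2 * A\<^sup>2 - pi * (506/1000 * (A - 2)\<^sup>2 - 2 * (A - 2)))"
    by (simp add: mult.assoc flip: exp_add)
  finally have "(norm (gab f z))\<^sup>2 \<le> (Q * exp (pi / 2 * A\<^sup>2 - pi * (506/1000 * (A - 2)\<^sup>2 - 2 * (A - 2))))\<^sup>2"
    by (intro power_mono) auto
  also have "\<dots> = Q\<^sup>2 * exp (2 * (pi / 2 * A\<^sup>2 - pi * (506/1000 * (A - 2)\<^sup>2 - 2 * (A - 2))))"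
    by (simp only: power_mult_distrib exp_double)
  also have "\<dots> = (8 * (1 + r\<^sup>2)\<^sup>2 * exp (pi * A\<^sup>2 - 2 * (pi * (506/1000 * (A - 2)\<^sup>2 - 2 * (A - 2))))) * smear f z"
    unfolding Q2 by (simp add: algebra_simps)
  also have "\<dots> \<le> eps r * smear f z"
    by (rule mult_right_mono[OF eps_bound[OF r A] smear_nonneg])
  finally show ?thesis .
qed

text \<open>The centre of the cell p, carried to the phase plane by \<open>pz\<close>.\<close>

definition pt :: "int \<times> int \<Rightarrow> real \<times> real" where
  "pt p = (of_int (fst p), - of_int (snd p))"

lemma dist_pt_cell: "w \<in> cell p \<Longrightarrow> dist (pz w) (pt p) \<le> 1"
proof -
  assume "w \<in> cell p"
  moreover have "pt p = pz (Complex (of_int (fst p)) (of_int (snd p)))" by (simp add: pt_def pz_def)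
  ultimately show ?thesis
    using cmod_le[of "w - Complex (of_int (fst p)) (of_int (snd p))"] by (simp add: dist_pz cell_iff)
qed

lemma smear_peetre:
  assumes f: "f \<in> L2" and d: "dist z z' \<le> \<rho>"
  shows "smear f z \<le> 4 * (1 + \<rho>\<^sup>2)\<^sup>2 * smear f z'"
proof -
  have "smear f z \<le> (LINT w|lborel. 4 * (1 + \<rho>\<^sup>2)\<^sup>2 * ((norm (gab f w))\<^sup>2 * ker (z' - w)))"
    unfolding smear_def
  proof (rule integral_mono[OF smear_integrable[OF f]])
    show "integrable lborel (\<lambda>w. 4 * (1 + \<rho>\<^sup>2)\<^sup>2 * ((norm (gab f w))\<^sup>2 * ker (z' - w)))"
      by (intro integrable_mult_right smear_integrable f)
    fix w
    have "(norm (gab f w))\<^sup>2 * ker (z - w) \<le> (norm (gab f w))\<^sup>2 * (4 * (1 + \<rho>\<^sup>2)\<^sup>2 * ker (z' - w))"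
      by (intro mult_left_mono ker_peetre d) auto
    then show "(norm (gab f w))\<^sup>2 * ker (z - w) \<le> 4 * (1 + \<rho>\<^sup>2)\<^sup>2 * ((norm (gab f w))\<^sup>2 * ker (z' - w))"
      by (simp only: mult_ac)
  qed
  also have "\<dots> = 4 * (1 + \<rho>\<^sup>2)\<^sup>2 * smear f z'" unfolding smear_def by (rule integral_mult_right_zero)
  finally show ?thesis .
qed

lemma open_neighborhood: "open (neighborhood r K)"
proof -
  have "neighborhood r K = (\<Union>w\<in>K. ball w r)" by (auto simp: neighborhood_def dist_commute)
  then show ?thesis by auto
qed

lemma eps_pos: "eps r > 0" by (simp add: eps_def)

text \<open>Each point of a contour edge is near an inner cell, which puts it in \<open>D\<close>,
  and near an outer one, which keeps it away from \<open>K\<close>. So \<open>outer_estimate\<close>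
  is available along the contour.\<close>

lemma hor_bd_cases:
  assumes "p \<in> hor_bd S" "w \<in> hor p"
  obtains q q' where "q \<in> S" "w \<in> cell q" "q' \<notin> S" "w \<in> cell q'"
proof (cases "p \<in> S")
  case True
  define q where "q = p - (0, 1)"
  have p: "p = (0, 1) + q" by (simp add: q_def)
  have "q \<notin> S" using assms(1) True p by (auto simp: hor_bd_def)
  moreover have "w \<in> cell p" "w \<in> cell q" using assms(2) by (auto simp: p hor_iff cell_iff)
  ultimately show ?thesis using that True by blast
next
  case False
  then obtain q where q: "q \<in> S" "p = (0, 1) + q" using assms(1) by (auto simp: hor_bd_def)
  moreover have "w \<in> cell p" "w \<in> cell q" using assms(2) by (auto simp: q hor_iff cell_iff)
  ultimately show ?thesis using that False by blast
qed

lemma ver_bd_cases: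
  assumes "p \<in> ver_bd S" "w \<in> ver p"
  obtains q q' where "q \<in> S" "w \<in> cell q" "q' \<notin> S" "w \<in> cell q'"
proof (cases "p \<in> S")
  case True
  define q where "q = p - (1, 0)"
  have p: "p = (1, 0) + q" by (simp add: q_def)
  have "q \<notin> S" using assms(1) True p by (auto simp: ver_bd_def)
  moreover have "w \<in> cell p" "w \<in> cell q" using assms(2) by (auto simp: p ver_iff cell_iff)
  ultimately show ?thesis using that True by blast
next
  case False
  then obtain q where q: "q \<in> S" "p = (1, 0) + q" using assms(1) by (auto simp: ver_bd_def)
  moreover have "w \<in> cell p" "w \<in> cell q" using assms(2) by (auto simp: q ver_iff cell_iff)
  ultimately show ?thesis using that False by blast
qed

text \<open>A discrete potential with the decay of Cauchy's kernel: each edge contributes the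
  smeared energy at its cell centre.\<close>

definition smear_pot :: "(real \<Rightarrow> complex) \<Rightarrow> (int \<times> int) set \<Rightarrow> real \<times> real \<Rightarrow> real" where
  "smear_pot f P z = (\<Sum>p\<in>P. smear f (pt p) / (1 + dist z (pt p)))"

text \<open>The first factor is the square of the bound in \<open>theta_upper\<close>, exp (4 *
  \<open>lattice_const\<close>) the inverse square of that in \<open>theta_lower\<close>. The number
  32 is 16 from \<open>smear_peetre\<close> at distance 1, times 2 for replacing the distance to the
  edge by that to the cell centre.\<close>

definition inner_const :: real where
  "inner_const = exp (2 * (pi + lattice_const)) * (32 * exp (4 * lattice_const))"

lemma inner_const_pos: "inner_const > 0" by (simp add: inner_const_def)

text \<open>Near \<open>K\<close> only the lattice of density one is available. The quotient by the theta function is holomorphic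
  there; Cauchy's formula is applied to its square, so that the bound is linear in the energy density and
  can be integrated against the weight \<open>hweight\<close> for every \<open>\<delta> > 1\<close>.\<close>

lemma inner_estimate:
  assumes f: "f \<in> L2" and van: "vanishing f K (neighborhood r K)" and r: "r \<ge> 24200" and K: "bounded K"
  obtains P Q where "finite P" "finite Q"
    "\<And>z k. k \<in> K \<Longrightarrow> dist z k < r / 2 - 3 \<Longrightarrow> fst z - 1/2 \<notin> \<int> \<Longrightarrow> snd z - 1/2 \<notin> \<int> \<Longrightarrow>
       (norm (gab f z))\<^sup>2 \<le> inner_const * eps r * (smear_pot f P z + smear_pot f Q z)"
proof -
  let ?D = "neighborhood r K"
  \<comment> \<open>With radius r / 2 the cells lie in \<open>D\<close>, where the quotient by
    \<open>theta\<close> is holomorphic, while the contour is at distance at least r / 2 - 1 from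
    \<open>K\<close>. Points within r / 2 - 3 of \<open>K\<close> are thus at distance at least 2
    from the contour.\<close>
  define S where "S = {p. \<exists>k\<in>K. dist (pt p) k < r / 2}"
  obtain B where B: "\<And>k. k \<in> K \<Longrightarrow> norm k \<le> B" using K by (auto simp: bounded_iff)
  have fin: "finite S"
  proof -
    obtain M :: nat where M: "real M \<ge> B + r" using real_arch_simple by blast
    have "S \<subseteq> {-int M..int M} \<times> {-int M..int M}"
    proof
      fix p assume "p \<in> S"
      then obtain k where k: "k \<in> K" "dist (pt p) k < r / 2" by (auto simp: S_def)
      have "norm (pt p) \<le> norm k + dist (pt p) k" using norm_triangle_ineq2[of "pt p" k] by (simp add: dist_norm)
      then have "norm (pt p) \<le> real M" using k B[OF k(1)] M r by linarith
      then have "\<bar>fst (pt p)\<bar> \<le> real M" "\<bar>snd (pt p)\<bar> \<le> real M"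
        using norm_fst_le[of "fst (pt p)" "snd (pt p)"] norm_snd_le[of "snd (pt p)" "fst (pt p)"] by auto
      then have "\<bar>fst p\<bar> \<le> int M" "\<bar>snd p\<bar> \<le> int M" by (auto simp: pt_def)
      then show "p \<in> {-int M..int M} \<times> {-int M..int M}" by (cases p) auto
    qed
    then show ?thesis by (rule finite_subset) auto
  qed
  \<comment> \<open>The truncation depends on the size of \<open>K\<close>, but the bounds for
    \<open>theta\<close> do not depend on \<open>N\<close>.\<close>
  obtain N :: nat where N: "real N \<ge> B + r" using real_arch_simple by blast
  have ReN: "\<bar>Re w\<bar> \<le> real N" if wD: "pz w \<in> ?D" for w
  proof -
    obtain k where k: "k \<in> K" "dist (pz w) k < r" using wD unfolding neighborhood_def by blast
    have "norm (pz w) \<le> norm k + dist (pz w) k" using norm_triangle_ineq2[of "pz w" k] by (simp add: dist_norm)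
    moreover have "\<bar>Re w\<bar> \<le> norm (pz w)" using norm_fst_le[of "Re w" "- Im w"] by (simp add: pz_def)
    ultimately show ?thesis using k B[OF k(1)] N by linarith
  qed
  define \<Omega> where "\<Omega> = pz -` ?D"
  have \<Omega>: "open \<Omega>" unfolding \<Omega>_def pz_def by (intro open_vimage open_neighborhood continuous_intros)
  obtain E where E: "E holomorphic_on UNIV" "\<And>p t. gab f (p, t) = of_real (exp (- (pi * p\<^sup>2))) * E (Complex p (- t))"
    using gab_entire[OF f] by blast
  have gE: "gab f (pz w) = of_real (exp (- (pi * (Re w)\<^sup>2))) * E w" for w
    unfolding pz_def E(2) minus_minus complex.collapse ..
  obtain h where h: "h holomorphic_on \<Omega>" "\<And>w. w \<in> \<Omega> \<Longrightarrow> E w = theta N w * h w"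
  proof (rule theta_divide[OF \<Omega> holomorphic_on_subset[OF E(1)]])
    show "E w = 0" if "w \<in> \<Omega>" "Re w \<in> \<int>" "Im w \<in> \<int>" for w
    proof -
      have "pz w \<in> \<Lambda> \<inter> ?D" using that by (auto simp: \<Omega>_def pz_mem_Lambda gauss_lattice_def)
      then have "gab f (pz w) = 0" using van by (auto simp: vanishing_def)
      then show ?thesis by (simp add: gE)
    qed
  qed auto
  have gh: "norm (gab f (pz w)) = (norm (theta N w) * exp (- (pi * (Re w)\<^sup>2))) * norm (h w)" if "w \<in> \<Omega>" for w
    by (simp add: gE h(2)[OF that] norm_mult)
  define H where "H w = (h w)\<^sup>2" for w
  have H: "H holomorphic_on \<Omega>" unfolding H_def[abs_def] by (intro holomorphic_intros h(1))
  have cellS: "w \<in> \<Omega>" if p: "p \<in> S" and w: "w \<in> cell p" for p w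
  proof -
    obtain k where k: "k \<in> K" "dist (pt p) k < r / 2" using p by (auto simp: S_def)
    have "dist (pz w) k < r" using dist_triangle[of "pz w" k "pt p"] dist_pt_cell[OF w] k r by linarith
    then show ?thesis using k by (auto simp: \<Omega>_def neighborhood_def)
  qed
  have edge: "norm (H w) / norm (w - cz z) \<le> 32 * exp (4 * lattice_const) * eps r * (smear f (pt p) / (1 + dist z (pt p)))"
    if q: "q \<in> S" "w \<in> cell q" and q': "q' \<notin> S" "w \<in> cell q'" and w: "w \<in> cell p" "Re w - 1/2 \<in> \<int> \<or> Im w - 1/2 \<in> \<int>"
      and z: "k \<in> K" "dist z k < r / 2 - 3" for q w q' p z k
  proof -
    have wO: "w \<in> \<Omega>" by (rule cellS[OF q])
    have far: "dist (pz w) k' \<ge> r / 2 - 1" if "k' \<in> K" for k'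
    proof -
      have "dist (pt q') k' \<ge> r / 2" using q' that by (auto simp: S_def not_less)
      then show ?thesis using dist_triangle[of "pt q'" k' "pz w"] dist_pt_cell[OF q'(2)] by (simp add: dist_commute)
    qed
    have "exp (- (2 * lattice_const)) * norm (h w) \<le> norm (gab f (pz w))"
      unfolding gh[OF wO] using theta_lower[OF ReN w(2)] wO by (intro mult_right_mono) (auto simp: \<Omega>_def)
    then have "norm (h w) \<le> exp (2 * lattice_const) * norm (gab f (pz w))"
      by (simp add: exp_minus field_simps)
    then have "(norm (h w))\<^sup>2 \<le> (exp (2 * lattice_const) * norm (gab f (pz w)))\<^sup>2" by (intro power_mono) auto
    also have "\<dots> = exp (4 * lattice_const) * (norm (gab f (pz w)))\<^sup>2"
      by (simp add: power_mult_distrib exp_double[symmetric])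
    also have "(norm (gab f (pz w)))\<^sup>2 \<le> eps r * smear f (pz w)"
    proof (rule outer_estimate[OF f van r])
      show "pz w \<in> ?D" using wO by (simp add: \<Omega>_def)
      show "r / 4 \<le> dist (pz w) k'" if "k' \<in> K" for k' using far[OF that] r by linarith
    qed
    also have "smear f (pz w) \<le> 16 * smear f (pt p)"
      using smear_peetre[OF f dist_pt_cell[OF w(1)]] by simp
    finally have 1: "norm (H w) \<le> exp (4 * lattice_const) * (eps r * (16 * smear f (pt p)))"
      using eps_pos[of r] by (simp add: H_def norm_power mult_left_mono)
    have nd: "norm (w - cz z) = dist (pz w) z" using dist_pz[of w "cz z"] by simp
    have 2: "norm (w - cz z) \<ge> 2" unfolding nd using far[OF z(1)] z(2) dist_triangle[of "pz w" k z] by linarith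
    have "dist z (pt p) \<le> norm (w - cz z) + 1"
      unfolding nd using dist_triangle[of z "pt p" "pz w"] dist_pt_cell[OF w(1)] by (simp add: dist_commute)
    moreover have "(1 + x) / 2 \<le> y" if "x \<le> y + 1" "2 \<le> y" for x y :: real using that by (simp add: field_simps)
    ultimately have 3: "(1 + dist z (pt p)) / 2 \<le> norm (w - cz z)" using 2 by blast
    have pos: "1 + dist z (pt p) > 0" by (simp add: add_pos_nonneg)
    have "norm (H w) / norm (w - cz z) \<le> (exp (4 * lattice_const) * (eps r * (16 * smear f (pt p)))) / ((1 + dist z (pt p)) / 2)"
      by (rule frac_le) (use 1 3 pos eps_pos[of r] smear_nonneg[of f] in auto)
    also have "\<dots> = 32 * exp (4 * lattice_const) * eps r * (smear f (pt p) / (1 + dist z (pt p)))"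
      by simp
    finally show ?thesis .
  qed
  show ?thesis
  proof (rule that[of "hor_bd S" "ver_bd S"])
    show "finite (hor_bd S)" "finite (ver_bd S)" using fin by (auto simp: hor_bd_def ver_bd_def)
    fix z k assume k: "k \<in> K" "dist z k < r / 2 - 3" and g: "fst z - 1/2 \<notin> \<int>" "snd z - 1/2 \<notin> \<int>"
    define w where "w = cz z"
    define p0 where "p0 = (round (Re w), round (Im w))"
    have in_p0: "w \<in> cell p0"
      unfolding cell_iff p0_def using of_int_round_abs_le[of "Re w"] of_int_round_abs_le[of "Im w"] by (simp add: abs_minus_commute)
    have ne: "\<bar>x - of_int m\<bar> \<noteq> 1/2" if "x - 1/2 \<notin> \<int>" for x :: real and m
    proof
      assume "\<bar>x - of_int m\<bar> = 1/2"
      then have "x - 1/2 = of_int m \<or> x - 1/2 = of_int (m - 1)" by (auto simp: abs_if split: if_splits)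
      then show False using that by auto
    qed
    have g': "Re w - 1/2 \<notin> \<int>" "Im w - 1/2 \<notin> \<int>" using g Ints_half_uminus[of "snd z"] by (auto simp: w_def cz_def)
    have "\<bar>Re w - of_int (fst p0)\<bar> < 1/2" "\<bar>Im w - of_int (snd p0)\<bar> < 1/2"
      using in_p0 ne[OF g'(1), of "fst p0"] ne[OF g'(2), of "snd p0"] unfolding cell_iff by linarith+
    then have int: "w \<in> interior (cell p0)"
      unfolding cell_def interior_cbox in_box_complex_iff by (auto simp: abs_if split: if_splits)
    have zw: "pz w = z" by (simp add: w_def)
    have p0S: "p0 \<in> S"
      using dist_triangle[of "pt p0" k z] dist_pt_cell[OF in_p0] k unfolding S_def zw by (auto simp: dist_commute intro!: bexI[of _ k])
    define G where "G p = 32 * exp (4 * lattice_const) * eps r * (smear f (pt p) / (1 + dist z (pt p)))" for p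
    have "norm (H w) \<le> (\<Sum>p\<in>hor_bd S. G p) + (\<Sum>p\<in>ver_bd S. G p)"
    proof (rule grid_cauchy_bound[OF fin H _ p0S int])
      show "cell p \<subseteq> \<Omega>" if "p \<in> S" for p using cellS[OF that] by auto
      show "norm (H v) / norm (v - w) \<le> G p" if p: "p \<in> hor_bd S" and v: "v \<in> hor p" for p v
      proof -
        obtain q q' where q: "q \<in> S" "v \<in> cell q" "q' \<notin> S" "v \<in> cell q'" using hor_bd_cases[OF p v] .
        have "v \<in> cell p" "Im v - 1/2 \<in> \<int>" using v by (auto simp: hor_iff cell_iff)
        then show ?thesis unfolding G_def w_def using edge[OF q] k by blast
      qed
      show "norm (H v) / norm (v - w) \<le> G p" if p: "p \<in> ver_bd S" and v: "v \<in> ver p" for p v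
      proof -
        obtain q q' where q: "q \<in> S" "v \<in> cell q" "q' \<notin> S" "v \<in> cell q'" using ver_bd_cases[OF p v] .
        have "v \<in> cell p" "Re v - 1/2 \<in> \<int>" using v by (auto simp: ver_iff cell_iff)
        then show ?thesis unfolding G_def w_def using edge[OF q] k by blast
      qed
    qed
    also have "\<dots> = 32 * exp (4 * lattice_const) * eps r * (smear_pot f (hor_bd S) z + smear_pot f (ver_bd S) z)"
      unfolding G_def smear_pot_def by (simp only: sum_distrib_left distrib_left)
    finally have 1: "norm (H w) \<le> 32 * exp (4 * lattice_const) * eps r * (smear_pot f (hor_bd S) z + smear_pot f (ver_bd S) z)" .
    have wO: "w \<in> \<Omega>" using cellS[OF p0S in_p0] .
    have "norm (theta N w) * exp (- (pi * (Re w)\<^sup>2)) \<le> exp (pi + lattice_const)"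
      by (rule theta_upper[OF ReN]) (use wO in \<open>simp add: \<Omega>_def\<close>)
    from mult_right_mono[OF this, of "norm (h w)"]
    have "norm (gab f z) \<le> exp (pi + lattice_const) * norm (h w)"
      using gh[OF wO] unfolding zw by simp
    then have "(norm (gab f z))\<^sup>2 \<le> (exp (pi + lattice_const) * norm (h w))\<^sup>2" by (intro power_mono) auto
    also have "\<dots> = exp (2 * (pi + lattice_const)) * norm (H w)"
      by (simp only: power_mult_distrib exp_double H_def norm_power)
    also have "\<dots> \<le> exp (2 * (pi + lattice_const)) * (32 * exp (4 * lattice_const) * eps r * (smear_pot f (hor_bd S) z + smear_pot f (ver_bd S) z))"
      by (intro mult_left_mono 1) auto
    finally show "(norm (gab f z))\<^sup>2 \<le> inner_const * eps r * (smear_pot f (hor_bd S) z + smear_pot f (ver_bd S) z)"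
      by (simp only: inner_const_def mult.assoc)
  qed
qed

section \<open>Integration of the pointwise estimates\<close>

lemma smear_total:
  assumes f: "f \<in> L2"
  shows "integrable lborel (smear f)" "(LINT z|lborel. smear f z) = (L2_norm f)\<^sup>2 * (LINT z|lborel. ker z)"
proof -
  note [measurable] = gab_measurable[OF f]
  have k: "integrable lborel (\<lambda>z. ker (z - w))" "(LINT z|lborel. ker (z - w)) = (LINT z|lborel. ker z)" for w
    using lborel_integral_shift(1,2)[OF ker_integrable] by auto
  have i: "integrable (lborel \<Otimes>\<^sub>M lborel) (\<lambda>(w, z). (norm (gab f w))\<^sup>2 * ker (z - w))"
  proof (rule lborel_pair.Fubini_integrable)
    show "integrable lborel (\<lambda>w. LINT z|lborel. norm (case (w, z) of (w, z) \<Rightarrow> (norm (gab f w))\<^sup>2 * ker (z - w)))"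
      using gab_plancherel(1)[OF f] by (simp add: abs_mult k)
    show "AE w in lborel. integrable lborel (\<lambda>z. case (w, z) of (w, z) \<Rightarrow> (norm (gab f w))\<^sup>2 * ker (z - w))"
      using k by simp
  qed measurable
  show "integrable lborel (smear f)"
    using lborel_pair.integrable_snd[OF i] unfolding smear_def[abs_def] .
  have "(LINT z|lborel. smear f z) = (LINT w|lborel. (LINT z|lborel. (norm (gab f w))\<^sup>2 * ker (z - w)))"
    unfolding smear_def by (rule lborel_pair.Fubini_integral[OF i])
  also have "\<dots> = (L2_norm f)\<^sup>2 * (LINT z|lborel. ker z)"
    by (simp add: k gab_plancherel(2)[OF f])
  finally show "(LINT z|lborel. smear f z) = (L2_norm f)\<^sup>2 * (LINT z|lborel. ker z)" .
qed

text \<open>Uniformity in \<open>P\<close> is the point: the number of contour edges grows with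
  \<open>K\<close>, this sum does not.\<close>

lemma smear_lattice_sum:
  assumes f: "f \<in> L2" and P: "finite P"
  shows "(\<Sum>p\<in>P. smear f (pt p)) \<le> lattice_const\<^sup>2 * (L2_norm f)\<^sup>2"
proof -
  have le: "(\<Sum>p\<in>P. ker (pt p - w)) \<le> lattice_const\<^sup>2" for w
  proof -
    have inj: "inj_on (\<lambda>(m, n). (m, - n)) P" by (auto simp: inj_on_def)
    have "(\<Sum>p\<in>P. ker (pt p - w)) = (\<Sum>(m, n)\<in>(\<lambda>(m, n). (m, - n)) ` P. ker ((of_int m, of_int n) - w))"
      unfolding sum.reindex[OF inj] by (rule sum.cong) (auto simp: pt_def)
    also have "\<dots> \<le> lattice_const\<^sup>2" by (rule sum_ker_lattice) (use P in auto)
    finally show ?thesis .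
  qed
  have "(\<Sum>p\<in>P. smear f (pt p)) = (LINT w|lborel. (\<Sum>p\<in>P. (norm (gab f w))\<^sup>2 * ker (pt p - w)))"
    unfolding smear_def by (rule Bochner_Integration.integral_sum[symmetric]) (rule smear_integrable[OF f])
  also have "\<dots> \<le> (LINT w|lborel. lattice_const\<^sup>2 * (norm (gab f w))\<^sup>2)"
  proof (rule integral_mono)
    show "integrable lborel (\<lambda>w. \<Sum>p\<in>P. (norm (gab f w))\<^sup>2 * ker (pt p - w))"
      by (intro Bochner_Integration.integrable_sum smear_integrable f)
    show "integrable lborel (\<lambda>w. lattice_const\<^sup>2 * (norm (gab f w))\<^sup>2)"
      using gab_plancherel(1)[OF f] by simp
    fix w
    show "(\<Sum>p\<in>P. (norm (gab f w))\<^sup>2 * ker (pt p - w)) \<le> lattice_const\<^sup>2 * (norm (gab f w))\<^sup>2"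
      using mult_left_mono[OF le[of w], of "(norm (gab f w))\<^sup>2"]
      by (simp add: sum_distrib_right[symmetric] mult.commute)
  qed
  also have "\<dots> = lattice_const\<^sup>2 * (L2_norm f)\<^sup>2" by (simp add: gab_plancherel(2)[OF f])
  finally show ?thesis .
qed

text \<open>Discards the grid lines, where the point would lie on an edge and Cauchy's formula for a
  single cell would fail.\<close>

lemma AE_generic: "AE z in (lborel :: (real \<times> real) measure). fst z - 1/2 \<notin> \<int> \<and> snd z - 1/2 \<notin> \<int>"
proof -
  have line: "AE z in (lborel :: (real \<times> real) measure). a \<bullet> z \<noteq> c" if "a \<noteq> 0" for a c
  proof (rule AE_I')
    have "negligible {z. a \<bullet> z = c}" by (rule negligible_hyperplane) (use that in simp)
    moreover have "{z. a \<bullet> z = c} \<in> sets lborel" by (simp add: closed_hyperplane borel_closed)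
    ultimately show "{z. a \<bullet> z = c} \<in> null_sets lborel"
      by (metis negligible_iff_null_sets null_sets_completion_iff)
  qed auto
  have 1: "AE z in (lborel :: (real \<times> real) measure). fst z \<noteq> c" for c
    using line[of "(1, 0)" c] by (simp add: inner_prod_def zero_prod_def)
  have 2: "AE z in (lborel :: (real \<times> real) measure). snd z \<noteq> c" for c
    using line[of "(0, 1)" c] by (simp add: inner_prod_def zero_prod_def)
  have "AE z in (lborel :: (real \<times> real) measure). \<forall>m::int. fst z \<noteq> of_int m + 1/2 \<and> snd z \<noteq> of_int m + 1/2"
    unfolding AE_all_countable using 1 2 by (auto intro: AE_conjI)
  then show ?thesis
  proof eventually_elim
    case (elim z)
    have "x - 1/2 \<notin> \<int>" if "\<And>m::int. x \<noteq> of_int m + 1/2" for x :: real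
    proof
      assume "x - 1/2 \<in> \<int>"
      then obtain m where "x - 1/2 = of_int m" by (auto elim: Ints_cases)
      then have "x = of_int m + 1/2" by simp
      then show False using that by blast
    qed
    then show ?case using elim by blast
  qed
qed

text \<open>The squared norm dual to \<open>H_norm\<close>, restricted to \<open>D\<close>.\<close>

definition energy :: "real \<Rightarrow> (real \<times> real) set \<Rightarrow> (real \<Rightarrow> complex) \<Rightarrow> real" where
  "energy d D f = (LINT z|lborel. indicator D z * ((norm (gab f z))\<^sup>2 * hweight d z))"

text \<open>Away from \<open>K\<close> the weight is at most 1 and the integral of
  \<open>smear\<close> is known. Near \<open>K\<close> the sum over edges and the integral are
  exchanged: the weighted Cauchy kernel integrates to at most \<open>C0\<close> whatever its pole,
  and \<open>smear_lattice_sum\<close> does the rest.\<close>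

lemma vanishing_energy:
  assumes d: "d > 1"
  obtains C where "C > 0"
    "\<And>f K r. f \<in> L2 \<Longrightarrow> bounded K \<Longrightarrow> r \<ge> 24200 \<Longrightarrow> vanishing f K (neighborhood r K) \<Longrightarrow>
      energy d (neighborhood r K) f \<le> C * eps r * (L2_norm f)\<^sup>2"
proof -
  obtain C0 where C0: "C0 > 0" and Ci: "\<And>z0. integrable lborel (\<lambda>z. hweight d z / (1 + norm (z - z0)))"
    and Cle: "\<And>z0. (LINT z|lborel. hweight d z / (1 + norm (z - z0))) \<le> C0"
    using hweight_convolution[OF d] by blast
  define \<kappa> where "\<kappa> = (LINT z|lborel. ker z)"
  have \<kappa>: "\<kappa> \<ge> 0" unfolding \<kappa>_def by simp
  define C where "C = \<kappa> + 2 * (inner_const * C0 * lattice_const\<^sup>2) + 1"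
  have "C > 0" unfolding C_def using \<kappa> inner_const_pos C0 by (intro add_nonneg_pos add_nonneg_nonneg mult_nonneg_nonneg) auto
  moreover have "energy d (neighborhood r K) f \<le> C * eps r * (L2_norm f)\<^sup>2"
    if f: "f \<in> L2" and K: "bounded K" and r: "r \<ge> 24200" and van: "vanishing f K (neighborhood r K)" for f K r
  proof -
    note [measurable] = gab_measurable[OF f]
    let ?D = "neighborhood r K"
    have [measurable]: "?D \<in> sets borel" using open_neighborhood by (rule borel_open)
    obtain P Q where PQ: "finite P" "finite Q" and inner: "\<And>z k. k \<in> K \<Longrightarrow> dist z k < r / 2 - 3 \<Longrightarrow> fst z - 1/2 \<notin> \<int> \<Longrightarrow> snd z - 1/2 \<notin> \<int> \<Longrightarrow>
       (norm (gab f z))\<^sup>2 \<le> inner_const * eps r * (smear_pot f P z + smear_pot f Q z)"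
      using inner_estimate[OF f van r K] by blast
    define g where "g p z = smear f (pt p) * (hweight d z / (1 + norm (z - pt p)))" for p z
    have g0: "g p z \<ge> 0" for p z unfolding g_def using smear_nonneg hweight_bounds(1)[of d z] by simp
    have gi: "integrable lborel (g p)" for p unfolding g_def[abs_def] by (intro integrable_mult_right Ci)
    have gle: "(LINT z|lborel. g p z) \<le> smear f (pt p) * C0" for p
      unfolding g_def integral_mult_right_zero by (intro mult_left_mono Cle smear_nonneg)
    define R where "R z = eps r * smear f z + inner_const * eps r * ((\<Sum>p\<in>P. g p z) + (\<Sum>p\<in>Q. g p z))" for z
    have Ri: "integrable lborel R" unfolding R_def[abs_def]
      by (intro Bochner_Integration.integrable_add integrable_mult_right Bochner_Integration.integrable_sum smear_total f gi)
    have s0: "0 \<le> (\<Sum>p\<in>P. g p z) + (\<Sum>p\<in>Q. g p z)" for z by (intro add_nonneg_nonneg sum_nonneg g0)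
    have t1: "0 \<le> eps r * smear f z" for z using eps_pos[of r] smear_nonneg[of f z] by simp
    have t2: "0 \<le> inner_const * eps r * ((\<Sum>p\<in>P. g p z) + (\<Sum>p\<in>Q. g p z))" for z
      using eps_pos[of r] inner_const_pos s0[of z] by simp
    have Li: "integrable lborel (\<lambda>z. indicator ?D z * ((norm (gab f z))\<^sup>2 * hweight d z))"
    proof (rule Bochner_Integration.integrable_bound[OF gab_plancherel(1)[OF f]])
      show "AE z in lborel. norm (indicator ?D z * ((norm (gab f z))\<^sup>2 * hweight d z)) \<le> norm ((norm (gab f z))\<^sup>2)"
        using hweight_bounds[of d] by (auto simp: abs_mult indicator_def mult_left_le less_imp_le abs_of_pos)
    qed measurable
    have "energy d ?D f \<le> (LINT z|lborel. R z)"
      unfolding energy_def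
    proof (rule integral_mono_AE[OF Li Ri])
      show "AE z in lborel. indicator ?D z * ((norm (gab f z))\<^sup>2 * hweight d z) \<le> R z"
        using AE_generic
      proof eventually_elim
        case (elim z)
        \<comment> \<open>The two estimates overlap, as r / 4 < r / 2 - 3; the cases split at r /
          4.\<close>
        consider "z \<notin> ?D" | "z \<in> ?D" "\<forall>k\<in>K. dist z k \<ge> r / 4" | k where "k \<in> K" "dist z k < r / 4" by force
        then show ?case
        proof cases
          case 1
          then show ?thesis using t1[of z] t2[of z] by (simp add: R_def)
        next
          case 2
          have "(norm (gab f z))\<^sup>2 * hweight d z \<le> (norm (gab f z))\<^sup>2 * 1"
            using hweight_bounds[of d z] by (intro mult_left_mono) auto
          also have "\<dots> \<le> eps r * smear f z" using outer_estimate[OF f van r 2(1)] 2(2) by simp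
          also have "\<dots> \<le> R z" using t2[of z] by (simp add: R_def)
          finally show ?thesis using 2 by simp
        next
          case 3
          have "dist z k < r / 2 - 3" using 3 r by linarith
          from inner[OF 3(1) this] elim
          have "(norm (gab f z))\<^sup>2 * hweight d z \<le> (inner_const * eps r * (smear_pot f P z + smear_pot f Q z)) * hweight d z"
            using hweight_bounds[of d z] by (intro mult_right_mono) auto
          also have "\<dots> = inner_const * eps r * ((\<Sum>p\<in>P. g p z) + (\<Sum>p\<in>Q. g p z))"
            unfolding g_def smear_pot_def dist_norm by (simp add: sum_distrib_right distrib_right mult.assoc)
          also have "\<dots> \<le> R z" using t1[of z] by (simp add: R_def)
          finally have *: "(norm (gab f z))\<^sup>2 * hweight d z \<le> R z" .
          show ?thesis
            by (cases "z \<in> ?D") (use * t1[of z] t2[of z] in \<open>auto simp: R_def\<close>)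
        qed
      qed
    qed
    also have "(LINT z|lborel. R z) = eps r * (LINT z|lborel. smear f z) + inner_const * eps r * ((\<Sum>p\<in>P. (LINT z|lborel. g p z)) + (\<Sum>p\<in>Q. (LINT z|lborel. g p z)))"
      unfolding R_def by (simp add: smear_total f gi Bochner_Integration.integral_add Bochner_Integration.integral_sum)
    also have "\<dots> \<le> eps r * ((L2_norm f)\<^sup>2 * \<kappa>) + inner_const * eps r * (lattice_const\<^sup>2 * (L2_norm f)\<^sup>2 * C0 + lattice_const\<^sup>2 * (L2_norm f)\<^sup>2 * C0)"
    proof -
      have "(\<Sum>p\<in>F. (LINT z|lborel. g p z)) \<le> lattice_const\<^sup>2 * (L2_norm f)\<^sup>2 * C0" if "finite F" for F
      proof -
        have "(\<Sum>p\<in>F. (LINT z|lborel. g p z)) \<le> (\<Sum>p\<in>F. smear f (pt p)) * C0"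
          unfolding sum_distrib_right by (intro sum_mono gle)
        also have "\<dots> \<le> lattice_const\<^sup>2 * (L2_norm f)\<^sup>2 * C0"
          using C0 by (intro mult_right_mono smear_lattice_sum f that) auto
        finally show ?thesis .
      qed
      then show ?thesis
        unfolding smear_total(2)[OF f] \<kappa>_def using PQ eps_pos[of r] inner_const_pos
        by (intro add_mono mult_left_mono) auto
    qed
    also have "\<dots> = (\<kappa> + 2 * (inner_const * C0 * lattice_const\<^sup>2)) * (eps r * (L2_norm f)\<^sup>2)"
      by (simp add: algebra_simps)
    also have "\<dots> \<le> C * (eps r * (L2_norm f)\<^sup>2)"
      unfolding C_def using eps_pos[of r] by (intro mult_right_mono) auto
    finally show ?thesis by (simp only: mult.assoc)
  qed
  ultimately show ?thesis using that by blast
qed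

section \<open>Orthogonal projection onto finitely many functions\<close>

text \<open>Gram-Schmidt by induction over the index set; the functions may be linearly dependent.
  \<open>v\<close> is the part of the new function orthogonal to the old ones.\<close>

lemma L2_projection:
  assumes T: "finite T" and e: "\<And>t. t \<in> T \<Longrightarrow> e t \<in> L2" and f: "f \<in> L2"
  shows "\<exists>c. \<forall>t\<in>T. L2_inner (\<lambda>x. f x - (\<Sum>s\<in>T. c s * e s x)) (e t) = 0"
  using T e f
proof (induction T arbitrary: f rule: finite_induct)
  case (insert t T)
  have eL: "e s \<in> L2" if "s \<in> insert t T" for s using insert.prems(1) that by blast
  obtain c where c: "\<And>s. s \<in> T \<Longrightarrow> L2_inner (\<lambda>x. f x - (\<Sum>s\<in>T. c s * e s x)) (e s) = 0"
    using insert.IH[of f] insert.prems by auto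
  obtain b where b: "\<And>s. s \<in> T \<Longrightarrow> L2_inner (\<lambda>x. e t x - (\<Sum>s\<in>T. b s * e s x)) (e s) = 0"
    using insert.IH[of "e t"] insert.prems by auto
  define g where "g x = f x - (\<Sum>s\<in>T. c s * e s x)" for x
  define v where "v x = e t x - (\<Sum>s\<in>T. b s * e s x)" for x
  have g: "g \<in> L2" unfolding g_def by (intro L2_diff L2_sum L2_scale eL insert.prems) auto
  have v: "v \<in> L2" unfolding v_def by (intro L2_diff L2_sum L2_scale eL) auto
  have gT: "L2_inner g (e s) = 0" if "s \<in> T" for s using c[OF that] by (simp add: g_def[abs_def])
  have vT: "L2_inner v (e s) = 0" if "s \<in> T" for s using b[OF that] by (simp add: v_def[abs_def])
  \<comment> \<open>A function orthogonal to the old ones does not see the difference between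
    \<open>e t\<close> and \<open>v\<close>, so it suffices to correct along
    \<open>v\<close>.\<close>
  have split: "L2_inner u (e t) = L2_inner u v" if u: "u \<in> L2" "\<And>s. s \<in> T \<Longrightarrow> L2_inner u (e s) = 0" for u
  proof -
    have "L2_inner v u = L2_inner (e t) u - L2_inner (\<lambda>x. \<Sum>s\<in>T. b s * e s x) u"
      unfolding v_def[abs_def] by (intro L2_inner_diff L2_sum L2_scale eL u) auto
    also have "L2_inner (\<lambda>x. \<Sum>s\<in>T. b s * e s x) u = (\<Sum>s\<in>T. L2_inner (\<lambda>x. b s * e s x) u)"
      by (intro L2_inner_sum L2_scale eL u) auto
    also have "\<dots> = 0"
      by (rule sum.neutral) (use u(2) L2_inner_commute[of _ u] in \<open>auto simp: L2_inner_scale\<close>)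
    finally show ?thesis by (metis L2_inner_commute diff_zero)
  qed
  \<comment> \<open>If \<open>v\<close> is null, the coefficient 0 works, since Cauchy-Schwarz gives
    orthogonality to \<open>v\<close>.\<close>
  define a where "a = (if L2_norm v = 0 then 0 else L2_inner g v / of_real ((L2_norm v)\<^sup>2))"
  define w where "w x = g x - a * v x" for x
  have w: "w \<in> L2" unfolding w_def by (intro L2_diff L2_scale g v)
  have wi: "L2_inner w u = L2_inner g u - a * L2_inner v u" if "u \<in> L2" for u
    unfolding w_def[abs_def] by (subst L2_inner_diff) (auto simp: g v that L2_scale L2_inner_scale)
  have wT: "L2_inner w (e s) = 0" if "s \<in> T" for s using that by (simp add: wi eL gT vT)
  have "L2_inner w v = 0"
  proof (cases "L2_norm v = 0")
    case True
    then show ?thesis using L2_Cauchy_Schwarz[OF w v] by simp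
  next
    case False
    then show ?thesis unfolding wi[OF v] L2_inner_self a_def by simp
  qed
  then have wt: "L2_inner w (e t) = 0" using split[OF w wT] by simp
  have weq: "w x = f x - (\<Sum>s\<in>insert t T. (if s = t then a else c s - a * b s) * e s x)" for x
  proof -
    have "(\<Sum>s\<in>T. (if s = t then a else c s - a * b s) * e s x) = (\<Sum>s\<in>T. c s * e s x - a * (b s * e s x))"
      by (rule sum.cong) (use insert.hyps in \<open>auto simp: algebra_simps\<close>)
    then show ?thesis using insert.hyps
      by (simp add: w_def g_def v_def sum_subtractf sum_distrib_left[symmetric] algebra_simps)
  qed
  show ?case
    by (rule exI[of _ "\<lambda>s. if s = t then a else c s - a * b s"])
       (use wt wT in \<open>auto simp: weq[abs_def, symmetric]\<close>)
qed auto

section \<open>Projection and residual\<close>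

lemma norm_pz: "norm (pz w) = norm w"
  using dist_pz[of w 0] by (simp add: dist_norm pz_def flip: zero_prod_def)

lemma finite_Lambda_bounded:
  assumes "bounded D" shows "finite (\<Lambda> \<inter> D)" "finite (\<Lambda>_sharp \<inter> D)"
proof -
  obtain t where t: "\<And>z. z \<in> D \<Longrightarrow> norm z < t" using assms bounded_pos_less[of D] by auto
  have "\<Lambda> \<inter> D \<subseteq> pz ` (gauss_lattice 0 \<inter> ball 0 t)" "\<Lambda>_sharp \<inter> D \<subseteq> pz ` (gauss_lattice half_shift \<inter> ball 0 t)"
  proof -
    have *: "z \<in> pz ` (gauss_lattice s \<inter> ball 0 t)" if "z \<in> D" "cz z \<in> gauss_lattice s" for z s
      using that t[OF that(1)] norm_pz[of "cz z"] by (intro image_eqI[of _ _ "cz z"]) auto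
    show "\<Lambda> \<inter> D \<subseteq> pz ` (gauss_lattice 0 \<inter> ball 0 t)" "\<Lambda>_sharp \<inter> D \<subseteq> pz ` (gauss_lattice half_shift \<inter> ball 0 t)"
      using * pz_mem_Lambda[of "cz z" for z] pz_mem_Lambda_sharp[of "cz z" for z] by auto
  qed
  then show "finite (\<Lambda> \<inter> D)" "finite (\<Lambda>_sharp \<inter> D)"
    by (auto elim!: finite_subset intro: finite_gauss_lattice_ball)
qed

lemma Lambda_disjoint: "\<Lambda> \<inter> \<Lambda>_sharp = {}"
proof -
  have False if "z \<in> \<Lambda>" "z \<in> \<Lambda>_sharp" for z
    using that gauss_lattice_disjoint pz_mem_Lambda[of "cz z"] pz_mem_Lambda_sharp[of "cz z"] by auto
  then show ?thesis by blast
qed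

lemma set_integral_UNIV_diff:
  "(LINT z:(UNIV - D)|M. f z) = (LINT z|M. indicator (- D) z * (f z :: real))"
  unfolding set_lebesgue_integral_def by (simp add: Compl_eq_Diff_UNIV)

text \<open>Inside \<open>D\<close> the weight is distributed over the two transforms:
  \<open>b\<close> carries that of \<open>H_norm\<close>, \<open>c\<close> its reciprocal. The bound
  for \<open>c\<close> is proportional to \<open>L2_norm p\<close>, and so is the term from outside,
  hence one factor \<open>L2_norm p\<close> cancels.\<close>

lemma residual_bound:
  assumes f: "f \<in> H_delta d" and p: "p \<in> L2" and D: "D \<in> sets borel"
    and eq: "L2_inner f p = of_real ((L2_norm p)\<^sup>2)"
    and en: "energy d D p \<le> B\<^sup>2 * (L2_norm p)\<^sup>2" and B: "B \<ge> 0"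
  shows "L2_norm p \<le> sqrt (LINT z:(UNIV - D)|lborel. (norm (gab f z))\<^sup>2) + B * H_norm d f"
proof -
  have fL: "f \<in> L2" using f by (simp add: H_delta_def)
  note [measurable] = gab_measurable[OF fL] gab_measurable[OF p] D
  have n0: "L2_norm p \<ge> 0" by (simp add: L2_norm_def)
  have hw: "1 / hweight d z = norm z powr d + 1" for z by (simp add: hweight_def)
  have hp: "hweight d z > 0" for z by (rule hweight_bounds)
  define A where "A = sqrt (LINT z|lborel. indicator (- D) z * (norm (gab f z))\<^sup>2)"
  define a where "a z = indicator (- D) z * norm (gab f z)" for z
  define b where "b z = norm (gab f z) * sqrt (1 / hweight d z)" for z
  define c where "c z = indicator D z * (norm (gab p z) * sqrt (hweight d z))" for z
  have a2: "(a z)\<^sup>2 = indicator (- D) z * (norm (gab f z))\<^sup>2" for z by (simp add: a_def power_mult_distrib indicator_def)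
  have b2: "(b z)\<^sup>2 = (norm z powr d + 1) * (norm (L2_inner f (gabor z)))\<^sup>2" for z
    using hp[of z] unfolding b_def power_mult_distrib by (simp add: hw gab_def[symmetric] mult.commute)
  have c2: "(c z)\<^sup>2 = indicator D z * ((norm (gab p z))\<^sup>2 * hweight d z)" for z
    using hp[of z] by (simp add: c_def power_mult_distrib indicator_def less_imp_le)
  have ai: "integrable lborel (\<lambda>z. (a z)\<^sup>2)" unfolding a2
    by (rule Bochner_Integration.integrable_bound[OF gab_plancherel(1)[OF fL]]) (auto simp: indicator_def)
  have bi: "integrable lborel (\<lambda>z. (b z)\<^sup>2)" unfolding b2 using f by (simp add: H_delta_def)
  have ci: "integrable lborel (\<lambda>z. (c z)\<^sup>2)" unfolding c2
    by (rule Bochner_Integration.integrable_bound[OF gab_plancherel(1)[OF p]])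
       (use hweight_bounds[of d] in \<open>auto simp: indicator_def abs_mult mult_left_le less_imp_le abs_of_pos\<close>)
  have [measurable]: "a \<in> borel_measurable borel" "b \<in> borel_measurable borel" "c \<in> borel_measurable borel"
    unfolding a_def[abs_def] b_def[abs_def] c_def[abs_def] by measurable
  have split: "norm (gab f z * cnj (gab p z)) = \<bar>a z * norm (gab p z)\<bar> + \<bar>b z * c z\<bar>" for z
  proof -
    have "sqrt (1 / hweight d z) * sqrt (hweight d z) = 1" using hp[of z] by (simp flip: real_sqrt_mult)
    then have "b z * c z = indicator D z * (norm (gab f z) * norm (gab p z))"
      unfolding b_def c_def by (simp add: mult_ac)
    then show ?thesis by (simp add: a_def indicator_def norm_mult)
  qed
  have i1: "integrable lborel (\<lambda>z. \<bar>a z * norm (gab p z)\<bar>)"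
    using Cauchy_Schwarz_integral(1)[of a lborel "\<lambda>z. norm (gab p z)"] ai gab_plancherel(1)[OF p] by simp
  have i2: "integrable lborel (\<lambda>z. \<bar>b z * c z\<bar>)"
    using Cauchy_Schwarz_integral(1)[of b lborel c] bi ci by simp
  have "(L2_norm p)\<^sup>2 = norm (L2_inner f p)" unfolding eq by (simp only: norm_of_real abs_power2)
  also have "\<dots> \<le> (LINT z|lborel. norm (gab f z * cnj (gab p z)))"
    unfolding moyal[OF fL p] by (rule integral_norm_bound)
  also have "\<dots> = (LINT z|lborel. \<bar>a z * norm (gab p z)\<bar>) + (LINT z|lborel. \<bar>b z * c z\<bar>)"
    unfolding split by (rule Bochner_Integration.integral_add[OF i1 i2])
  also have "\<dots> \<le> sqrt (LINT z|lborel. (a z)\<^sup>2) * sqrt (LINT z|lborel. (norm (gab p z))\<^sup>2) + sqrt (LINT z|lborel. (b z)\<^sup>2) * sqrt (LINT z|lborel. (c z)\<^sup>2)"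
    by (intro add_mono Cauchy_Schwarz_integral(2)) (use ai bi ci gab_plancherel(1)[OF p] in auto)
  also have "\<dots> = A * L2_norm p + H_norm d f * sqrt (LINT z|lborel. (c z)\<^sup>2)"
    unfolding a2 b2 gab_plancherel(2)[OF p] A_def H_norm_def using n0 by simp
  also have "\<dots> \<le> A * L2_norm p + H_norm d f * (B * L2_norm p)"
  proof -
    have "sqrt (LINT z|lborel. (c z)\<^sup>2) \<le> sqrt ((B * L2_norm p)\<^sup>2)"
      using en unfolding c2 energy_def by (simp add: power_mult_distrib)
    then show ?thesis using B n0 by (intro add_left_mono mult_left_mono) (auto simp: H_norm_def)
  qed
  finally have "L2_norm p * L2_norm p \<le> (A + B * H_norm d f) * L2_norm p" by (simp add: power2_eq_square algebra_simps)
  moreover have "0 \<le> A + B * H_norm d f"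
    using B by (auto simp: A_def H_norm_def intro!: add_nonneg_nonneg mult_nonneg_nonneg)
  ultimately have "L2_norm p \<le> A + B * H_norm d f" using n0 by (cases "L2_norm p = 0") auto
  then show ?thesis unfolding A_def set_integral_UNIV_diff .
qed

theorem theorem10p1:
  "\<exists>r\<^sub>0 > 0. \<exists>C :: real \<Rightarrow> real.
     \<forall>K D :: (real \<times> real) set. \<forall>r \<ge> r\<^sub>0.
       bounded_domain K \<longrightarrow> bounded_domain D \<longrightarrow> K \<subseteq> D \<longrightarrow> D = neighborhood r K \<longrightarrow>
       (\<forall>f \<in> H_space. \<exists>(\<alpha> :: real \<times> real \<Rightarrow> complex) (\<omega> :: real \<times> real \<Rightarrow> complex). \<exists>\<phi> \<in> L2.
          (AE x in lborel. f x = (\<Sum>z\<in>\<Lambda> \<inter> D. \<alpha> z * gabor z x)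
                               + (\<Sum>\<mu>\<in>\<Lambda>_sharp \<inter> (D - K). \<omega> \<mu> * gabor \<mu> x) + \<phi> x) \<and>
          (\<forall>\<delta> > 1. f \<in> H_delta \<delta> \<longrightarrow>
             L2_norm \<phi> \<le> sqrt (LINT \<mu>:(UNIV - D)|lborel. (norm (L2_inner f (gabor \<mu>)))\<^sup>2)
                        + C \<delta> * r powr \<delta> * exp (- r / exp 1) * H_norm \<delta> f))"
proof -
  define Pr where "Pr d C \<longleftrightarrow> C > 0 \<and> (\<forall>f K r. f \<in> L2 \<longrightarrow> bounded K \<longrightarrow> r \<ge> 24200 \<longrightarrow> vanishing f K (neighborhood r K) \<longrightarrow>
      energy d (neighborhood r K) f \<le> C * eps r * (L2_norm f)\<^sup>2)" for d C
  \<comment> \<open>The constants must be fixed as a function of \<delta> before \<open>K\<close>,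
    \<open>D\<close>, \<open>r\<close> and \<open>f\<close>; choice extracts them from
    \<open>vanishing_energy\<close>.\<close>
  define C0 where "C0 d = (SOME C. Pr d C)" for d
  have Pr: "Pr d (C0 d)" if d: "d > 1" for d
  proof -
    have "\<exists>C. Pr d C" unfolding Pr_def by (rule vanishing_energy[OF d]) (intro exI conjI allI impI)
    then show ?thesis unfolding C0_def by (rule someI_ex)
  qed
  have C0: "C0 d > 0" if "d > 1" for d using Pr[OF that] by (simp add: Pr_def)
  have bound: "energy d (neighborhood r K) f \<le> C0 d * eps r * (L2_norm f)\<^sup>2"
    if "d > 1" "f \<in> L2" "bounded K" "r \<ge> 24200" "vanishing f K (neighborhood r K)" for d f K r
    using Pr[OF that(1)] that(2-) by (simp add: Pr_def)
  \<comment> \<open>The energy bound concerns squares: 2048 is the prefactor of \<open>eps\<close>,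
    and the root of its exponential is exp (- r / e).\<close>
  define C where "C d = sqrt (2048 * C0 d)" for d
  have main: "\<exists>(\<alpha> :: real \<times> real \<Rightarrow> complex) (\<omega> :: real \<times> real \<Rightarrow> complex). \<exists>\<phi> \<in> L2.
          (AE x in lborel. f x = (\<Sum>z\<in>\<Lambda> \<inter> D. \<alpha> z * gabor z x)
                               + (\<Sum>\<mu>\<in>\<Lambda>_sharp \<inter> (D - K). \<omega> \<mu> * gabor \<mu> x) + \<phi> x) \<and>
          (\<forall>\<delta> > 1. f \<in> H_delta \<delta> \<longrightarrow>
             L2_norm \<phi> \<le> sqrt (LINT \<mu>:(UNIV - D)|lborel. (norm (L2_inner f (gabor \<mu>)))\<^sup>2)
                        + C \<delta> * r powr \<delta> * exp (- r / exp 1) * H_norm \<delta> f)"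
    if K: "bounded_domain K" and D: "bounded_domain D" and DK: "D = neighborhood r K" and r: "r \<ge> 24200" and f: "f \<in> H_space" for K D r f
  proof -
    have fL: "f \<in> L2" using f by (auto simp: H_space_def H_delta_def)
    have Kb: "bounded K" and Db: "bounded D" using K D by (auto simp: bounded_domain_def)
    define T where "T = (\<Lambda> \<inter> D) \<union> (\<Lambda>_sharp \<inter> (D - K))"
    have fin: "finite (\<Lambda> \<inter> D)" "finite (\<Lambda>_sharp \<inter> (D - K))"
      using finite_Lambda_bounded[OF Db] finite_Lambda_bounded[OF bounded_subset[OF Db, of "D - K"]] by auto
    \<comment> \<open>The projection makes no reference to \<delta>, so one decomposition serves all
      \<delta> > 1; its coefficients provide both \<alpha> and \<omega>.\<close>
    obtain c where c: "\<And>t. t \<in> T \<Longrightarrow> L2_inner (\<lambda>x. f x - (\<Sum>s\<in>T. c s * gabor s x)) (gabor t) = 0"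
      using L2_projection[of T gabor f] fin gabor_L2 fL by (auto simp: T_def)
    define \<phi> where "\<phi> x = f x - (\<Sum>s\<in>T. c s * gabor s x)" for x
    have SL: "(\<lambda>x. \<Sum>s\<in>T. c s * gabor s x) \<in> L2" by (intro L2_sum L2_scale gabor_L2)
    have \<phi>L: "\<phi> \<in> L2" unfolding \<phi>_def by (intro L2_diff fL SL)
    have ort: "gab \<phi> t = 0" if "t \<in> T" for t using c[OF that] by (simp add: gab_def \<phi>_def[abs_def])
    have van: "vanishing \<phi> K (neighborhood r K)" using ort by (auto simp: vanishing_def T_def DK)
    have "L2_inner (\<lambda>x. \<Sum>s\<in>T. c s * gabor s x) \<phi> = (\<Sum>s\<in>T. c s * L2_inner (gabor s) \<phi>)"
      by (subst L2_inner_sum) (auto simp: L2_scale gabor_L2 \<phi>L L2_inner_scale)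
    also have "\<dots> = 0"
      by (rule sum.neutral) (use ort L2_inner_commute[of _ \<phi>] in \<open>auto simp: gab_def\<close>)
    finally have "L2_inner \<phi> \<phi> = L2_inner f \<phi>"
      unfolding \<phi>_def[abs_def] by (subst L2_inner_diff) (auto simp: fL SL \<phi>L[unfolded \<phi>_def[abs_def]])
    then have eq: "L2_inner f \<phi> = of_real ((L2_norm \<phi>)\<^sup>2)" by (simp add: L2_inner_self)
    have sumT: "(\<Sum>s\<in>T. c s * gabor s x) = (\<Sum>z\<in>\<Lambda> \<inter> D. c z * gabor z x) + (\<Sum>\<mu>\<in>\<Lambda>_sharp \<inter> (D - K). c \<mu> * gabor \<mu> x)" for x
      unfolding T_def by (rule sum.union_disjoint) (use fin Lambda_disjoint in auto)
    have "L2_norm \<phi> \<le> sqrt (LINT \<mu>:(UNIV - D)|lborel. (norm (L2_inner f (gabor \<mu>)))\<^sup>2) + C \<delta> * r powr \<delta> * exp (- r / exp 1) * H_norm \<delta> f"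
      if d: "\<delta> > 1" and fd: "f \<in> H_delta \<delta>" for \<delta>
    proof -
      have B2: "(C \<delta> * exp (- r / exp 1))\<^sup>2 = C0 \<delta> * eps r"
        using C0[OF d] by (simp add: C_def power_mult_distrib eps_def exp_double[symmetric])
      have "L2_norm \<phi> \<le> sqrt (LINT z:(UNIV - D)|lborel. (norm (gab f z))\<^sup>2) + (C \<delta> * exp (- r / exp 1)) * H_norm \<delta> f"
      proof (rule residual_bound[OF fd \<phi>L _ eq])
        show "D \<in> sets borel" using D by (auto simp: bounded_domain_def intro: borel_open)
        show "energy \<delta> D \<phi> \<le> (C \<delta> * exp (- r / exp 1))\<^sup>2 * (L2_norm \<phi>)\<^sup>2"
          unfolding B2 DK by (rule bound[OF d \<phi>L Kb r van])
        show "0 \<le> C \<delta> * exp (- r / exp 1)" using C0[OF d] by (simp add: C_def)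
      qed
      also have "(C \<delta> * exp (- r / exp 1)) * H_norm \<delta> f \<le> (C \<delta> * r powr \<delta> * exp (- r / exp 1)) * H_norm \<delta> f"
      proof (rule mult_right_mono)
        have "1 \<le> r powr \<delta>" using r d by (intro ge_one_powr_ge_zero) auto
        then have "C \<delta> * 1 \<le> C \<delta> * r powr \<delta>" using C0[OF d] by (intro mult_left_mono) (auto simp: C_def)
        then show "C \<delta> * exp (- r / exp 1) \<le> C \<delta> * r powr \<delta> * exp (- r / exp 1)" by (simp add: mult_right_mono)
      qed (simp add: H_norm_def)
      finally show ?thesis by (simp add: gab_def)
    qed
    moreover have "AE x in lborel. f x = (\<Sum>z\<in>\<Lambda> \<inter> D. c z * gabor z x) + (\<Sum>\<mu>\<in>\<Lambda>_sharp \<inter> (D - K). c \<mu> * gabor \<mu> x) + \<phi> x"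
      by (simp add: \<phi>_def sumT)
    ultimately show ?thesis using \<phi>L by blast
  qed
  show ?thesis
  proof (rule exI[of _ 24200], intro conjI exI[of _ C] allI impI ballI)
    show "0 < (24200 :: real)" by simp
  qed (rule main; assumption)
qed

end
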